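(* Any geometric data $(\gamma,\Pi^V,\mathbb F)$ on a vector bundle $p:E\to P$ induces a Dirac structure on the total space $E$.
   Context: Dirac structures: on $TE\oplus T^*E$ consider the pairing $\langle (X_1,\alpha_1),(X_2,\alpha_2)\rangle=\frac12(i_{X_2}\alpha_1+i_{X_1}\alpha_2)$ and the Courant bracket $[(X_1,\alpha_1),(X_2,\alpha_2)]=([X_1,X_2],\mathcal L_{X_1}\alpha_2-i_{X_2}d\alpha_1)$. A Dirac structure on $E$ is a smooth maximal isotropic subbundle of $TE\oplus T^*E$ whose space of sections is closed under this bracket. Geometric data: let $Vert=\ker dp\subset TE$. A geometric data on $p:E\to P$ consists of an Ehresmann connection $\gamma:TE\to Vert$ (at each $e\in E$, $\gamma_e:T_eE\to Vert_e$ is a projection; $Hor=\ker\gamma$, so $TE=Hor\oplus Vert$, and $hor(u)$ denotes the horizontal lift of a vector field $u\in\chi(P)$), a vertical bivector field $\Pi^V$ (a section of $\Lambda^2Vert$), and a 2-form $\mathbb F\in\Omega^2(P)\otimes C^\infty(E)$ (not necessarily nondegenerate) such that (i) $[\Pi^V,\Pi^V]=0$ (Schouten bracket); (ii) $[hor(u),\Pi^V]=0$ for all $u\in\chi(P)$; (iii) $\partial_\gamma\mathbb F=0$; (iv) $\mathrm{Curv}_\gamma(u,v)=(\Pi^V)^\sharp(d(\mathbb F(u,v)))$ for all $u,v\in\chi(P)$, where $\mathrm{Curv}_\gamma(u,v)=[hor(u),hor(v)]-hor([u,v])$, $\beta(\Pi^\sharp\alpha)=\Pi(\alpha,\beta)$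 for 1-forms $\alpha,\beta$, and, for $\mathbb G\in\Omega^k(P)\otimes C^\infty(E)$, $$\partial_\gamma\mathbb G(u_0,\dots,u_k)=\sum_{i=0}^k(-1)^i\mathcal L_{hor(u_i)}\big(\mathbb G(u_0,\dots,\widehat{u_i},\dots,u_k)\big)+\sum_{i<j}(-1)^{i+j}\mathbb G([u_i,u_j],u_0,\dots,\widehat{u_i},\dots,\widehat{u_j},\dots,u_k).$$ *)

theory Defs
  imports "HOL-Analysis.Analysis" "HOL-Library.Function_Algebras"
begin

section \<open>Function spaces as real vector spaces\<close>

text \<open>
  Tangent vectors and covectors are represented below as real-valued functions. With the pointwise
  vector space structure on function types, \<^const>\<open>subspace\<close>, \<^const>\<open>span\<close> and
  \<^const>\<open>independent\<close> apply to them and to the pairs that make up \<open>TM \<oplus> T\<^sup>*M\<close>.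
\<close>

instantiation "fun" :: (type, real_vector) real_vector
begin

definition scaleR_fun :: "real \<Rightarrow> ('a \<Rightarrow> 'b) \<Rightarrow> 'a \<Rightarrow> 'b"
  where "scaleR_fun c f = (\<lambda>x. c *\<^sub>R f x)"

instance
  by standard (simp_all add: scaleR_fun_def plus_fun_def scaleR_add_right scaleR_add_left)

end

definition linear_on :: "'a::real_vector set \<Rightarrow> ('a \<Rightarrow> 'b::real_vector) \<Rightarrow> bool"
  where "linear_on S f \<longleftrightarrow>
    (\<forall>x\<in>S. \<forall>y\<in>S. f (x + y) = f x + f y) \<and> (\<forall>c. \<forall>x\<in>S. f (c *\<^sub>R x) = c *\<^sub>R f x)"

definition alternating_bilinear_on :: "'a::real_vector set \<Rightarrow> ('a \<Rightarrow> 'a \<Rightarrow> real) \<Rightarrow> bool"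
  where "alternating_bilinear_on S B \<longleftrightarrow>
    (\<forall>x\<in>S. linear_on S (B x)) \<and> (\<forall>y\<in>S. linear_on S (\<lambda>x. B x y)) \<and> (\<forall>x\<in>S. B x x = 0)"


section \<open>Smooth manifolds\<close>

fun Ck_on :: "nat \<Rightarrow> 'v::real_normed_vector set \<Rightarrow> ('v \<Rightarrow> 'w::real_normed_vector) \<Rightarrow> bool"
  where
    "Ck_on 0 S f \<longleftrightarrow> continuous_on S f"
  | "Ck_on (Suc k) S f \<longleftrightarrow>
      (\<forall>x\<in>S. f differentiable (at x)) \<and> (\<forall>h. Ck_on k S (\<lambda>x. frechet_derivative f (at x) h))"

text \<open>Only used for open \<open>S\<close> and finite-dimensional domains.\<close>

definition smooth_on :: "'v::real_normed_vector set \<Rightarrow> ('v \<Rightarrow> 'w::real_normed_vector) \<Rightarrow> bool"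
  where "smooth_on S f \<longleftrightarrow> (\<forall>k. Ck_on k S f)"

type_synonym ('a, 'v) chart = "'a set \<times> ('a \<Rightarrow> 'v)"

text \<open>
  A manifold is a whole type with a Hausdorff, second countable topology, together with a smooth
  atlas. Charts take values in a finite-dimensional real inner product space rather than in the
  type class \<^class>\<open>euclidean_space\<close>, because the latter excludes dimension 0.
\<close>

definition finite_dimensional :: "'v::real_vector itself \<Rightarrow> bool"
  where "finite_dimensional TYPE('v) \<longleftrightarrow> (\<exists>B::'v set. finite B \<and> span B = UNIV)"

definition smooth_atlas ::
    "('a::{t2_space,second_countable_topology}, 'v::real_inner) chart set \<Rightarrow> bool"
  where "smooth_atlas A \<longleftrightarrow>
    finite_dimensional TYPE('v) \<and>
    (\<Union>(U, \<phi>)\<in>A. U) = UNIV \<and>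
    (\<forall>(U, \<phi>)\<in>A. open U \<and> open (\<phi> ` U) \<and> homeomorphism U (\<phi> ` U) \<phi> (inv_into U \<phi>)) \<and>
    (\<forall>(U, \<phi>)\<in>A. \<forall>(V, \<psi>)\<in>A. smooth_on (\<phi> ` (U \<inter> V)) (\<psi> \<circ> inv_into U \<phi>))"

definition smooth_map_on ::
    "('a::topological_space, 'v::real_normed_vector) chart set \<Rightarrow>
     ('b::topological_space, 'w::real_normed_vector) chart set \<Rightarrow> 'a set \<Rightarrow> ('a \<Rightarrow> 'b) \<Rightarrow> bool"
  where "smooth_map_on A B S f \<longleftrightarrow>
    (\<forall>x\<in>S. \<exists>(U, \<phi>)\<in>A. \<exists>(V, \<psi>)\<in>B. \<exists>W. open W \<and> x \<in> W \<and> W \<subseteq> U \<inter> S \<and> f ` W \<subseteq> V \<and>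
       smooth_on (\<phi> ` W) (\<psi> \<circ> f \<circ> inv_into U \<phi>))"

definition model_atlas :: "('v, 'v) chart set"
  where "model_atlas = {(UNIV, id)}"

definition prod_model_atlas :: "('a, 'v) chart set \<Rightarrow> ('a \<times> 'f, 'v \<times> 'f) chart set"
  where "prod_model_atlas A = (\<lambda>(U, \<phi>). (U \<times> UNIV, map_prod \<phi> id)) ` A"

abbreviation smooth_fun_on ::
    "('a::topological_space, 'v::real_normed_vector) chart set \<Rightarrow> 'a set \<Rightarrow> ('a \<Rightarrow> real) \<Rightarrow> bool"
  where "smooth_fun_on A U f \<equiv> smooth_map_on A model_atlas U f"

definition smooth_funs ::
    "('a::topological_space, 'v::real_normed_vector) chart set \<Rightarrow> ('a \<Rightarrow> real) set"
  where "smooth_funs A = {f. smooth_fun_on A UNIV f}"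


section \<open>Tangent and cotangent spaces\<close>

text \<open>
  Tangent vectors at \<open>x\<close> are the derivations at \<open>x\<close> of the algebra of smooth functions. They are
  extended by 0 to all functions, and covectors are extended by 0 to everything that is not a
  tangent vector, so that equality of vectors and of covectors is equality of functions.
\<close>

type_synonym 'a tvec = "('a \<Rightarrow> real) \<Rightarrow> real"
type_synonym 'a covec = "'a tvec \<Rightarrow> real"

definition tangent_space ::
    "('a::topological_space, 'v::real_normed_vector) chart set \<Rightarrow> 'a \<Rightarrow> 'a tvec set"
  where "tangent_space A x = {v.
    linear_on (smooth_funs A) v \<and>
    (\<forall>f\<in>smooth_funs A. \<forall>g\<in>smooth_funs A. v (\<lambda>y. f y * g y) = f x * v g + g x * v f) \<and>
    (\<forall>f. f \<notin> smooth_funs A \<longrightarrow> v f = 0)}"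

definition cotangent_space ::
    "('a::topological_space, 'v::real_normed_vector) chart set \<Rightarrow> 'a \<Rightarrow> 'a covec set"
  where "cotangent_space A x = {\<alpha>.
    linear_on (tangent_space A x) \<alpha> \<and> (\<forall>v. v \<notin> tangent_space A x \<longrightarrow> \<alpha> v = 0)}"

definition differential ::
    "('a::topological_space, 'v::real_normed_vector) chart set \<Rightarrow> ('a \<Rightarrow> real) \<Rightarrow> 'a \<Rightarrow> 'a covec"
  where "differential A f x = (\<lambda>v. if v \<in> tangent_space A x then v f else 0)"

definition pushforward ::
    "('b::topological_space, 'w::real_normed_vector) chart set \<Rightarrow> ('a \<Rightarrow> 'b) \<Rightarrow>
     'a tvec \<Rightarrow> 'b tvec"
  where "pushforward B p v = (\<lambda>g. if g \<in> smooth_funs B then v (g \<circ> p) else 0)"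


section \<open>Vector fields and 1-forms\<close>

type_synonym 'a vfield = "'a \<Rightarrow> 'a tvec"
type_synonym 'a form1 = "'a \<Rightarrow> 'a covec"

definition smooth_vfield_on ::
    "('a::topological_space, 'v::real_normed_vector) chart set \<Rightarrow> 'a set \<Rightarrow> 'a vfield \<Rightarrow> bool"
  where "smooth_vfield_on A U X \<longleftrightarrow>
    (\<forall>x\<in>U. X x \<in> tangent_space A x) \<and> (\<forall>f\<in>smooth_funs A. smooth_fun_on A U (\<lambda>x. X x f))"

abbreviation smooth_vfield ::
    "('a::topological_space, 'v::real_normed_vector) chart set \<Rightarrow> 'a vfield \<Rightarrow> bool"
  where "smooth_vfield A \<equiv> smooth_vfield_on A UNIV"

definition smooth_form1_on ::
    "('a::topological_space, 'v::real_normed_vector) chart set \<Rightarrow> 'a set \<Rightarrow> 'a form1 \<Rightarrow> bool"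
  where "smooth_form1_on A U \<alpha> \<longleftrightarrow>
    (\<forall>x\<in>U. \<alpha> x \<in> cotangent_space A x) \<and>
    (\<forall>X. smooth_vfield A X \<longrightarrow> smooth_fun_on A U (\<lambda>x. \<alpha> x (X x)))"

abbreviation smooth_form1 ::
    "('a::topological_space, 'v::real_normed_vector) chart set \<Rightarrow> 'a form1 \<Rightarrow> bool"
  where "smooth_form1 A \<equiv> smooth_form1_on A UNIV"

text \<open>
  For smooth vector fields the value at a non-smooth \<open>f\<close> is 0, as required of a tangent vector.
\<close>

definition lie_bracket :: "'a vfield \<Rightarrow> 'a vfield \<Rightarrow> 'a vfield"
  where "lie_bracket X Y = (\<lambda>x f. X x (\<lambda>y. Y y f) - Y x (\<lambda>y. X y f))"

text \<open>
  The exterior derivative \<open>d\<alpha>(X,Y) = X(\<alpha>(Y)) - Y(\<alpha>(X)) - \<alpha>([X,Y])\<close> and the Lie derivative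
  \<open>(L\<^sub>X\<alpha>)(Y) = X(\<alpha>(Y)) - \<alpha>([X,Y])\<close> are function-linear in the vector fields they are evaluated on.
  Their values on tangent vectors are obtained by extending these to vector fields, and do not
  depend on the choice of the extension.
\<close>

definition extension ::
    "('a::topological_space, 'v::real_normed_vector) chart set \<Rightarrow> 'a \<Rightarrow> 'a tvec \<Rightarrow> 'a vfield"
  where "extension A x v = (SOME X. smooth_vfield A X \<and> X x = v)"

definition ext_deriv1 ::
    "('a::topological_space, 'v::real_normed_vector) chart set \<Rightarrow> 'a form1 \<Rightarrow>
     'a \<Rightarrow> 'a tvec \<Rightarrow> 'a tvec \<Rightarrow> real"
  where "ext_deriv1 A \<alpha> x v w =
    (if v \<in> tangent_space A x \<and> w \<in> tangent_space A x then
       let X = extension A x v; Y = extension A x w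
       in X x (\<lambda>y. \<alpha> y (Y y)) - Y x (\<lambda>y. \<alpha> y (X y)) - \<alpha> x (lie_bracket X Y x)
     else 0)"

definition lie_deriv1 ::
    "('a::topological_space, 'v::real_normed_vector) chart set \<Rightarrow> 'a vfield \<Rightarrow> 'a form1 \<Rightarrow> 'a form1"
  where "lie_deriv1 A X \<alpha> x v =
    (if v \<in> tangent_space A x then
       let Y = extension A x v
       in X x (\<lambda>y. \<alpha> y (Y y)) - \<alpha> x (lie_bracket X Y x)
     else 0)"


section \<open>Dirac structures\<close>

definition pairing :: "'a tvec \<times> 'a covec \<Rightarrow> 'a tvec \<times> 'a covec \<Rightarrow> real"
  where "pairing s t = (snd s (fst t) + snd t (fst s)) / 2"

definition smooth_section_on ::
    "('a::topological_space, 'v::real_normed_vector) chart set \<Rightarrow> 'a set \<Rightarrow>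
     ('a \<Rightarrow> 'a tvec \<times> 'a covec) \<Rightarrow> bool"
  where "smooth_section_on A U s \<longleftrightarrow>
    smooth_vfield_on A U (fst \<circ> s) \<and> smooth_form1_on A U (snd \<circ> s)"

definition courant_bracket ::
    "('a::topological_space, 'v::real_normed_vector) chart set \<Rightarrow>
     ('a \<Rightarrow> 'a tvec \<times> 'a covec) \<Rightarrow> ('a \<Rightarrow> 'a tvec \<times> 'a covec) \<Rightarrow> 'a \<Rightarrow> 'a tvec \<times> 'a covec"
  where "courant_bracket A s t =
    (\<lambda>x. (lie_bracket (fst \<circ> s) (fst \<circ> t) x,
          lie_deriv1 A (fst \<circ> s) (snd \<circ> t) x - ext_deriv1 A (snd \<circ> s) x (fst (t x))))"

definition isotropic_subspace ::
    "('a::topological_space, 'v::real_normed_vector) chart set \<Rightarrow> 'a \<Rightarrow>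
     ('a tvec \<times> 'a covec) set \<Rightarrow> bool"
  where "isotropic_subspace A x L \<longleftrightarrow>
    L \<subseteq> tangent_space A x \<times> cotangent_space A x \<and> subspace L \<and>
    (\<forall>s\<in>L. \<forall>t\<in>L. pairing s t = 0)"

definition maximal_isotropic_subspace ::
    "('a::topological_space, 'v::real_normed_vector) chart set \<Rightarrow> 'a \<Rightarrow>
     ('a tvec \<times> 'a covec) set \<Rightarrow> bool"
  where "maximal_isotropic_subspace A x L \<longleftrightarrow>
    isotropic_subspace A x L \<and> (\<forall>L'. isotropic_subspace A x L' \<and> L \<subseteq> L' \<longrightarrow> L' = L)"

definition smooth_subbundle ::
    "('a::topological_space, 'v::real_normed_vector) chart set \<Rightarrow>
     ('a \<Rightarrow> ('a tvec \<times> 'a covec) set) \<Rightarrow> bool"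
  where "smooth_subbundle A D \<longleftrightarrow>
    (\<forall>x. \<exists>U k s. open U \<and> x \<in> U \<and> (\<forall>i<k::nat. smooth_section_on A U (s i)) \<and>
      (\<forall>y\<in>U. inj_on (\<lambda>i. s i y) {..<k} \<and> independent ((\<lambda>i. s i y) ` {..<k}) \<and>
             span ((\<lambda>i. s i y) ` {..<k}) = D y))"

definition sections ::
    "('a::topological_space, 'v::real_normed_vector) chart set \<Rightarrow>
     ('a \<Rightarrow> ('a tvec \<times> 'a covec) set) \<Rightarrow> ('a \<Rightarrow> 'a tvec \<times> 'a covec) set"
  where "sections A D = {s. smooth_section_on A UNIV s \<and> (\<forall>x. s x \<in> D x)}"

definition dirac_structure ::
    "('a::topological_space, 'v::real_normed_vector) chart set \<Rightarrow>
     ('a \<Rightarrow> ('a tvec \<times> 'a covec) set) \<Rightarrow> bool"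
  where "dirac_structure A D \<longleftrightarrow>
    smooth_subbundle A D \<and>
    (\<forall>x. maximal_isotropic_subspace A x (D x)) \<and>
    (\<forall>s\<in>sections A D. \<forall>t\<in>sections A D. courant_bracket A s t \<in> sections A D)"


section \<open>The Schouten bracket\<close>

text \<open>
  A \<open>k\<close>-vector field \<open>P\<close> acts as the alternating \<open>k\<close>-derivation
  \<open>[f\<^sub>1, \<dots>, f\<^sub>k] \<mapsto> P(df\<^sub>1, \<dots>, df\<^sub>k)\<close>. In terms of multiderivations of degrees \<open>p, q \<ge> 1\<close> the
  Schouten bracket is
  \<open>[P,Q](f\<^sub>1,\<dots>,f\<^sub>n) = \<Sum>\<sigma>. sgn \<sigma> P(Q(f\<^sub>\<sigma>\<^sub>1,\<dots>,f\<^sub>\<sigma>\<^sub>q), f\<^sub>\<sigma>\<^sub>(\<^sub>q\<^sub>+\<^sub>1\<^sub>),\<dots>,f\<^sub>\<sigma>\<^sub>n)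
     - (-1)\<^sup>(\<^sup>p\<^sup>-\<^sup>1\<^sup>)\<^sup>(\<^sup>q\<^sup>-\<^sup>1\<^sup>) \<Sum>\<tau>. sgn \<tau> Q(P(f\<^sub>\<tau>\<^sub>1,\<dots>,f\<^sub>\<tau>\<^sub>p), f\<^sub>\<tau>\<^sub>(\<^sub>p\<^sub>+\<^sub>1\<^sub>),\<dots>,f\<^sub>\<tau>\<^sub>n)\<close>
  with \<open>n = p + q - 1\<close>, where \<open>\<sigma>\<close> runs over the \<open>(q,p-1)\<close>-shuffles and \<open>\<tau>\<close> over the
  \<open>(p,q-1)\<close>-shuffles. A shuffle is given by the set \<open>S\<close> of the indices that it puts first.
\<close>

type_synonym 'a multivector = "('a \<Rightarrow> real) list \<Rightarrow> 'a \<Rightarrow> real"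

definition shuffle_sign :: "nat \<Rightarrow> nat set \<Rightarrow> real"
  where "shuffle_sign n S = (-1) ^ card {(i, j). i \<in> S \<and> j \<in> {..<n} - S \<and> j < i}"

definition schouten ::
    "nat \<Rightarrow> nat \<Rightarrow> 'a multivector \<Rightarrow> 'a multivector \<Rightarrow> 'a multivector"
  where "schouten p q P Q fs x =
    (let n = p + q - 1 in
     (\<Sum>S | S \<subseteq> {..<n} \<and> card S = q. shuffle_sign n S * P (Q (nths fs S) # nths fs (- S)) x)
     - (-1) ^ ((p - 1) * (q - 1)) *
       (\<Sum>S | S \<subseteq> {..<n} \<and> card S = p. shuffle_sign n S * Q (P (nths fs S) # nths fs (- S)) x))"

definition multivector_of_vfield :: "'a vfield \<Rightarrow> 'a multivector"
  where "multivector_of_vfield X fs x = X x (fs ! 0)"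

definition multivector_of_bivector ::
    "('a::topological_space, 'v::real_normed_vector) chart set \<Rightarrow>
     ('a \<Rightarrow> 'a covec \<Rightarrow> 'a covec \<Rightarrow> real) \<Rightarrow> 'a multivector"
  where "multivector_of_bivector A PiV fs x =
    PiV x (differential A (fs ! 0) x) (differential A (fs ! 1) x)"

definition sharp ::
    "('a::topological_space, 'v::real_normed_vector) chart set \<Rightarrow>
     ('a \<Rightarrow> 'a covec \<Rightarrow> 'a covec \<Rightarrow> real) \<Rightarrow> 'a \<Rightarrow> 'a covec \<Rightarrow> 'a tvec"
  where "sharp A PiV x \<alpha> =
    (THE v. v \<in> tangent_space A x \<and> (\<forall>\<beta>\<in>cotangent_space A x. \<beta> v = PiV x \<alpha> \<beta>))"


section \<open>Vector bundles\<close>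

text \<open>
  The fibrewise operations \<open>vadd\<close> and \<open>vscale\<close> are only meaningful for vectors in the same fibre. That
  each fibre is a real vector space under them follows from the linearity of the trivializations
  \<open>(U, \<tau>)\<close>, whose maps \<open>e \<mapsto> (p e, \<tau> e)\<close> are diffeomorphisms from \<open>p\<^sup>-\<^sup>1(U)\<close> to \<open>U \<times> 'f\<close>.
\<close>

definition local_trivialization ::
    "('e::topological_space, 'm::real_normed_vector) chart set \<Rightarrow>
     ('p::topological_space, 'b::real_normed_vector) chart set \<Rightarrow> ('e \<Rightarrow> 'p) \<Rightarrow>
     ('e \<Rightarrow> 'e \<Rightarrow> 'e) \<Rightarrow> (real \<Rightarrow> 'e \<Rightarrow> 'e) \<Rightarrow>
     'p set \<Rightarrow> ('e \<Rightarrow> 'f::real_normed_vector) \<Rightarrow> bool"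
  where "local_trivialization A\<^sub>E A\<^sub>P p vadd vscale U \<tau> \<longleftrightarrow>
    open U \<and>
    bij_betw (\<lambda>e. (p e, \<tau> e)) (p -` U) (U \<times> UNIV) \<and>
    smooth_map_on A\<^sub>E (prod_model_atlas A\<^sub>P) (p -` U) (\<lambda>e. (p e, \<tau> e)) \<and>
    smooth_map_on (prod_model_atlas A\<^sub>P) A\<^sub>E (U \<times> UNIV) (inv_into (p -` U) (\<lambda>e. (p e, \<tau> e))) \<and>
    (\<forall>e\<in>p -` U. \<forall>e'\<in>p -` U. p e = p e' \<longrightarrow> \<tau> (vadd e e') = \<tau> e + \<tau> e') \<and>
    (\<forall>e\<in>p -` U. \<forall>c. \<tau> (vscale c e) = c *\<^sub>R \<tau> e)"

definition smooth_vector_bundle ::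
    "('e::{t2_space,second_countable_topology}, 'm::real_inner) chart set \<Rightarrow>
     ('p::{t2_space,second_countable_topology}, 'b::real_inner) chart set \<Rightarrow> ('e \<Rightarrow> 'p) \<Rightarrow>
     ('e \<Rightarrow> 'e \<Rightarrow> 'e) \<Rightarrow> (real \<Rightarrow> 'e \<Rightarrow> 'e) \<Rightarrow>
     ('p set \<times> ('e \<Rightarrow> 'f::real_inner)) set \<Rightarrow> bool"
  where "smooth_vector_bundle A\<^sub>E A\<^sub>P p vadd vscale Triv \<longleftrightarrow>
    smooth_atlas A\<^sub>E \<and> smooth_atlas A\<^sub>P \<and> finite_dimensional TYPE('f) \<and>
    smooth_map_on A\<^sub>E A\<^sub>P UNIV p \<and>
    (\<forall>e e'. p e = p e' \<longrightarrow> p (vadd e e') = p e) \<and> (\<forall>c e. p (vscale c e) = p e) \<and>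
    (\<Union>(U, \<tau>)\<in>Triv. U) = UNIV \<and>
    (\<forall>(U, \<tau>)\<in>Triv. local_trivialization A\<^sub>E A\<^sub>P p vadd vscale U \<tau>)"


section \<open>Geometric data\<close>

definition vertical_space ::
    "('e::topological_space, 'm::real_normed_vector) chart set \<Rightarrow>
     ('p::topological_space, 'b::real_normed_vector) chart set \<Rightarrow> ('e \<Rightarrow> 'p) \<Rightarrow>
     'e \<Rightarrow> 'e tvec set"
  where "vertical_space A\<^sub>E A\<^sub>P p e = {v \<in> tangent_space A\<^sub>E e. pushforward A\<^sub>P p v = 0}"

definition ehresmann_connection ::
    "('e::topological_space, 'm::real_normed_vector) chart set \<Rightarrow>
     ('p::topological_space, 'b::real_normed_vector) chart set \<Rightarrow> ('e \<Rightarrow> 'p) \<Rightarrow>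
     ('e \<Rightarrow> 'e tvec \<Rightarrow> 'e tvec) \<Rightarrow> bool"
  where "ehresmann_connection A\<^sub>E A\<^sub>P p \<gamma> \<longleftrightarrow>
    (\<forall>e. linear_on (tangent_space A\<^sub>E e) (\<gamma> e) \<and>
         \<gamma> e ` tangent_space A\<^sub>E e \<subseteq> vertical_space A\<^sub>E A\<^sub>P p e \<and>
         (\<forall>v\<in>vertical_space A\<^sub>E A\<^sub>P p e. \<gamma> e v = v)) \<and>
    (\<forall>X. smooth_vfield A\<^sub>E X \<longrightarrow> smooth_vfield A\<^sub>E (\<lambda>e. \<gamma> e (X e)))"

definition horizontal_space ::
    "('e::topological_space, 'm::real_normed_vector) chart set \<Rightarrow>
     ('e \<Rightarrow> 'e tvec \<Rightarrow> 'e tvec) \<Rightarrow> 'e \<Rightarrow> 'e tvec set"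
  where "horizontal_space A\<^sub>E \<gamma> e = {v \<in> tangent_space A\<^sub>E e. \<gamma> e v = 0}"

definition horizontal_lift_at ::
    "('e::topological_space, 'm::real_normed_vector) chart set \<Rightarrow>
     ('p::topological_space, 'b::real_normed_vector) chart set \<Rightarrow> ('e \<Rightarrow> 'p) \<Rightarrow>
     ('e \<Rightarrow> 'e tvec \<Rightarrow> 'e tvec) \<Rightarrow> 'e \<Rightarrow> 'p tvec \<Rightarrow> 'e tvec"
  where "horizontal_lift_at A\<^sub>E A\<^sub>P p \<gamma> e w =
    (THE v. v \<in> horizontal_space A\<^sub>E \<gamma> e \<and> pushforward A\<^sub>P p v = w)"

definition hor ::
    "('e::topological_space, 'm::real_normed_vector) chart set \<Rightarrow>
     ('p::topological_space, 'b::real_normed_vector) chart set \<Rightarrow> ('e \<Rightarrow> 'p) \<Rightarrow>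
     ('e \<Rightarrow> 'e tvec \<Rightarrow> 'e tvec) \<Rightarrow> 'p vfield \<Rightarrow> 'e vfield"
  where "hor A\<^sub>E A\<^sub>P p \<gamma> u = (\<lambda>e. horizontal_lift_at A\<^sub>E A\<^sub>P p \<gamma> e (u (p e)))"

definition curvature ::
    "('e::topological_space, 'm::real_normed_vector) chart set \<Rightarrow>
     ('p::topological_space, 'b::real_normed_vector) chart set \<Rightarrow> ('e \<Rightarrow> 'p) \<Rightarrow>
     ('e \<Rightarrow> 'e tvec \<Rightarrow> 'e tvec) \<Rightarrow> 'p vfield \<Rightarrow> 'p vfield \<Rightarrow> 'e vfield"
  where "curvature A\<^sub>E A\<^sub>P p \<gamma> u v =
    lie_bracket (hor A\<^sub>E A\<^sub>P p \<gamma> u) (hor A\<^sub>E A\<^sub>P p \<gamma> v) - hor A\<^sub>E A\<^sub>P p \<gamma> (lie_bracket u v)"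

text \<open>
  \<open>\<Lambda>\<^sup>2Vert\<close> consists of the elements of \<open>\<Lambda>\<^sup>2TE\<close> that vanish when one argument annihilates the
  vertical space.
\<close>

definition vertical_bivector_field ::
    "('e::topological_space, 'm::real_normed_vector) chart set \<Rightarrow>
     ('p::topological_space, 'b::real_normed_vector) chart set \<Rightarrow> ('e \<Rightarrow> 'p) \<Rightarrow>
     ('e \<Rightarrow> 'e covec \<Rightarrow> 'e covec \<Rightarrow> real) \<Rightarrow> bool"
  where "vertical_bivector_field A\<^sub>E A\<^sub>P p PiV \<longleftrightarrow>
    (\<forall>e. alternating_bilinear_on (cotangent_space A\<^sub>E e) (PiV e) \<and>
         (\<forall>\<alpha>\<in>cotangent_space A\<^sub>E e. \<forall>\<beta>\<in>cotangent_space A\<^sub>E e.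
            (\<forall>v\<in>vertical_space A\<^sub>E A\<^sub>P p e. \<alpha> v = 0) \<longrightarrow> PiV e \<alpha> \<beta> = 0)) \<and>
    (\<forall>\<alpha> \<beta>. smooth_form1 A\<^sub>E \<alpha> \<and> smooth_form1 A\<^sub>E \<beta> \<longrightarrow>
       smooth_fun_on A\<^sub>E UNIV (\<lambda>e. PiV e (\<alpha> e) (\<beta> e)))"

text \<open>
  Elements of \<open>\<Omega>\<^sup>k(P) \<otimes> C\<^sup>\<infinity>(E)\<close>, the tensor product being over \<open>C\<^sup>\<infinity>(P)\<close>, are the smooth sections
  over \<open>E\<close> of the pullback of \<open>\<Lambda>\<^sup>kT\<^sup>*P\<close>.
\<close>

definition form2_with_values ::
    "('e::topological_space, 'm::real_normed_vector) chart set \<Rightarrow>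
     ('p::topological_space, 'b::real_normed_vector) chart set \<Rightarrow> ('e \<Rightarrow> 'p) \<Rightarrow>
     ('e \<Rightarrow> 'p tvec \<Rightarrow> 'p tvec \<Rightarrow> real) \<Rightarrow> bool"
  where "form2_with_values A\<^sub>E A\<^sub>P p F \<longleftrightarrow>
    (\<forall>e. alternating_bilinear_on (tangent_space A\<^sub>P (p e)) (F e)) \<and>
    (\<forall>u v. smooth_vfield A\<^sub>P u \<and> smooth_vfield A\<^sub>P v \<longrightarrow>
       smooth_fun_on A\<^sub>E UNIV (\<lambda>e. F e (u (p e)) (v (p e))))"

definition eval_form2 ::
    "('e \<Rightarrow> 'p) \<Rightarrow> ('e \<Rightarrow> 'p tvec \<Rightarrow> 'p tvec \<Rightarrow> real) \<Rightarrow> 'p vfield list \<Rightarrow> 'e \<Rightarrow> real"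
  where "eval_form2 p F us e = F e ((us ! 0) (p e)) ((us ! 1) (p e))"

text \<open>\<open>G\<close> has degree \<open>k\<close> and \<open>us = [u\<^sub>0, \<dots>, u\<^sub>k]\<close>.\<close>

definition covariant_deriv ::
    "('e::topological_space, 'm::real_normed_vector) chart set \<Rightarrow>
     ('p::topological_space, 'b::real_normed_vector) chart set \<Rightarrow> ('e \<Rightarrow> 'p) \<Rightarrow>
     ('e \<Rightarrow> 'e tvec \<Rightarrow> 'e tvec) \<Rightarrow> nat \<Rightarrow>
     ('p vfield list \<Rightarrow> 'e \<Rightarrow> real) \<Rightarrow> 'p vfield list \<Rightarrow> 'e \<Rightarrow> real"
  where "covariant_deriv A\<^sub>E A\<^sub>P p \<gamma> k G us e =
    (\<Sum>i\<le>k. (-1) ^ i * hor A\<^sub>E A\<^sub>P p \<gamma> (us ! i) e (G (nths us (- {i}))))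
    + (\<Sum>j\<le>k. \<Sum>i<j. (-1) ^ (i + j) * G (lie_bracket (us ! i) (us ! j) # nths us (- {i, j})) e)"

definition geometric_data ::
    "('e::topological_space, 'm::real_normed_vector) chart set \<Rightarrow>
     ('p::topological_space, 'b::real_normed_vector) chart set \<Rightarrow> ('e \<Rightarrow> 'p) \<Rightarrow>
     ('e \<Rightarrow> 'e tvec \<Rightarrow> 'e tvec) \<Rightarrow> ('e \<Rightarrow> 'e covec \<Rightarrow> 'e covec \<Rightarrow> real) \<Rightarrow>
     ('e \<Rightarrow> 'p tvec \<Rightarrow> 'p tvec \<Rightarrow> real) \<Rightarrow> bool"
  where "geometric_data A\<^sub>E A\<^sub>P p \<gamma> PiV F \<longleftrightarrow>
    ehresmann_connection A\<^sub>E A\<^sub>P p \<gamma> \<and>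
    vertical_bivector_field A\<^sub>E A\<^sub>P p PiV \<and>
    form2_with_values A\<^sub>E A\<^sub>P p F \<and>
    (\<forall>f\<in>smooth_funs A\<^sub>E. \<forall>g\<in>smooth_funs A\<^sub>E. \<forall>h\<in>smooth_funs A\<^sub>E. \<forall>e.
       schouten 2 2 (multivector_of_bivector A\<^sub>E PiV) (multivector_of_bivector A\<^sub>E PiV) [f, g, h] e = 0) \<and>
    (\<forall>u. smooth_vfield A\<^sub>P u \<longrightarrow> (\<forall>f\<in>smooth_funs A\<^sub>E. \<forall>g\<in>smooth_funs A\<^sub>E. \<forall>e.
       schouten 1 2 (multivector_of_vfield (hor A\<^sub>E A\<^sub>P p \<gamma> u)) (multivector_of_bivector A\<^sub>E PiV)
         [f, g] e = 0)) \<and>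
    (\<forall>u v w. smooth_vfield A\<^sub>P u \<and> smooth_vfield A\<^sub>P v \<and> smooth_vfield A\<^sub>P w \<longrightarrow>
       (\<forall>e. covariant_deriv A\<^sub>E A\<^sub>P p \<gamma> 2 (eval_form2 p F) [u, v, w] e = 0)) \<and>
    (\<forall>u v. smooth_vfield A\<^sub>P u \<and> smooth_vfield A\<^sub>P v \<longrightarrow>
       (\<forall>e. curvature A\<^sub>E A\<^sub>P p \<gamma> u v e =
            sharp A\<^sub>E PiV e (differential A\<^sub>E (\<lambda>e'. F e' (u (p e')) (v (p e'))) e)))"

text \<open>
  The Dirac structure induced by \<open>(\<gamma>, \<PiV>, F)\<close> is the direct sum of the graph of \<open>F\<close>, transported to
  the horizontal spaces and extended by 0 to the vertical ones, and of the graph of \<open>\<PiV>\<close> over the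
  annihilator of \<open>Hor\<close>, which is identified with \<open>Vert\<^sup>*\<close>:
  \<open>D\<^sub>e = {(hor w + \<PiV>\<^sup>\<sharp>\<alpha>, i\<^sub>wF + \<alpha>) | w \<in> T\<^sub>p\<^sub>(\<^sub>e\<^sub>)P, \<alpha> \<in> T\<^sup>*\<^sub>eE, \<alpha> = 0 on Hor\<^sub>e}\<close>.
\<close>

definition horizontal_contraction ::
    "('e::topological_space, 'm::real_normed_vector) chart set \<Rightarrow>
     ('p::topological_space, 'b::real_normed_vector) chart set \<Rightarrow> ('e \<Rightarrow> 'p) \<Rightarrow>
     ('e \<Rightarrow> 'p tvec \<Rightarrow> 'p tvec \<Rightarrow> real) \<Rightarrow> 'e \<Rightarrow> 'p tvec \<Rightarrow> 'e covec"
  where "horizontal_contraction A\<^sub>E A\<^sub>P p F e w =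
    (\<lambda>v. if v \<in> tangent_space A\<^sub>E e then F e w (pushforward A\<^sub>P p v) else 0)"

definition induced_dirac ::
    "('e::topological_space, 'm::real_normed_vector) chart set \<Rightarrow>
     ('p::topological_space, 'b::real_normed_vector) chart set \<Rightarrow> ('e \<Rightarrow> 'p) \<Rightarrow>
     ('e \<Rightarrow> 'e tvec \<Rightarrow> 'e tvec) \<Rightarrow> ('e \<Rightarrow> 'e covec \<Rightarrow> 'e covec \<Rightarrow> real) \<Rightarrow>
     ('e \<Rightarrow> 'p tvec \<Rightarrow> 'p tvec \<Rightarrow> real) \<Rightarrow> 'e \<Rightarrow> ('e tvec \<times> 'e covec) set"
  where "induced_dirac A\<^sub>E A\<^sub>P p \<gamma> PiV F e =
    {(horizontal_lift_at A\<^sub>E A\<^sub>P p \<gamma> e w + sharp A\<^sub>E PiV e \<alpha>,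
      horizontal_contraction A\<^sub>E A\<^sub>P p F e w + \<alpha>) | w \<alpha>.
      w \<in> tangent_space A\<^sub>P (p e) \<and> \<alpha> \<in> cotangent_space A\<^sub>E e \<and>
      (\<forall>v\<in>horizontal_space A\<^sub>E \<gamma> e. \<alpha> v = 0)}"

end

theory Submission
  imports Defs
begin

text \<open>
  At each point \<open>D\<^sub>e\<close> equals its own orthogonal complement, hence it is maximal isotropic, and bundle
  coordinates provide local frames consisting of the sections \<open>H\<^sub>u = (hor u, i\<^sub>u F)\<close> and
  \<open>V\<^sub>f = (\<Pi>\<^sup>\<sharp>df, df \<circ> \<gamma>)\<close>. Since \<open>D\<close> is its own orthogonal complement, it is involutive iff
  \<open>\<langle>[s, t], r\<rangle> = 0\<close> for all sections. On sections of an isotropic subbundle this expression is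
  function-linear and cyclic in \<open>s, t, r\<close>, so only the triples \<open>HHH\<close>, \<open>HHV\<close>, \<open>HVV\<close> and \<open>VVV\<close> of frame
  sections matter, and for these it vanishes by (iii), (iv), (ii) and (i), respectively.

  The manifold input is that a derivation at a point is determined by its values on local coordinates
  (Hadamard's lemma and cutoff functions), which gives local frames, and that a local trivialization
  composed with a chart of the base is a chart of the total space.
\<close>

section \<open>Differential calculus on finite-dimensional inner product spaces\<close>

text \<open>What shapes the proof is that sections, vector fields and the functions on which tangent
  vectors act are all global, whereas coordinates are local. So every coordinate object is cut off
  by a bump function first, and locality has to be recovered from algebra: from the Leibniz rule for
  derivations, and from linearity over smooth functions for everything else. The Courant expression
  threatens this linearity: replacing s by g s adds the derivative of g along r times twice the
  pairing of s and t. Isotropy of D removes exactly this term. Linearity is needed in the first slot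
  only, since cyclicity rotates the other slots there.

  The covector part of \<open>vert_section f\<close> cannot be df itself, since it has to annihilate
  Hor. Composing with the connection changes df only by something that annihilates Vert, which a
  vertical bivector cannot see. So the vector part is still the Hamiltonian field of f, and the
  conditions on \<Pi> become identities between brackets of functions.\<close>

lemma Ck_on_subset: "Ck_on k S f \<Longrightarrow> T \<subseteq> S \<Longrightarrow> Ck_on k T f"
  by (induction k arbitrary: f) (auto intro: continuous_on_subset)

lemma Ck_on_Suc_imp: "Ck_on (Suc k) S f \<Longrightarrow> Ck_on k S f"
proof (induction k arbitrary: f)
  case 0
  then show ?case
    by (auto intro!: continuous_at_imp_continuous_on differentiable_imp_continuous_within)
next
  case (Suc k)
  then show ?case by simp
qed

lemma Ck_on_imp_continuous_on: "Ck_on k S f \<Longrightarrow> continuous_on S f"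
proof (induction k)
  case (Suc k)
  then show ?case using Ck_on_Suc_imp[of k S f] by blast
qed simp

text \<open>Openness of S makes f and g agree near each of its points, so their Frechet derivatives
  agree on S and the induction hypothesis applies to these.\<close>

lemma Ck_on_cong:
  assumes "open S" "\<And>x. x \<in> S \<Longrightarrow> f x = g x" "Ck_on k S f"
  shows "Ck_on k S g"
  using assms(2,3)
proof (induction k arbitrary: f g)
  case 0
  then show ?case by (auto cong: continuous_on_cong)
next
  case (Suc k)
  have D: "(g has_derivative frechet_derivative f (at x)) (at x)" if "x \<in> S" for x
  proof (rule has_derivative_transform_within_open[OF _ assms(1) that])
    show "(f has_derivative frechet_derivative f (at x)) (at x)"
      using Suc.prems(2) that by (simp flip: frechet_derivative_works)
  qed (use Suc.prems in auto)
  then have eq: "frechet_derivative f (at x) = frechet_derivative g (at x)" if "x \<in> S" for x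
    using frechet_derivative_at that by blast
  show ?case
    unfolding Ck_on.simps
  proof (intro conjI ballI allI)
    show "g differentiable (at x)" if "x \<in> S" for x
      using D[OF that] by (auto simp: differentiable_def)
    show "Ck_on k S (\<lambda>x. frechet_derivative g (at x) h)" for h
      by (rule Suc.IH[of "\<lambda>x. frechet_derivative f (at x) h"]) (use Suc.prems eq in auto)
  qed
qed

text \<open>Uniqueness of derivatives: a derivative found by any rule may replace
  \<open>frechet_derivative\<close>, on which the definition of \<open>Ck_on\<close>
  insists.\<close>

lemma Ck_on_SucI:
  assumes "open S" "\<And>x. x \<in> S \<Longrightarrow> (f has_derivative f' x) (at x)" "\<And>h. Ck_on k S (\<lambda>x. f' x h)"
  shows "Ck_on (Suc k) S f"
  unfolding Ck_on.simps
proof (intro conjI ballI allI)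
  show "f differentiable (at x)" if "x \<in> S" for x
    using assms(2)[OF that] by (auto simp: differentiable_def)
  have "f' x = frechet_derivative f (at x)" if "x \<in> S" for x
    using frechet_derivative_at[OF assms(2)[OF that]] .
  then show "Ck_on k S (\<lambda>x. frechet_derivative f (at x) h)" for h
    using Ck_on_cong[OF assms(1) _ assms(3)[of h]] by auto
qed

lemma Ck_on_SucD:
  assumes "Ck_on (Suc k) S f" "x \<in> S"
  shows "(f has_derivative frechet_derivative f (at x)) (at x)"
  using assms by (simp flip: frechet_derivative_works)

lemma Ck_on_local:
  assumes "\<And>x. x \<in> S \<Longrightarrow> \<exists>W. open W \<and> x \<in> W \<and> Ck_on k W f"
  shows "Ck_on k S f"
  using assms
proof (induction k arbitrary: f)
  case 0
  show ?case
    unfolding Ck_on.simps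
  proof (rule continuous_at_imp_continuous_on, rule ballI)
    fix x assume "x \<in> S"
    with 0[of x] obtain W where "open W" "x \<in> W" "continuous_on W f" by auto
    then show "isCont f x" by (simp add: continuous_on_eq_continuous_at)
  qed
next
  case (Suc k)
  show ?case
    unfolding Ck_on.simps
  proof (intro conjI ballI allI)
    show "f differentiable (at x)" if "x \<in> S" for x
      using Suc.prems[OF that] by auto
    show "Ck_on k S (\<lambda>x. frechet_derivative f (at x) h)" for h
    proof (rule Suc.IH)
      fix x assume "x \<in> S"
      then show "\<exists>W. open W \<and> x \<in> W \<and> Ck_on k W (\<lambda>x. frechet_derivative f (at x) h)"
        using Suc.prems[of x] by auto
    qed
  qed
qed

lemma Ck_on_const: "Ck_on k S (\<lambda>_. c)"
proof (induction k arbitrary: c)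
  case (Suc k)
  then show ?case by (simp add: frechet_derivative_const)
qed simp

lemma Ck_on_add:
  assumes "open S" "Ck_on k S f" "Ck_on k S g"
  shows "Ck_on k S (\<lambda>x. f x + g x)"
  using assms(2,3)
proof (induction k arbitrary: f g)
  case (Suc k)
  show ?case
  proof (rule Ck_on_SucI[OF assms(1)])
    show "((\<lambda>x. f x + g x) has_derivative
        (\<lambda>h. frechet_derivative f (at x) h + frechet_derivative g (at x) h)) (at x)" if "x \<in> S" for x
      by (intro has_derivative_add Ck_on_SucD[OF _ that]) (use Suc in auto)
  qed (use Suc in auto)
qed (auto intro: continuous_intros)

lemma Ck_on_sum:
  assumes "open S" "\<And>i. i \<in> I \<Longrightarrow> Ck_on k S (f i)"
  shows "Ck_on k S (\<lambda>x. \<Sum>i\<in>I. f i x)"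
  using assms(2)
  by (induction I rule: infinite_finite_induct) (auto intro!: Ck_on_add Ck_on_const assms(1))

lemma Ck_on_bounded_linear:
  assumes "open S" "bounded_linear L" "Ck_on k S f"
  shows "Ck_on k S (\<lambda>x. L (f x))"
  using assms(3)
proof (induction k arbitrary: f)
  case 0
  then show ?case by (simp add: bounded_linear.continuous_on[OF assms(2)])
next
  case (Suc k)
  show ?case
  proof (rule Ck_on_SucI[OF assms(1)])
    show "((\<lambda>x. L (f x)) has_derivative (\<lambda>h. L (frechet_derivative f (at x) h))) (at x)"
      if "x \<in> S" for x
      by (rule bounded_linear.has_derivative[OF assms(2)]) (rule Ck_on_SucD[OF Suc.prems that])
  qed (use Suc in auto)
qed

lemma Ck_on_bounded_bilinear:
  assumes "open S" "bounded_bilinear bil" "Ck_on k S f" "Ck_on k S g"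
  shows "Ck_on k S (\<lambda>x. bil (f x) (g x))"
  using assms(3,4)
proof (induction k arbitrary: f g)
  case 0
  then show ?case by (simp add: bounded_bilinear.continuous_on[OF assms(2)])
next
  case (Suc k)
  show ?case
  proof (rule Ck_on_SucI[OF assms(1)])
    show "((\<lambda>x. bil (f x) (g x)) has_derivative
        (\<lambda>h. bil (f x) (frechet_derivative g (at x) h) + bil (frechet_derivative f (at x) h) (g x)))
            (at x)"
      if "x \<in> S" for x
      by (intro bounded_bilinear.FDERIV[OF assms(2)] Ck_on_SucD[OF _ that]) (use Suc in auto)
    show "Ck_on k S (\<lambda>x. bil (f x) (frechet_derivative g (at x) h) +
           bil (frechet_derivative f (at x) h) (g x))" for h
      \<comment> \<open>The product rule leaves one factor undifferentiated; its class k + 1 has to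
        be lowered to k before the induction hypothesis fits.\<close>
      using Suc.prems Ck_on_Suc_imp[OF Suc.prems(1)] Ck_on_Suc_imp[OF Suc.prems(2)]
      by (intro Ck_on_add[OF assms(1)] Suc.IH) simp_all
  qed
qed

text \<open>A set that carries finite dimension with it, through the expansion in its last clause,
  and that is empty in dimension 0.\<close>

definition orthonormal_basis :: "'v::real_inner set \<Rightarrow> bool"
  where "orthonormal_basis B \<longleftrightarrow> finite B \<and> (\<forall>b\<in>B. \<forall>c\<in>B. inner b c = (if b = c then 1 else 0)) \<and>
    (\<forall>x. (\<Sum>b\<in>B. inner x b *\<^sub>R b) = x)"

lemma ex_orthonormal_basis:
  assumes "finite_dimensional TYPE('v::real_inner)"
  shows "\<exists>B::'v set. orthonormal_basis B"
proof -
  obtain B0 :: "'v set" where "finite B0" "span B0 = UNIV"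
    using assms by (auto simp: finite_dimensional_def)
  then obtain C :: "'v set" where C: "finite C" "span C = UNIV" "pairwise orthogonal C"
    using basis_orthogonal[of B0] by metis
  \<comment> \<open>Orthogonalization may leave 0 in \<open>C\<close>; dropping it does not change
    the span and permits normalization.\<close>
  define B where "B = (\<lambda>c. c /\<^sub>R norm c) ` (C - {0})"
  have fin: "finite B" using C by (simp add: B_def)
  have orth: "inner b c = (if b = c then 1 else 0)" if bcB: "b \<in> B" "c \<in> B" for b c
  proof -
    obtain b' c' :: 'v where bc: "b' \<in> C" "c' \<in> C" "b' \<noteq> 0" "c' \<noteq> 0" "b = b' /\<^sub>R norm b'" "c = c' /\<^sub>R
        norm c'"
      using bcB unfolding B_def by blast
    show ?thesis
    proof (cases "b' = c'")
      case True
      have "inner b b = 1"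
        using bc by (simp add: field_simps power2_norm_eq_inner[symmetric] power2_eq_square)
      then show ?thesis using True bc by simp
    next
      case False
      then have "inner b' c' = 0" using C(3) bc by (auto simp: pairwise_def orthogonal_def)
      then have "inner b c = 0" using bc by simp
      moreover have "inner b b = 1"
        using bc by (simp add: field_simps power2_norm_eq_inner[symmetric] power2_eq_square)
      ultimately show ?thesis by auto
    qed
  qed
  have "x \<in> span B" for x
  proof -
    have "C \<subseteq> span B"
    proof
      fix c assume "c \<in> C"
      show "c \<in> span B"
      proof (cases "c = 0")
        case False
        then have "c /\<^sub>R norm c \<in> B" using \<open>c \<in> C\<close> by (auto simp: B_def)
        then have "norm c *\<^sub>R (c /\<^sub>R norm c) \<in> span B" by (intro span_scale span_base)
        then show ?thesis using False by simp
      qed (simp add: span_zero)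
    qed
    then show ?thesis using C(2) by (metis UNIV_I span_minimal subset_eq subspace_span)
  qed
  moreover have "(\<Sum>b\<in>B. inner x b *\<^sub>R b) = x" if "x \<in> span B" for x
    using that
  proof (induction rule: span_induct_alt)
    case base
    then show ?case by simp
  next
    case (step c b y)
    have "(\<Sum>d\<in>B. inner b d *\<^sub>R d) = b"
    proof -
      have "(\<Sum>d\<in>B. inner b d *\<^sub>R d) = (\<Sum>d\<in>B. if b = d then d else 0)"
        by (rule sum.cong) (use orth step in auto)
      then show ?thesis using fin step by simp
    qed
    moreover have "(\<Sum>d\<in>B. inner (c *\<^sub>R b + y) d *\<^sub>R d) =
        c *\<^sub>R (\<Sum>d\<in>B. inner b d *\<^sub>R d) + (\<Sum>d\<in>B. inner y d *\<^sub>R d)"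
      by (simp add: inner_add_left scaleR_add_left sum.distrib scaleR_sum_right)
    ultimately show ?case
      using step by simp
  qed
  ultimately have "orthonormal_basis B"
    using fin orth by (simp add: orthonormal_basis_def)
  then show ?thesis ..
qed

lemma linear_orthonormal_expand:
  assumes "orthonormal_basis B" "linear L"
  shows "L h = (\<Sum>b\<in>B. inner h b *\<^sub>R L b)"
proof -
  have "L h = L (\<Sum>b\<in>B. inner h b *\<^sub>R b)" using assms by (simp add: orthonormal_basis_def)
  also have "\<dots> = (\<Sum>b\<in>B. inner h b *\<^sub>R L b)" using assms(2) by (simp add: linear_sum linear_scale)
  finally show ?thesis .
qed

text \<open>The chain rule produces the derivative of f in the direction g'(x)h, which varies with
  x, whereas \<open>Ck_on\<close> differentiates in fixed directions. Expanding that direction in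
  the basis \<open>B\<close> turns the derivative into a sum of products of functions of class
  k.\<close>

lemma Ck_on_compose:
  fixes f :: "'v::real_inner \<Rightarrow> 'w::real_normed_vector"
  assumes B: "orthonormal_basis (B::'v set)" and S: "open S" and T: "open T"
    and "Ck_on k S g" "Ck_on k T f" "g ` S \<subseteq> T"
  shows "Ck_on k S (\<lambda>x. f (g x))"
  using assms(4-6)
proof (induction k arbitrary: f)
  case 0
  then show ?case by (auto intro: continuous_on_compose2)
next
  case (Suc k)
  let ?f' = "\<lambda>x. frechet_derivative f (at x)" and ?g' = "\<lambda>x. frechet_derivative g (at x)"
  have f': "linear (?f' y)" if "y \<in> T" for y
    using Ck_on_SucD[OF Suc.prems(2) that] has_derivative_linear by blast
  have "Ck_on k S (\<lambda>x. \<Sum>b\<in>B. inner (?g' x h) b *\<^sub>R ?f' (g x) b)" for h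
  proof (intro Ck_on_sum[OF S] Ck_on_bounded_bilinear[OF S bounded_bilinear_scaleR])
    show "Ck_on k S (\<lambda>x. inner (?g' x h) b)" for b
      by (rule Ck_on_bounded_linear[OF S bounded_linear_inner_left]) (use Suc.prems(1) in simp)
    show "Ck_on k S (\<lambda>x. ?f' (g x) b)" for b
      by (rule Suc.IH) (use Suc.prems Ck_on_Suc_imp[OF Suc.prems(1)] in auto)
  qed
  then have C: "Ck_on k S (\<lambda>x. ?f' (g x) (?g' x h))" for h
  proof (rule Ck_on_cong[OF S, rotated])
    show "(\<Sum>b\<in>B. inner (?g' x h) b *\<^sub>R ?f' (g x) b) = ?f' (g x) (?g' x h)" if "x \<in> S" for x
      using linear_orthonormal_expand[OF B f'] Suc.prems(3) that by (simp add: image_subset_iff)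
  qed
  show ?case
  proof (rule Ck_on_SucI[OF S])
    show "((\<lambda>x. f (g x)) has_derivative (\<lambda>h. ?f' (g x) (?g' x h))) (at x)" if "x \<in> S" for x
      by (rule has_derivative_compose[OF Ck_on_SucD[OF Suc.prems(1) that] Ck_on_SucD[OF Suc.prems(2)]])
         (use Suc.prems that in auto)
  qed (rule C)
qed

section \<open>Smooth maps between model spaces\<close>

lemma smooth_on_subset: "smooth_on S f \<Longrightarrow> T \<subseteq> S \<Longrightarrow> smooth_on T f"
  by (auto simp: smooth_on_def intro: Ck_on_subset)

lemma smooth_on_cong: "open S \<Longrightarrow> (\<And>x. x \<in> S \<Longrightarrow> f x = g x) \<Longrightarrow> smooth_on S f \<Longrightarrow> smooth_on S g"
  unfolding smooth_on_def by (intro allI, rule Ck_on_cong[of S f g]) simp_all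

lemma smooth_on_local: "(\<And>x. x \<in> S \<Longrightarrow> \<exists>W. open W \<and> x \<in> W \<and> smooth_on W f) \<Longrightarrow> smooth_on S f"
  unfolding smooth_on_def by (intro allI Ck_on_local) fastforce

lemma smooth_on_const: "smooth_on S (\<lambda>_. c)"
  by (simp add: smooth_on_def Ck_on_const)

lemma smooth_on_add: "open S \<Longrightarrow> smooth_on S f \<Longrightarrow> smooth_on S g \<Longrightarrow> smooth_on S (\<lambda>x. f x + g x)"
  by (simp add: smooth_on_def Ck_on_add)

lemma smooth_on_bounded_linear:
  "open S \<Longrightarrow> bounded_linear L \<Longrightarrow> smooth_on S f \<Longrightarrow> smooth_on S (\<lambda>x. L (f x))"
  by (simp add: smooth_on_def Ck_on_bounded_linear)

lemma smooth_on_bounded_bilinear: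
  "open S \<Longrightarrow> bounded_bilinear bil \<Longrightarrow> smooth_on S f \<Longrightarrow> smooth_on S g \<Longrightarrow>
    smooth_on S (\<lambda>x. bil (f x) (g x))"
  by (simp add: smooth_on_def Ck_on_bounded_bilinear)

lemmas smooth_on_mult = smooth_on_bounded_bilinear[OF _ bounded_bilinear_mult]

lemma smooth_on_compose:
  fixes f :: "'v::real_inner \<Rightarrow> 'w::real_normed_vector"
  assumes "orthonormal_basis (B::'v set)" "open S" "open T" "smooth_on S g" "smooth_on T f" "g ` S \<subseteq> T"
  shows "smooth_on S (\<lambda>x. f (g x))"
  unfolding smooth_on_def
proof
  show "Ck_on k S (\<lambda>x. f (g x))" for k
    by (rule Ck_on_compose[OF assms(1-3) _ _ assms(6)]) (use assms(4,5) in \<open>simp_all add: smooth_on_def\<close>)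
qed

lemma smooth_on_bounded_linear_self:
  assumes "bounded_linear L"
  shows "smooth_on UNIV L"
  unfolding smooth_on_def
proof
  fix k
  show "Ck_on k UNIV L"
  proof (cases k)
    case 0
    then show ?thesis using assms by (simp add: linear_continuous_on)
  next
    case (Suc n)
    show ?thesis
      unfolding Suc
      by (rule Ck_on_SucI[where f' = "\<lambda>_. L"]) (auto intro: bounded_linear_imp_has_derivative assms
          Ck_on_const)
  qed
qed

lemma smooth_on_ident: "smooth_on S (\<lambda>x. x)"
  using smooth_on_bounded_linear_self[OF bounded_linear_ident] smooth_on_subset by blast

lemma smooth_on_frechet_derivative:
  assumes "smooth_on S f"
  shows "smooth_on S (\<lambda>x. frechet_derivative f (at x) h)"
  unfolding smooth_on_def
proof
  show "Ck_on k S (\<lambda>x. frechet_derivative f (at x) h)" for k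
    using assms unfolding smooth_on_def by (auto dest: spec[of _ "Suc k"])
qed

lemma smooth_on_has_derivative:
  assumes "smooth_on S f" "x \<in> S"
  shows "(f has_derivative frechet_derivative f (at x)) (at x)"
  using assms(1) unfolding smooth_on_def by (intro Ck_on_SucD[OF _ assms(2), of 0]) (rule spec)

lemma smooth_on_imp_continuous_on: "smooth_on S f \<Longrightarrow> continuous_on S f"
  unfolding smooth_on_def by (rule Ck_on_imp_continuous_on[of 0]) (rule spec)

text \<open>The coordinate cube \<open>K B\<close> is compact, being built up one interval at a time
  as a continuous image of a product. By Cauchy-Schwarz the ball around 0 is a closed subset of it,
  and translation moves the centre.\<close>

lemma compact_cball_orthonormal:
  fixes a :: "'v::real_inner"
  assumes B: "orthonormal_basis (B::'v set)"
  shows "compact (cball a r)"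
proof -
  define K where "K C = {\<Sum>b\<in>C. c b *\<^sub>R b | c. \<forall>b\<in>C. \<bar>c b\<bar> \<le> r}" for C :: "'v set"
  have "compact (K C)" if "finite C" for C
    using that
  proof (induction C)
    case empty
    then show ?case by (simp add: K_def)
  next
    case (insert b C)
    have "K (insert b C) = (\<lambda>(t, k). t *\<^sub>R b + k) ` ({-r..r} \<times> K C)" (is "?L = ?R")
    proof
      show "?L \<subseteq> ?R"
      proof
        fix x assume "x \<in> ?L"
        then obtain c where c: "x = (\<Sum>b\<in>insert b C. c b *\<^sub>R b)" "\<forall>b\<in>insert b C. \<bar>c b\<bar> \<le> r"
          by (auto simp: K_def)
        then have "x = c b *\<^sub>R b + (\<Sum>b\<in>C. c b *\<^sub>R b)" using insert by simp
        moreover have "(\<Sum>b\<in>C. c b *\<^sub>R b) \<in> K C" using c by (auto simp: K_def)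
        ultimately show "x \<in> ?R" using c(2) by (force simp: abs_le_iff)
      qed
      show "?R \<subseteq> ?L"
      proof
        fix x assume "x \<in> ?R"
        then obtain t c where c: "\<bar>t\<bar> \<le> r" "x = t *\<^sub>R b + (\<Sum>b\<in>C. c b *\<^sub>R b)" "\<forall>b\<in>C. \<bar>c b\<bar> \<le> r"
          unfolding K_def by (smt (verit) SigmaE atLeastAtMost_iff image_iff mem_Collect_eq
              prod.simps(2))
        have "(\<Sum>d\<in>C. (if d = b then t else c d) *\<^sub>R d) = (\<Sum>b\<in>C. c b *\<^sub>R b)"
          by (rule sum.cong) (use insert in auto)
        then have "x = (\<Sum>d\<in>insert b C. (if d = b then t else c d) *\<^sub>R d)" using c insert by simp
        then show "x \<in> ?L" using c unfolding K_def
          by (intro CollectI exI[of _ "\<lambda>d. if d = b then t else c d"]) auto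
      qed
    qed
    moreover have "compact ((\<lambda>(t, k). t *\<^sub>R b + k) ` ({-r..r} \<times> K C))"
      by (intro compact_continuous_image compact_Times insert)
         (auto simp: case_prod_beta intro!: continuous_intros)
    ultimately show ?case by simp
  qed
  then have KB: "compact (K B)" using B by (simp add: orthonormal_basis_def)
  have "cball 0 r \<subseteq> K B"
  proof
    fix x :: 'v assume x: "x \<in> cball 0 r"
    have "x = (\<Sum>b\<in>B. inner x b *\<^sub>R b)" using B by (simp add: orthonormal_basis_def)
    moreover have "\<bar>inner x b\<bar> \<le> r" if "b \<in> B" for b
    proof -
      have "norm b = 1" using B that by (simp add: orthonormal_basis_def norm_eq_sqrt_inner)
      then have "\<bar>inner x b\<bar> \<le> norm x" using Cauchy_Schwarz_ineq2[of x b] by simp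
      then show ?thesis using x by simp
    qed
    ultimately show "x \<in> K B" unfolding K_def by (intro CollectI exI[of _ "inner x"]) auto
  qed
  then have "compact (cball (0::'v) r)"
    using compact_Int_closed[OF KB closed_cball, of 0 r] by (simp add: Int_absorb1)
  then have "compact ((\<lambda>x. a + x) ` cball 0 r)"
    by (intro compact_continuous_image continuous_intros)
  then show ?thesis by (simp add: image_add_cball)
qed

section \<open>A smooth cutoff function and Hadamard's lemma\<close>

text \<open>The classical flat function exp(-1/t). The powers of 1/t make the family closed under
  differentiation up to linear combinations, so that smoothness follows by induction for all members
  at once.\<close>

definition flat_exp :: "nat \<Rightarrow> real \<Rightarrow> real"
  where "flat_exp n t = (if t > 0 then inverse t ^ n * exp (- inverse t) else 0)"

lemma flat_exp_has_derivative:
  "(flat_exp n has_field_derivative flat_exp (n + 2) t - of_nat n * flat_exp (n + 1) t) (at t)"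
proof (cases t "0 :: real" rule: linorder_cases)
  case less
  have "((\<lambda>_. 0) has_field_derivative (0::real)) (at t)" by simp
  then have "(flat_exp n has_field_derivative 0) (at t)"
    by (rule DERIV_cong_ev[THEN iffD1, rotated 3])
       (use eventually_nhds_in_open[of "{..<0::real}" t] less in \<open>auto simp: flat_exp_def elim!:
           eventually_mono\<close>)
  then show ?thesis using less by (simp add: flat_exp_def)
next
  case equal
  have "((\<lambda>h. flat_exp n h / h) \<longlongrightarrow> 0) (at_left 0)"
    by (rule tendsto_eventually) (auto simp: flat_exp_def eventually_at_filter)
  moreover have "((\<lambda>h. flat_exp n h / h) \<longlongrightarrow> 0) (at_right 0)"
  proof -
    \<comment> \<open>Substituting x = 1/h turns the difference quotient at 0 into x^(n+1) / exp x
      with x tending to infinity.\<close>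
    have "((\<lambda>h::real. inverse h ^ (Suc n) / exp (inverse h)) \<longlongrightarrow> 0) (at_right 0)"
      by (rule filterlim_compose[OF tendsto_power_div_exp_0 filterlim_inverse_at_top_right])
    then show ?thesis
      by (rule filterlim_cong[THEN iffD1, rotated 3])
         (auto simp: flat_exp_def eventually_at_filter exp_minus field_simps)
  qed
  ultimately have "((\<lambda>h. flat_exp n h / h) \<longlongrightarrow> 0) (at 0)" by (simp add: filterlim_split_at_real)
  then show ?thesis using equal by (simp add: DERIV_def flat_exp_def)
next
  case greater
  have "((\<lambda>t. inverse t ^ n * exp (- inverse t)) has_field_derivative
      flat_exp (n + 2) t - of_nat n * flat_exp (n + 1) t) (at t)"
  proof (cases n)
    case (Suc m)
    have D1: "((\<lambda>t. inverse t ^ n) has_field_derivative of_nat n * (- (inverse t ^ Suc (Suc 0)) *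
        inverse t ^ m)) (at t)"
      using DERIV_power[OF DERIV_inverse, of t n UNIV] greater Suc by (simp del: power_Suc)
    have D2: "((\<lambda>t. exp (- inverse t)) has_field_derivative exp (- inverse t) * inverse t ^ 2) (at t)"
      using greater by (auto intro!: derivative_eq_intros simp: power2_eq_square)
    show ?thesis
      by (rule DERIV_cong[OF DERIV_mult[OF D1 D2]])
         (use greater Suc in \<open>simp add: flat_exp_def algebra_simps power_add power2_eq_square\<close>)
  qed (use greater in \<open>auto intro!: derivative_eq_intros simp: flat_exp_def field_simps
      power2_eq_square\<close>)
  then show ?thesis
    by (rule DERIV_cong_ev[THEN iffD1, rotated 3])
       (use eventually_nhds_in_open[of "{0::real<..}" t] greater in \<open>auto simp: flat_exp_def elim!:
           eventually_mono\<close>)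
qed

lemma smooth_on_flat_exp: "smooth_on UNIV (flat_exp n)"
proof -
  have "Ck_on k UNIV (flat_exp n)" for k
  proof (induction k arbitrary: n)
    case 0
    have "isCont (flat_exp n) t" for t using DERIV_isCont[OF flat_exp_has_derivative] .
    then show ?case by (simp add: continuous_at_imp_continuous_on)
  next
    case (Suc k)
    show ?case
    proof (rule Ck_on_SucI)
      show "(flat_exp n has_derivative (\<lambda>h. h * (flat_exp (n + 2) x + - of_nat n * flat_exp (n + 1)
          x))) (at x)" for x
        using flat_exp_has_derivative[of n x] unfolding has_field_derivative_def by (simp add:
            mult.commute[of _ "_ - _"])
      show "Ck_on k UNIV (\<lambda>x. h * (flat_exp (n + 2) x + - of_nat n * flat_exp (n + 1) x))" for h
        by (intro Ck_on_bounded_bilinear[OF _ bounded_bilinear_mult] Ck_on_const Ck_on_add Suc.IH) auto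
    qed auto
  qed
  then show ?thesis by (simp add: smooth_on_def)
qed

lemma ex_smooth_cutoff:
  obtains \<kappa> :: "real \<Rightarrow> real" where "smooth_on UNIV \<kappa>"
    "\<And>s. s \<le> 1/2 \<Longrightarrow> \<kappa> s = 1" "\<And>s. s \<ge> 1 \<Longrightarrow> \<kappa> s = 0"
proof -
  have B: "orthonormal_basis {1::real}" by (simp add: orthonormal_basis_def)
  define c where "c = flat_exp 0 (1/2)"
  have c: "c > 0" by (simp add: c_def flat_exp_def)
  have c': "flat_exp 0 c > 0" using c by (simp add: flat_exp_def)
  \<comment> \<open>The inner \<open>flat_exp\<close> is 0 for s at least 1 and at least c for s at
    most 1/2. Feeding c minus it to the outer one gives the constants \<open>flat_exp 0 c\<close>
    and 0 on these two ranges, which the affine normalization sends to 0 and 1. Differences are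
    written as sums of products so that the smoothness rules apply literally.\<close>
  define \<kappa> where "\<kappa> s = 1 + - inverse (flat_exp 0 c) * flat_exp 0 (c + - 1 * flat_exp 0 (1 + - 1 *
      s))" for s
  have mono: "flat_exp 0 s \<le> flat_exp 0 t" if "s \<le> t" for s t
    using that by (auto simp: flat_exp_def le_imp_inverse_le)
  note compose = smooth_on_compose[OF B open_UNIV open_UNIV _ smooth_on_flat_exp]
  show ?thesis
  proof
    show "smooth_on UNIV \<kappa>"
      unfolding \<kappa>_def
      by (intro smooth_on_add smooth_on_mult smooth_on_const compose smooth_on_ident) auto
    show "\<kappa> s = 1" if "s \<le> 1/2" for s
    proof -
      have "c \<le> flat_exp 0 (1 - s)" unfolding c_def by (rule mono) (use that in simp)
      then show ?thesis by (simp add: \<kappa>_def flat_exp_def[of 0 "c - _"])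
    qed
    show "\<kappa> s = 0" if "s \<ge> 1" for s
      using c' that by (simp add: \<kappa>_def flat_exp_def[of 0 "1 - s"])
  qed
qed

text \<open>
  The Leibniz rule of the library requires a Banach space as parameter space, so the integrals in
  Hadamard's lemma are differentiated by hand.
\<close>

definition ray_integral :: "'v::real_inner \<Rightarrow> nat \<Rightarrow> ('v \<Rightarrow> real) \<Rightarrow> 'v \<Rightarrow> real"
  where "ray_integral a k f y = integral {0..1} (\<lambda>t. t ^ k * f (a + t *\<^sub>R (y - a)))"

lemma ray_in_ball:
  assumes "y \<in> ball a r" "t \<in> {0..1}"
  shows "a + t *\<^sub>R (y - a) \<in> ball (a::'v::real_normed_vector) r"
proof -
  have "dist a (a + t *\<^sub>R (y - a)) = t * dist a y"
    using assms(2) by (simp add: dist_norm norm_minus_commute)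
  also have "\<dots> \<le> dist a y" using assms(2) by (simp add: mult_left_le_one_le)
  finally show ?thesis using assms(1) by simp
qed

lemma continuous_on_ray:
  fixes f :: "'v::real_inner \<Rightarrow> real"
  assumes "continuous_on (ball a r) f" "y \<in> ball a r"
  shows "continuous_on {0..1} (\<lambda>t. f (a + t *\<^sub>R (y - a)))"
  by (rule continuous_on_compose2[OF assms(1)])
     (use ray_in_ball[OF assms(2)] in \<open>auto intro!: continuous_intros simp del: mem_ball\<close>)

text \<open>Differentiation under the integral sign. The point y enters through a + t (y - a), so
  each derivative brings out a factor t, whence \<open>Suc k\<close>. The remainder is controlled
  uniformly in t by uniform continuity of the partial derivatives on a compact ball.\<close>

lemma ray_integral_has_derivative:
  fixes f :: "'v::real_inner \<Rightarrow> real"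
  assumes B: "orthonormal_basis B" and f: "Ck_on (Suc 0) (ball a r) f" and y: "y \<in> ball a r"
  shows "(ray_integral a k f has_derivative
    (\<lambda>h. \<Sum>b\<in>B. inner h b * ray_integral a (Suc k) (\<lambda>z. frechet_derivative f (at z) b) y)) (at y)"
proof -
  let ?D = "\<lambda>z. frechet_derivative f (at z)"
  have fD: "(f has_derivative ?D z) (at z)" if "z \<in> ball a r" for z
    using Ck_on_SucD[OF f that] .
  have linD: "linear (?D z)" if "z \<in> ball a r" for z
    using fD[OF that] has_derivative_linear by blast
  have contD: "continuous_on (ball a r) (\<lambda>z. ?D z b)" for b using f by simp
  have contf: "continuous_on (ball a r) f" using f Ck_on_imp_continuous_on by blast
  have norm_b: "norm b = 1" if "b \<in> B" for b
    using B that by (simp add: orthonormal_basis_def norm_eq_sqrt_inner)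
  have finB: "finite B" using B by (simp add: orthonormal_basis_def)
  \<comment> \<open>A radius strictly between y and the boundary: the closed ball is compact, and
    its interior still contains a neighbourhood of y.\<close>
  obtain r' where r': "dist a y < r'" "r' < r" using y dense by auto
  have cball_sub: "cball a r' \<subseteq> ball a r" using r' by auto
  have estimate: "\<exists>d>0. \<forall>h. norm h < d \<longrightarrow>
      norm (ray_integral a k f (y + h) - ray_integral a k f y -
        (\<Sum>b\<in>B. inner h b * ray_integral a (Suc k) (\<lambda>z. ?D z b) y)) \<le> (real (card B) * e) * norm h"
    if "e > 0" for e
  proof -
    have "\<exists>d>0. \<forall>z\<in>cball a r'. \<forall>z'\<in>cball a r'. dist z' z < d \<longrightarrow> \<bar>?D z' b - ?D z b\<bar> < e" for b
    proof -
      have "uniformly_continuous_on (cball a r') (\<lambda>z. ?D z b)"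
        by (intro compact_uniformly_continuous compact_cball_orthonormal[OF B]
            continuous_on_subset[OF contD cball_sub])
      then show ?thesis using that by (auto simp: uniformly_continuous_on_def dist_real_def)
    qed
    then obtain \<delta> where \<delta>: "\<And>b. \<delta> b > 0"
      "\<And>b z z'. z \<in> cball a r' \<Longrightarrow> z' \<in> cball a r' \<Longrightarrow> dist z' z < \<delta> b \<Longrightarrow> \<bar>?D z' b - ?D z b\<bar> < e"
      by metis
    \<comment> \<open>The first bound keeps y + h inside the smaller ball; the others keep each of
      the finitely many partial derivatives within e.\<close>
    define d where "d = Min (insert (r' - dist a y) (\<delta> ` B))"
    have d: "d > 0" "d \<le> r' - dist a y" "\<And>b. b \<in> B \<Longrightarrow> d \<le> \<delta> b"
      using finB r' \<delta>(1) by (auto simp: d_def)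
    show ?thesis
    proof (intro exI[of _ d] conjI allI impI d(1))
      fix h :: 'v assume h: "norm h < d"
      have "dist a (y + h) \<le> dist a y + norm h" using dist_triangle[of a "y + h" y] by (simp add:
          dist_norm)
      then have yh: "y + h \<in> ball a r'" "y \<in> ball a r'" using h d r' by auto
      then have yh': "y + h \<in> ball a r" using r' by auto
      \<comment> \<open>First-order Taylor estimate: the mean value theorem on the segment from z to
        z + w, which stays in the ball by convexity, leaves only the variation of the partial
        derivatives along it.\<close>
      have pointwise: "\<bar>f (z + w) - f z - (\<Sum>b\<in>B. inner w b * ?D z b)\<bar> \<le> (card B * e) * norm w"
        if z: "z \<in> ball a r'" "z + w \<in> ball a r'" and w: "norm w < d" for z w
      proof -
        have seg: "z + s *\<^sub>R w \<in> ball a r'" if "0 \<le> s" "s \<le> 1" for s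
        proof -
          have "z + s *\<^sub>R w = (1 - s) *\<^sub>R z + s *\<^sub>R (z + w)" by (simp add: algebra_simps)
          then show ?thesis using convexD[OF convex_ball z, of "1 - s" s] that by simp
        qed
        have "\<exists>s>0. s < 1 \<and> f (z + 1 *\<^sub>R w) - f (z + 0 *\<^sub>R w) = (1 - 0) * ?D (z + s *\<^sub>R w) w"
        proof (rule MVT2)
          fix s :: real assume s: "0 \<le> s" "s \<le> 1"
          then have zs: "z + s *\<^sub>R w \<in> ball a r" using seg[OF s] r' by auto
          have "((\<lambda>s. f (z + s *\<^sub>R w)) has_derivative (\<lambda>x. ?D (z + s *\<^sub>R w) (x *\<^sub>R w))) (at s)"
            by (rule has_derivative_compose[of "\<lambda>s. z + s *\<^sub>R w" _ _ _ f, OF _ fD[OF zs]]) (auto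
                intro!: derivative_eq_intros)
          then show "((\<lambda>s. f (z + s *\<^sub>R w)) has_real_derivative ?D (z + s *\<^sub>R w) w) (at s)"
            using linD[OF zs] by (simp add: has_field_derivative_def linear_scale mult.commute[of _
                "?D _ _"] mult_commute_abs)
        qed simp
        then obtain s where s: "0 < s" "s < 1" "f (z + w) - f z = ?D (z + s *\<^sub>R w) w" by auto
        have zs: "z + s *\<^sub>R w \<in> ball a r'" using seg s by simp
        have "?D (z + s *\<^sub>R w) w = (\<Sum>b\<in>B. inner w b * ?D (z + s *\<^sub>R w) b)"
          using linear_orthonormal_expand[OF B linD, of "z + s *\<^sub>R w" w] zs r' by auto
        then have "f (z + w) - f z - (\<Sum>b\<in>B. inner w b * ?D z b) =
            (\<Sum>b\<in>B. inner w b * (?D (z + s *\<^sub>R w) b - ?D z b))"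
          using s by (simp add: right_diff_distrib sum_subtractf)
        also have "\<bar>\<dots>\<bar> \<le> (\<Sum>b\<in>B. norm w * e)"
        proof (rule order_trans[OF sum_abs sum_mono])
          fix b assume b: "b \<in> B"
          have "\<bar>inner w b\<bar> \<le> norm w" using Cauchy_Schwarz_ineq2[of w b] norm_b[OF b] by simp
          moreover have "dist (z + s *\<^sub>R w) z < \<delta> b"
          proof -
            have "dist (z + s *\<^sub>R w) z = s * norm w" using s by (simp add: dist_norm)
            also have "\<dots> \<le> norm w" using s by (simp add: mult_left_le_one_le)
            finally show ?thesis using w d(3)[OF b] by linarith
          qed
          then have "\<bar>?D (z + s *\<^sub>R w) b - ?D z b\<bar> \<le> e"
            using \<delta>(2)[of z "z + s *\<^sub>R w" b] zs z(1) by auto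
          ultimately show "\<bar>inner w b * (?D (z + s *\<^sub>R w) b - ?D z b)\<bar> \<le> norm w * e"
            by (simp add: abs_mult mult_mono)
        qed
        finally show ?thesis by (simp add: mult_ac)
      qed
      let ?c = "\<lambda>t. a + t *\<^sub>R (y - a)" and ?ch = "\<lambda>t. a + t *\<^sub>R (y + h - a)"
      let ?g = "\<lambda>t. t ^ k * f (?ch t) - t ^ k * f (?c t) - (\<Sum>b\<in>B. inner h b * (t ^ Suc k * ?D (?c t) b))"
      have contg1: "continuous_on {0..1} (\<lambda>t. t ^ k * f (?ch t))"
        by (intro continuous_intros continuous_on_ray[OF contf yh'])
      have contg2: "continuous_on {0..1} (\<lambda>t. t ^ k * f (?c t))"
        by (intro continuous_intros continuous_on_ray[OF contf y])
      have contg3: "continuous_on {0..1} (\<lambda>t. t ^ Suc k * ?D (?c t) b)" for b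
        by (intro continuous_intros continuous_on_ray[OF contD y])
      have "ray_integral a k f (y + h) - ray_integral a k f y -
          (\<Sum>b\<in>B. inner h b * ray_integral a (Suc k) (\<lambda>z. ?D z b) y) = integral {0..1} ?g"
        unfolding ray_integral_def
        by (subst integral_diff integral_sum finB,
            auto intro!: integrable_continuous_interval continuous_intros contg1 contg2 contg3
              simp del: power_Suc simp: finB)+
      also have "norm \<dots> \<le> (card B * e * norm h) * (1 - 0)"
      proof (rule integral_bound)
        show "continuous_on {0..1} ?g"
          by (intro continuous_on_diff continuous_on_sum continuous_on_mult continuous_on_const
              contg1 contg2 contg3)
        fix t :: real assume t: "t \<in> {0..1}"
        have 1: "?c t \<in> ball a r'" using ray_in_ball[OF yh(2) t] .
        have 2: "?ch t = ?c t + t *\<^sub>R h" by (simp add: algebra_simps)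
        have 3: "?c t + t *\<^sub>R h \<in> ball a r'" using ray_in_ball[OF yh(1) t] unfolding 2 .
        have 4: "norm (t *\<^sub>R h) \<le> norm h" using t by (simp add: mult_left_le_one_le)
        \<comment> \<open>At time t the ray moves by t h, and \<open>t ^ Suc k\<close> is
          \<open>t ^ k\<close> times the factor t of this displacement; hence the pointwise estimate
          applies with w = t h.\<close>
        have "?g t = t ^ k * (f (?c t + t *\<^sub>R h) - f (?c t) - (\<Sum>b\<in>B. inner (t *\<^sub>R h) b * ?D (?c t) b))"
          unfolding 2 by (simp add: right_diff_distrib sum_distrib_left mult_ac)
        also have "\<bar>\<dots>\<bar> \<le> 1 * (card B * e * norm h)"
          unfolding abs_mult
        proof (rule mult_mono)
          show "\<bar>t ^ k\<bar> \<le> 1" using t by (simp add: power_le_one power_abs)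
          have "\<bar>f (?c t + t *\<^sub>R h) - f (?c t) - (\<Sum>b\<in>B. inner (t *\<^sub>R h) b * ?D (?c t) b)\<bar>
              \<le> card B * e * norm (t *\<^sub>R h)"
            by (rule pointwise[OF 1 3]) (use 4 h in linarith)
          also have "\<dots> \<le> card B * e * norm h" using 4 \<open>e > 0\<close> by (intro mult_left_mono) auto
          finally show "\<bar>f (?c t + t *\<^sub>R h) - f (?c t) - (\<Sum>b\<in>B. inner (t *\<^sub>R h) b * ?D (?c t) b)\<bar>
              \<le> card B * e * norm h" .
        qed auto
        finally show "norm (?g t) \<le> card B * e * norm h" by simp
      qed simp
      finally show "norm (ray_integral a k f (y + h) - ray_integral a k f y -
          (\<Sum>b\<in>B. inner h b * ray_integral a (Suc k) (\<lambda>z. ?D z b) y)) \<le> card B * e * norm h"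
        by simp
    qed
  qed
  show ?thesis
    unfolding has_derivative_at_alt
  proof (intro conjI allI impI)
    show "bounded_linear (\<lambda>h. \<Sum>b\<in>B. inner h b * ray_integral a (Suc k) (\<lambda>z. ?D z b) y)"
      by (intro bounded_linear_sum bounded_linear_mult_left[THEN bounded_linear_compose]
          bounded_linear_inner_left)
    fix e :: real assume e: "e > 0"
    \<comment> \<open>The basis is empty in dimension 0, hence the + 1.\<close>
    define e' where "e' = e / (card B + 1)"
    have "e' > 0" using e by (simp add: e'_def add_nonneg_pos)
    have le: "card B * e' \<le> e" using e by (simp add: e'_def field_simps)
    from estimate[OF \<open>e' > 0\<close>] obtain d where d: "d > 0" "\<And>h. norm h < d \<Longrightarrow>
      norm (ray_integral a k f (y + h) - ray_integral a k f y -
        (\<Sum>b\<in>B. inner h b * ray_integral a (Suc k) (\<lambda>z. ?D z b) y)) \<le> (real (card B) * e') * norm h"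
      by blast
    show "\<exists>d>0. \<forall>y'. norm (y' - y) < d \<longrightarrow> norm (ray_integral a k f y' - ray_integral a k f y -
        (\<Sum>b\<in>B. inner (y' - y) b * ray_integral a (Suc k) (\<lambda>z. ?D z b) y)) \<le> e * norm (y' - y)"
    proof (intro exI[of _ d] conjI allI impI d(1))
      fix y' assume "norm (y' - y) < d"
      from d(2)[OF this] show "norm (ray_integral a k f y' - ray_integral a k f y -
        (\<Sum>b\<in>B. inner (y' - y) b * ray_integral a (Suc k) (\<lambda>z. ?D z b) y)) \<le> e * norm (y' - y)"
        using mult_right_mono[OF le, of "norm (y' - y)"] by simp
    qed
  qed
qed

text \<open>Differentiating under the integral requires a continuous first derivative, so one order
  is lost; for smooth f this costs nothing.\<close>

lemma Ck_on_ray_integral: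
  fixes f :: "'v::real_inner \<Rightarrow> real"
  assumes B: "orthonormal_basis (B::'v set)" and "Ck_on (Suc n) (ball a r) f"
  shows "Ck_on n (ball a r) (ray_integral a k f)"
  using assms(2)
proof (induction n arbitrary: f k)
  case 0
  then show ?case
    using ray_integral_has_derivative[OF B 0]
    by (auto intro!: continuous_at_imp_continuous_on has_derivative_continuous)
next
  case (Suc n)
  have C1: "Ck_on (Suc 0) (ball a r) f"
    using Suc.prems
  proof (induction n)
    case (Suc n)
    then show ?case using Ck_on_Suc_imp[of "Suc (Suc n)"] by blast
  qed (use Ck_on_Suc_imp in blast)
  show ?case
    by (rule Ck_on_SucI[OF _ ray_integral_has_derivative[OF B C1]])
       (use Suc in \<open>auto intro!: Ck_on_sum Ck_on_bounded_bilinear[OF _ bounded_bilinear_mult]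
           Ck_on_const\<close>)
qed

text \<open>The fundamental theorem of calculus along the segment from a to z; the factors
  \<open>inner (z - a) b\<close> do not depend on t and leave the integral. At z = a the integrand
  is constant, which gives the value of \<open>g b\<close> there.\<close>

lemma Hadamard:
  fixes f :: "'v::real_inner \<Rightarrow> real"
  assumes B: "orthonormal_basis (B::'v set)" and f: "smooth_on (ball a r) f" and r: "r > 0"
  obtains g where "\<And>b. smooth_on (ball a r) (g b)" "\<And>b. g b a = frechet_derivative f (at a) b"
    "\<And>z. z \<in> ball a r \<Longrightarrow> f z = f a + (\<Sum>b\<in>B. inner (z - a) b * g b z)"
proof
  let ?D = "\<lambda>z. frechet_derivative f (at z)"
  define g where "g b = ray_integral a 0 (\<lambda>z. ?D z b)" for b
  show "smooth_on (ball a r) (g b)" for b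
    unfolding smooth_on_def g_def
    using smooth_on_frechet_derivative[OF f, of b] unfolding smooth_on_def
    by (auto intro!: Ck_on_ray_integral[OF B] simp del: Ck_on.simps(2))
  show "g b a = ?D a b" for b by (simp add: g_def ray_integral_def)
  fix z assume z: "z \<in> ball a r"
  let ?c = "\<lambda>t. a + t *\<^sub>R (z - a)"
  have contD: "continuous_on (ball a r) (\<lambda>z. ?D z b)" for b
    using smooth_on_imp_continuous_on[OF smooth_on_frechet_derivative[OF f]] .
  have fD: "(f has_derivative ?D x) (at x)" if "x \<in> ball a r" for x
    using smooth_on_has_derivative[OF f that] .
  have deriv: "((\<lambda>t. f (?c t)) has_vector_derivative (\<Sum>b\<in>B. inner (z - a) b * ?D (?c t) b)) (at t
      within {0..1})"
    if "t \<in> {0..1}" for t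
  proof -
    have ct: "?c t \<in> ball a r" using ray_in_ball[OF z that] .
    have lin: "linear (?D (?c t))" using fD[OF ct] has_derivative_linear by blast
    have "((\<lambda>t. f (?c t)) has_derivative (\<lambda>s. ?D (?c t) (s *\<^sub>R (z - a)))) (at t)"
      by (rule has_derivative_compose[of ?c _ _ _ f, OF _ fD[OF ct]]) (auto intro!: derivative_eq_intros)
    then have "((\<lambda>t. f (?c t)) has_vector_derivative ?D (?c t) (z - a)) (at t)"
      using lin by (simp add: has_vector_derivative_def linear_scale)
    then show ?thesis
      using linear_orthonormal_expand[OF B lin, of "z - a"] has_vector_derivative_at_within by simp
  qed
  have "((\<lambda>t. \<Sum>b\<in>B. inner (z - a) b * ?D (?c t) b) has_integral (f (?c 1) - f (?c 0))) {0..1}"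
    by (rule fundamental_theorem_of_calculus) (use deriv in auto)
  then have "f z - f a = integral {0..1} (\<lambda>t. \<Sum>b\<in>B. inner (z - a) b * ?D (?c t) b)"
    by (simp add: has_integral_iff)
  also have "\<dots> = (\<Sum>b\<in>B. integral {0..1} (\<lambda>t. inner (z - a) b * ?D (?c t) b))"
    using B by (intro integral_sum)
      (auto intro!: integrable_continuous_interval continuous_intros continuous_on_ray[OF contD z]
          simp: orthonormal_basis_def)
  finally show "f z = f a + (\<Sum>b\<in>B. inner (z - a) b * g b z)"
    by (simp add: g_def ray_integral_def)
qed

section \<open>Smooth functions on manifolds\<close>

text \<open>The model space may differ from that of the atlas, to allow for bundle charts.\<close>

definition compatible_chart ::
    "('a::topological_space, 'v::real_normed_vector) chart set \<Rightarrow> 'a set \<Rightarrow>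
     ('a \<Rightarrow> 'w::real_normed_vector) \<Rightarrow> bool"
  where "compatible_chart A U \<phi> \<longleftrightarrow>
    open U \<and> open (\<phi> ` U) \<and> homeomorphism U (\<phi> ` U) \<phi> (inv_into U \<phi>) \<and>
    (\<forall>(V, \<psi>)\<in>A. smooth_on (\<phi> ` (U \<inter> V)) (\<psi> \<circ> inv_into U \<phi>) \<and>
       smooth_on (\<psi> ` (U \<inter> V)) (\<phi> \<circ> inv_into V \<psi>))"

lemma homeomorphism_open_image:
  assumes "homeomorphism U V \<phi> \<phi>'" "open U" "open V" "open W" "W \<subseteq> U"
  shows "open (\<phi> ` W)"
proof -
  have "\<phi> ` W = \<phi>' -` W \<inter> V"
    using assms(1,5) unfolding homeomorphism_def by force
  moreover have "continuous_on V \<phi>'" using assms(1) by (simp add: homeomorphism_def)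
  ultimately show ?thesis using assms(3,4) by (simp add: continuous_on_open_vimage)
qed

locale smooth_manifold =
  fixes A :: "('a::{t2_space,second_countable_topology}, 'v::real_inner) chart set"
  assumes atlas: "smooth_atlas A"
begin

section \<open>Charts and the independence of smoothness from their choice\<close>

lemma finite_dimensional_model: "finite_dimensional TYPE('v)"
  using atlas by (simp add: smooth_atlas_def)

lemma compatible_chart_atlas:
  assumes "(U, \<phi>) \<in> A"
  shows "compatible_chart A U \<phi>"
proof -
  have 1: "\<And>U \<phi>. (U, \<phi>) \<in> A \<Longrightarrow> open U \<and> open (\<phi> ` U) \<and> homeomorphism U (\<phi> ` U) \<phi> (inv_into U \<phi>)"
    and 2: "\<And>U \<phi> V \<psi>. (U, \<phi>) \<in> A \<Longrightarrow> (V, \<psi>) \<in> A \<Longrightarrow> smooth_on (\<phi> ` (U \<inter> V)) (\<psi> \<circ> inv_into U \<phi>)"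
    using atlas unfolding smooth_atlas_def by (auto split: prod.splits)
  show ?thesis
    unfolding compatible_chart_def
  proof (intro conjI ballI, goal_cases)
    case (4 c)
    then show ?case using 2[OF assms, of "fst c" "snd c"] 2[of "fst c" "snd c", OF _ assms]
      by (simp add: split_beta Int_commute)
  qed (use 1[OF assms] in auto)
qed

lemma atlas_cover: obtains U \<phi> where "(U, \<phi>) \<in> A" "x \<in> U"
proof -
  have "x \<in> (\<Union>(U, \<phi>)\<in>A. U)" using atlas by (simp add: smooth_atlas_def)
  then show ?thesis using that by (elim UN_E case_prodE) auto
qed

lemma chart_open:
  assumes "compatible_chart A U \<phi>"
  shows "open U" "open (\<phi> ` U)" "homeomorphism U (\<phi> ` U) \<phi> (inv_into U \<phi>)"
    "open W \<Longrightarrow> open (\<phi> ` (U \<inter> W))" "continuous_on U \<phi>"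
    "\<And>y. y \<in> U \<Longrightarrow> inv_into U \<phi> (\<phi> y) = y" "inj_on \<phi> U"
proof -
  show "open U" "open (\<phi> ` U)" and hom: "homeomorphism U (\<phi> ` U) \<phi> (inv_into U \<phi>)"
    using assms by (auto simp: compatible_chart_def)
  then show "open W \<Longrightarrow> open (\<phi> ` (U \<inter> W))"
    using homeomorphism_open_image[OF hom, of "U \<inter> W"] assms by (auto simp: compatible_chart_def)
  show "continuous_on U \<phi>" "\<And>y. y \<in> U \<Longrightarrow> inv_into U \<phi> (\<phi> y) = y"
    using hom by (auto simp: homeomorphism_def)
  then show "inj_on \<phi> U" by (metis inj_onI)
qed

lemma smooth_fun_onE:
  assumes "smooth_fun_on A S f" "x \<in> S"
  obtains U \<phi> W where "(U, \<phi>) \<in> A" "open W" "x \<in> W" "W \<subseteq> U \<inter> S" "smooth_on (\<phi> ` W) (f \<circ> inv_into U \<phi>)"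
proof -
  have "\<exists>(U, \<phi>)\<in>A. \<exists>W. open W \<and> x \<in> W \<and> W \<subseteq> U \<inter> S \<and> smooth_on (\<phi> ` W) (f \<circ> inv_into U \<phi>)"
    using assms unfolding smooth_map_on_def model_atlas_def by simp
  then show ?thesis using that by (elim bexE case_prodE exE conjE) blast
qed

lemma smooth_fun_onI_atlas:
  assumes "\<And>x. x \<in> S \<Longrightarrow> \<exists>U \<phi> W. (U, \<phi>) \<in> A \<and> open W \<and> x \<in> W \<and> W \<subseteq> U \<inter> S \<and>
    smooth_on (\<phi> ` W) (f \<circ> inv_into U \<phi>)"
  shows "smooth_fun_on A S f"
  unfolding smooth_map_on_def model_atlas_def
proof
  fix x assume "x \<in> S"
  from assms[OF this] obtain U \<phi> W where "(U, \<phi>) \<in> A" "open W" "x \<in> W" "W \<subseteq> U \<inter> S"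
    "smooth_on (\<phi> ` W) (f \<circ> inv_into U \<phi>)"
    by (elim exE conjE)
  then show "\<exists>(U, \<phi>)\<in>A. \<exists>(V, \<psi>)\<in>{(UNIV, id)}. \<exists>W. open W \<and> x \<in> W \<and> W \<subseteq> U \<inter> S \<and> f ` W \<subseteq> V \<and>
      smooth_on (\<phi> ` W) (\<psi> \<circ> f \<circ> inv_into U \<phi>)"
    by (intro bexI[of _ "(U, \<phi>)"]) auto
qed

lemma smooth_fun_on_open:
  assumes "smooth_fun_on A S f"
  shows "open S"
proof (subst open_subopen, rule ballI)
  fix x assume "x \<in> S"
  from smooth_fun_onE[OF assms this] show "\<exists>T. open T \<and> x \<in> T \<and> T \<subseteq> S" by (metis le_inf_iff)
qed

text \<open>The definition provides only some atlas chart around each point; smooth transition maps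
  carry the property over to any given compatible chart.\<close>

lemma smooth_fun_on_chart:
  assumes "compatible_chart A U \<phi>" and f: "smooth_fun_on A S f"
  shows "smooth_on (\<phi> ` (U \<inter> S)) (f \<circ> inv_into U \<phi>)"
proof (rule smooth_on_local)
  fix z assume "z \<in> \<phi> ` (U \<inter> S)"
  then obtain x where x: "x \<in> U" "x \<in> S" "z = \<phi> x" by auto
  obtain B :: "'v set" where B: "orthonormal_basis B"
    using ex_orthonormal_basis[OF finite_dimensional_model] by blast
  from smooth_fun_onE[OF f x(2)] obtain V \<psi> W where
    W: "(V, \<psi>) \<in> A" "open W" "x \<in> W" "W \<subseteq> V \<inter> S" "smooth_on (\<psi> ` W) (f \<circ> inv_into V \<psi>)" .
  note chart = chart_open[OF assms(1)] and chart' = chart_open[OF compatible_chart_atlas[OF W(1)]]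
  have o: "open (\<phi> ` (U \<inter> W))" using chart W by blast
  have "V \<inter> W = W" using W by auto
  then have o': "open (\<psi> ` W)" using chart'(4)[OF W(2)] by simp
  have "smooth_on (\<phi> ` (U \<inter> V)) (\<psi> \<circ> inv_into U \<phi>)"
    using assms(1) W(1) by (auto simp: compatible_chart_def)
  then have t: "smooth_on (\<phi> ` (U \<inter> W)) (\<psi> \<circ> inv_into U \<phi>)"
    by (rule smooth_on_subset) (use W in auto)
  have "smooth_on (\<phi> ` (U \<inter> W)) (\<lambda>z. (f \<circ> inv_into V \<psi>) ((\<psi> \<circ> inv_into U \<phi>) z))"
    by (rule smooth_on_compose[OF B o o' t W(5)]) (use chart(6) in auto)
  then have "smooth_on (\<phi> ` (U \<inter> W)) (f \<circ> inv_into U \<phi>)"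
  proof (rule smooth_on_cong[OF o, rotated])
    fix z assume "z \<in> \<phi> ` (U \<inter> W)"
    then obtain y where "y \<in> U" "y \<in> W" "z = \<phi> y" by auto
    then show "(f \<circ> inv_into V \<psi>) ((\<psi> \<circ> inv_into U \<phi>) z) = (f \<circ> inv_into U \<phi>) z"
      using chart(6) chart'(6) W(4) by auto
  qed
  then show "\<exists>W. open W \<and> z \<in> W \<and> smooth_on W (f \<circ> inv_into U \<phi>)"
    using o x W by blast
qed

text \<open>The transfer from compatible charts back to the atlas. Here the transition map lands in
  the model space \<open>'w\<close>, so it is a basis of that space that the chain rule
  needs.\<close>

lemma smooth_fun_onI:
  assumes B: "orthonormal_basis (B::'w::real_inner set)"
  assumes "\<And>x. x \<in> S \<Longrightarrow> \<exists>U (\<phi>::'a \<Rightarrow> 'w) W. compatible_chart A U \<phi> \<and> open W \<and> x \<in> W \<and> W \<subseteq> U \<inter> S \<and>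
    smooth_on (\<phi> ` W) (f \<circ> inv_into U \<phi>)"
  shows "smooth_fun_on A S f"
proof (rule smooth_fun_onI_atlas)
  fix x assume "x \<in> S"
  from assms(2)[OF this] obtain U W and \<phi> :: "'a \<Rightarrow> 'w" where
    W: "compatible_chart A U \<phi>" "open W" "x \<in> W" "W \<subseteq> U \<inter> S" "smooth_on (\<phi> ` W) (f \<circ> inv_into U \<phi>)"
    by (elim exE conjE)
  obtain V \<psi> where V: "(V, \<psi>) \<in> A" "x \<in> V" by (rule atlas_cover)
  note chart = chart_open[OF W(1)] and chart' = chart_open[OF compatible_chart_atlas[OF V(1)]]
  have o: "open (\<psi> ` (V \<inter> W))" using chart' W by blast
  have "U \<inter> W = W" using W by auto
  then have o': "open (\<phi> ` W)" using chart(4)[OF W(2)] by simp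
  have "smooth_on (\<psi> ` (U \<inter> V)) (\<phi> \<circ> inv_into V \<psi>)"
    using W(1) V(1) by (auto simp: compatible_chart_def)
  then have t: "smooth_on (\<psi> ` (V \<inter> W)) (\<phi> \<circ> inv_into V \<psi>)"
    by (rule smooth_on_subset) (use W in auto)
  have "smooth_on (\<psi> ` (V \<inter> W)) (\<lambda>z. (f \<circ> inv_into U \<phi>) ((\<phi> \<circ> inv_into V \<psi>) z))"
    by (rule smooth_on_compose[OF B o o' t W(5)]) (use chart'(6) in auto)
  then have "smooth_on (\<psi> ` (V \<inter> W)) (f \<circ> inv_into V \<psi>)"
  proof (rule smooth_on_cong[OF o, rotated])
    fix z assume "z \<in> \<psi> ` (V \<inter> W)"
    then obtain y where "y \<in> V" "y \<in> W" "z = \<psi> y" by auto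
    then show "(f \<circ> inv_into U \<phi>) ((\<phi> \<circ> inv_into V \<psi>) z) = (f \<circ> inv_into V \<psi>) z"
      using chart(6) chart'(6) W(4) by auto
  qed
  then show "\<exists>U \<phi> W. (U, \<phi>) \<in> A \<and> open W \<and> x \<in> W \<and> W \<subseteq> U \<inter> S \<and> smooth_on (\<phi> ` W) (f \<circ> inv_into U \<phi>)"
    using V W chart'(1) by (intro exI[of _ V] exI[of _ \<psi>] exI[of _ "V \<inter> W"]) auto
qed

lemma smooth_fun_on_iff:
  "smooth_fun_on A S f \<longleftrightarrow> open S \<and> (\<forall>(U, \<phi>)\<in>A. smooth_on (\<phi> ` (U \<inter> S)) (f \<circ> inv_into U \<phi>))"
proof
  assume "smooth_fun_on A S f"
  then show "open S \<and> (\<forall>(U, \<phi>)\<in>A. smooth_on (\<phi> ` (U \<inter> S)) (f \<circ> inv_into U \<phi>))"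
    by (auto intro: smooth_fun_on_open smooth_fun_on_chart[OF compatible_chart_atlas])
next
  assume *: "open S \<and> (\<forall>(U, \<phi>)\<in>A. smooth_on (\<phi> ` (U \<inter> S)) (f \<circ> inv_into U \<phi>))"
  show "smooth_fun_on A S f"
  proof (rule smooth_fun_onI_atlas)
    fix x assume "x \<in> S"
    obtain U \<phi> where "(U, \<phi>) \<in> A" "x \<in> U" by (rule atlas_cover)
    then show "\<exists>U \<phi> W. (U, \<phi>) \<in> A \<and> open W \<and> x \<in> W \<and> W \<subseteq> U \<inter> S \<and> smooth_on (\<phi> ` W) (f \<circ> inv_into U \<phi>)"
      using * \<open>x \<in> S\<close> chart_open(1)[OF compatible_chart_atlas]
      by (intro exI[of _ U] exI[of _ \<phi>] exI[of _ "U \<inter> S"]) auto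
  qed
qed

lemma smooth_fun_onI_charts:
  assumes "open S" "\<And>U \<phi>. (U, \<phi>) \<in> A \<Longrightarrow> open (\<phi> ` (U \<inter> S)) \<Longrightarrow> smooth_on (\<phi> ` (U \<inter> S)) (\<lambda>z. f (inv_into
      U \<phi> z))"
  shows "smooth_fun_on A S f"
  unfolding smooth_fun_on_iff o_def
  using assms chart_open(4)[OF compatible_chart_atlas] by auto

lemma smooth_fun_onD_charts:
  assumes "smooth_fun_on A S f" "(U, \<phi>) \<in> A"
  shows "smooth_on (\<phi> ` (U \<inter> S)) (\<lambda>z. f (inv_into U \<phi> z))"
  using smooth_fun_on_chart[OF compatible_chart_atlas[OF assms(2)] assms(1)] by (simp only: o_def)

section \<open>The algebra of smooth functions\<close>

lemma smooth_fun_on_const: "open S \<Longrightarrow> smooth_fun_on A S (\<lambda>_. c)"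
  by (intro smooth_fun_onI_charts smooth_on_const)

lemma smooth_fun_on_add:
  "smooth_fun_on A S f \<Longrightarrow> smooth_fun_on A S g \<Longrightarrow> smooth_fun_on A S (\<lambda>x. f x + g x)"
  by (rule smooth_fun_onI_charts, erule smooth_fun_on_open) (intro smooth_on_add smooth_fun_onD_charts)

lemma smooth_fun_on_mult:
  "smooth_fun_on A S f \<Longrightarrow> smooth_fun_on A S g \<Longrightarrow> smooth_fun_on A S (\<lambda>x. f x * g x)"
  by (rule smooth_fun_onI_charts, erule smooth_fun_on_open) (intro smooth_on_mult smooth_fun_onD_charts)

lemma smooth_fun_on_minus: "smooth_fun_on A S f \<Longrightarrow> smooth_fun_on A S (\<lambda>x. - f x)"
  using smooth_fun_on_mult[OF smooth_fun_on_const[of S "- 1"], of f] smooth_fun_on_open[of S f] by simp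

lemma smooth_fun_on_diff:
  "smooth_fun_on A S f \<Longrightarrow> smooth_fun_on A S g \<Longrightarrow> smooth_fun_on A S (\<lambda>x. f x - g x)"
  using smooth_fun_on_add[OF _ smooth_fun_on_minus, of S f g] by simp

lemma smooth_fun_on_sum:
  assumes "open S" "\<And>i. i \<in> I \<Longrightarrow> smooth_fun_on A S (f i)"
  shows "smooth_fun_on A S (\<lambda>x. \<Sum>i\<in>I. f i x)"
  using assms(2)
  by (induction I rule: infinite_finite_induct)
     (auto intro!: smooth_fun_on_add smooth_fun_on_const assms(1))

lemma smooth_fun_on_subset: "smooth_fun_on A S f \<Longrightarrow> open T \<Longrightarrow> T \<subseteq> S \<Longrightarrow> smooth_fun_on A T f"
  by (rule smooth_fun_onI_charts, assumption, rule smooth_on_subset[OF smooth_fun_onD_charts]) auto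

lemma smooth_fun_on_cong:
  assumes "smooth_fun_on A S f" "\<And>x. x \<in> S \<Longrightarrow> f x = g x"
  shows "smooth_fun_on A S g"
proof (rule smooth_fun_onI_charts)
  show "open S" using smooth_fun_on_open[OF assms(1)] .
  fix U \<phi> assume U: "(U, \<phi>) \<in> A" and o: "open (\<phi> ` (U \<inter> S))"
  show "smooth_on (\<phi> ` (U \<inter> S)) (\<lambda>z. g (inv_into U \<phi> z))"
    by (rule smooth_on_cong[OF o _ smooth_fun_onD_charts[OF assms(1) U]])
       (use assms(2) chart_open(6)[OF compatible_chart_atlas[OF U]] in auto)
qed

lemma smooth_fun_on_local:
  assumes "\<And>x. x \<in> S \<Longrightarrow> \<exists>W. x \<in> W \<and> W \<subseteq> S \<and> smooth_fun_on A W f"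
  shows "smooth_fun_on A S f"
proof (rule smooth_fun_onI_atlas)
  fix x assume "x \<in> S"
  with assms obtain W where "x \<in> W" "W \<subseteq> S" "smooth_fun_on A W f" by blast
  from smooth_fun_onE[OF this(3,1)] this(2)
  show "\<exists>U \<phi> W. (U, \<phi>) \<in> A \<and> open W \<and> x \<in> W \<and> W \<subseteq> U \<inter> S \<and> smooth_on (\<phi> ` W) (f \<circ> inv_into U \<phi>)"
    by (metis (no_types, lifting) le_inf_iff order_trans)
qed

lemma smooth_fun_on_compose:
  assumes f: "smooth_fun_on A S f" and \<kappa>: "smooth_on UNIV (\<kappa> :: real \<Rightarrow> real)"
  shows "smooth_fun_on A S (\<lambda>x. \<kappa> (f x))"
proof (rule smooth_fun_onI_charts)
  show "open S" using smooth_fun_on_open[OF f] .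
  fix U \<phi> assume U: "(U, \<phi>) \<in> A" and o: "open (\<phi> ` (U \<inter> S))"
  have "orthonormal_basis {1::real}" by (simp add: orthonormal_basis_def)
  then show "smooth_on (\<phi> ` (U \<inter> S)) (\<lambda>z. \<kappa> (f (inv_into U \<phi> z)))"
    by (rule smooth_on_compose[OF _ o open_UNIV smooth_fun_onD_charts[OF f U] \<kappa>]) simp
qed

lemma smooth_fun_on_chart_fun:
  assumes "orthonormal_basis (B::'w::real_inner set)" "compatible_chart A U (\<phi>::'a \<Rightarrow> 'w)"
    "open N" "N \<subseteq> U" "smooth_on (\<phi> ` N) h"
  shows "smooth_fun_on A N (\<lambda>y. h (\<phi> y))"
proof (rule smooth_fun_onI[OF assms(1)])
  fix x assume "x \<in> N"
  have "open (\<phi> ` N)" using chart_open(4)[OF assms(2,3)] assms(4) by (simp add: Int_absorb1)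
  then have "smooth_on (\<phi> ` N) ((\<lambda>y. h (\<phi> y)) \<circ> inv_into U \<phi>)"
    by (rule smooth_on_cong[OF _ _ assms(5)]) (use assms(4) chart_open[OF assms(2)] in auto)
  then show "\<exists>V (\<psi>::'a \<Rightarrow> 'w) W. compatible_chart A V \<psi> \<and> open W \<and> x \<in> W \<and> W \<subseteq> V \<inter> N \<and>
      smooth_on (\<psi> ` W) ((\<lambda>y. h (\<phi> y)) \<circ> inv_into V \<psi>)"
    using assms(2-4) \<open>x \<in> N\<close>
    by (intro exI[of _ U] exI[of _ \<phi>] exI[of _ N]) auto
qed

abbreviation "CInf \<equiv> smooth_funs A"

lemma smooth_funs_iff: "f \<in> CInf \<longleftrightarrow> smooth_fun_on A UNIV f"
  by (simp add: smooth_funs_def)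

lemma smooth_funs_const [simp]: "(\<lambda>_. c) \<in> CInf"
  by (simp add: smooth_funs_iff smooth_fun_on_const)

lemma smooth_funs_add: "f \<in> CInf \<Longrightarrow> g \<in> CInf \<Longrightarrow> (\<lambda>x. f x + g x) \<in> CInf"
  by (simp add: smooth_funs_iff smooth_fun_on_add)

lemma smooth_funs_mult: "f \<in> CInf \<Longrightarrow> g \<in> CInf \<Longrightarrow> (\<lambda>x. f x * g x) \<in> CInf"
  by (simp add: smooth_funs_iff smooth_fun_on_mult)

lemma smooth_funs_diff: "f \<in> CInf \<Longrightarrow> g \<in> CInf \<Longrightarrow> (\<lambda>x. f x - g x) \<in> CInf"
  by (simp add: smooth_funs_iff smooth_fun_on_diff)

lemma smooth_funs_minus: "f \<in> CInf \<Longrightarrow> (\<lambda>x. - f x) \<in> CInf"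
  by (simp add: smooth_funs_iff smooth_fun_on_minus)

lemma smooth_funs_sum: "(\<And>i. i \<in> I \<Longrightarrow> f i \<in> CInf) \<Longrightarrow> (\<lambda>x. \<Sum>i\<in>I. f i x) \<in> CInf"
  unfolding smooth_funs_iff by (rule smooth_fun_on_sum) auto

text \<open>The three nested sets serve extension by zero: \<open>C\<close> is closed, so its
  complement is an open set on which a product with the bump is 0, and \<open>C\<close> lies in
  \<open>U\<close>, so the other factor need only be smooth on \<open>U\<close>. The bump is 1 on
  all of \<open>W\<close>, so germs at x are preserved.\<close>

lemma ex_bump:
  assumes "open U" "x \<in> U"
  obtains \<rho> W C where "\<rho> \<in> CInf" "open W" "x \<in> W" "W \<subseteq> C" "closed C" "C \<subseteq> U"
    "\<And>y. y \<in> W \<Longrightarrow> \<rho> y = 1" "\<And>y. y \<notin> C \<Longrightarrow> \<rho> y = 0"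
proof -
  obtain B :: "'v set" where B: "orthonormal_basis B"
    using ex_orthonormal_basis[OF finite_dimensional_model] by blast
  obtain V \<psi> where V: "(V, \<psi>) \<in> A" "x \<in> V" by (rule atlas_cover)
  note compat = compatible_chart_atlas[OF V(1)]
  note chart = chart_open[OF compat]
  have "open (\<psi> ` (V \<inter> U))" using chart assms(1) by blast
  then obtain r where r: "r > 0" "cball (\<psi> x) r \<subseteq> \<psi> ` (V \<inter> U)"
    using open_contains_cball[of "\<psi> ` (V \<inter> U)"] V(2) assms(2) by (meson IntI imageI)
  obtain \<kappa> :: "real \<Rightarrow> real" where \<kappa>: "smooth_on UNIV \<kappa>"
    "\<And>s. s \<le> 1/2 \<Longrightarrow> \<kappa> s = 1" "\<And>s. s \<ge> 1 \<Longrightarrow> \<kappa> s = 0" using ex_smooth_cutoff by blast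
  \<comment> \<open>The squared distance, scaled to be 1 on the sphere of radius r; the square is
    smooth at the centre too. Within r/2 it is at most 1/4, well inside the range where the cutoff
    is 1.\<close>
  define h where "h z = inner (z + - \<psi> x) (z + - \<psi> x) * inverse (r\<^sup>2)" for z
  define \<rho> where "\<rho> y = (if y \<in> V then \<kappa> (h (\<psi> y)) else 0)" for y
  \<comment> \<open>Compact, hence closed in the whole Hausdorff space; closedness relative to
    \<open>V\<close> alone would not allow extension by zero.\<close>
  define C where "C = inv_into V \<psi> ` cball (\<psi> x) r"
  define W where "W = V \<inter> \<psi> -` ball (\<psi> x) (r / 2)"
  have C_iff: "y \<in> C \<longleftrightarrow> \<psi> y \<in> cball (\<psi> x) r" if "y \<in> V" for y
  proof
    assume "y \<in> C"
    then obtain z where z: "z \<in> cball (\<psi> x) r" "y = inv_into V \<psi> z" by (auto simp: C_def)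
    then have "z \<in> \<psi> ` V" using r by auto
    then have "\<psi> y = z" using z by (simp add: f_inv_into_f)
    then show "\<psi> y \<in> cball (\<psi> x) r" using z by simp
  next
    assume "\<psi> y \<in> cball (\<psi> x) r"
    then have "inv_into V \<psi> (\<psi> y) \<in> C" by (auto simp: C_def)
    then show "y \<in> C" using chart(6)[OF that] by simp
  qed
  have C_sub: "C \<subseteq> V \<inter> U"
  proof
    fix y assume "y \<in> C"
    then obtain z where z: "z \<in> cball (\<psi> x) r" "y = inv_into V \<psi> z" by (auto simp: C_def)
    with r obtain w where "w \<in> V \<inter> U" "z = \<psi> w" by blast
    then show "y \<in> V \<inter> U" using z chart(6) by auto
  qed
  have "compact C"
    unfolding C_def
    by (rule compact_continuous_image[OF _ compact_cball_orthonormal[OF B]])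
       (use chart(3) r in \<open>auto simp: homeomorphism_def intro: continuous_on_subset\<close>)
  then have closed: "closed C" by (rule compact_imp_closed)
  have h_eq: "h z = (dist (\<psi> x) z)\<^sup>2 / r\<^sup>2" for z
    by (simp add: h_def dist_norm norm_minus_commute power2_norm_eq_inner field_simps)
  have zero: "\<rho> y = 0" if "y \<notin> C" for y
  proof (cases "y \<in> V")
    case True
    then have "r \<le> dist (\<psi> x) (\<psi> y)" using C_iff that by auto
    then have "h (\<psi> y) \<ge> 1" using r(1) by (simp add: h_eq power_mono)
    then show ?thesis using \<kappa>(3) by (simp add: \<rho>_def)
  qed (simp add: \<rho>_def)
  show ?thesis
  proof
    show "open W" unfolding W_def
      using chart(1,5) by (simp add: continuous_on_open_vimage Int_commute)
    show "x \<in> W" using V r by (simp add: W_def)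
    show "W \<subseteq> C" using C_iff r(1) by (auto simp: W_def)
    show "closed C" "C \<subseteq> U" using closed C_sub by auto
    show "\<rho> y = 1" if "y \<in> W" for y
    proof -
      have "dist (\<psi> x) (\<psi> y) < r / 2" "y \<in> V" using that by (auto simp: W_def)
      then have "(dist (\<psi> x) (\<psi> y))\<^sup>2 \<le> (r / 2)\<^sup>2" by (intro power_mono) auto
      also have "\<dots> \<le> r\<^sup>2 / 2" by (simp add: power_divide)
      finally have "h (\<psi> y) \<le> 1/2" using r(1) by (simp add: h_eq field_simps)
      then show ?thesis using \<kappa>(2) \<open>y \<in> V\<close> by (simp add: \<rho>_def)
    qed
    show "\<rho> y = 0" if "y \<notin> C" for y using zero[OF that] .
    have "smooth_on UNIV h"
      unfolding h_def
      by (intro smooth_on_mult smooth_on_bounded_bilinear[OF _ bounded_bilinear_inner]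
          smooth_on_add smooth_on_ident smooth_on_const) auto
    then have "smooth_on (\<psi> ` V) h" using smooth_on_subset by blast
    from smooth_fun_on_chart_fun[OF B compat chart(1) order_refl this]
    have "smooth_fun_on A V (\<lambda>y. \<kappa> (h (\<psi> y)))" using smooth_fun_on_compose[OF _ \<kappa>(1)] by blast
    then have 1: "smooth_fun_on A V \<rho>" by (rule smooth_fun_on_cong) (simp add: \<rho>_def)
    have 2: "smooth_fun_on A (- C) \<rho>"
      by (rule smooth_fun_on_cong[OF smooth_fun_on_const[of _ 0]]) (use closed zero in auto)
    show "\<rho> \<in> CInf"
      unfolding smooth_funs_iff
    proof (rule smooth_fun_on_local)
      fix y :: 'a
      show "\<exists>W. y \<in> W \<and> W \<subseteq> UNIV \<and> smooth_fun_on A W \<rho>"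
        using 1 2 C_sub by (cases "y \<in> C") auto
    qed
  qed
qed

text \<open>\<open>U\<close> and the complement of \<open>C\<close> are an open cover, and on the
  complement the product is 0 whatever f does outside \<open>U\<close>.\<close>

lemma bump_mult_smooth:
  assumes "\<rho> \<in> CInf" "smooth_fun_on A U f" "closed C" "C \<subseteq> U" "\<And>y. y \<notin> C \<Longrightarrow> \<rho> y = 0"
  shows "(\<lambda>y. \<rho> y * f y) \<in> CInf"
  unfolding smooth_funs_iff
proof (rule smooth_fun_on_local)
  have 1: "smooth_fun_on A U (\<lambda>y. \<rho> y * f y)"
    using assms(1,2) smooth_fun_on_open[OF assms(2)]
    by (auto simp: smooth_funs_iff intro!: smooth_fun_on_mult intro: smooth_fun_on_subset)
  have 2: "smooth_fun_on A (- C) (\<lambda>y. \<rho> y * f y)"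
    by (rule smooth_fun_on_cong[OF smooth_fun_on_const[of _ 0]]) (use assms in auto)
  fix y :: 'a
  show "\<exists>W. y \<in> W \<and> W \<subseteq> UNIV \<and> smooth_fun_on A W (\<lambda>y. \<rho> y * f y)"
    using 1 2 assms(4) by (cases "y \<in> C") auto
qed

text \<open>Derivations act on global functions only; a locally defined function is replaced by a
  global one with the same germ at x.\<close>

lemma ex_smooth_extension:
  assumes "smooth_fun_on A U f" "x \<in> U"
  obtains g W where "g \<in> CInf" "open W" "x \<in> W" "W \<subseteq> U" "\<And>y. y \<in> W \<Longrightarrow> g y = f y"
proof -
  obtain \<rho> W C where \<rho>: "\<rho> \<in> CInf" "open W" "x \<in> W" "W \<subseteq> C" "closed C" "C \<subseteq> U"
    "\<And>y. y \<in> W \<Longrightarrow> \<rho> y = 1" "\<And>y. y \<notin> C \<Longrightarrow> \<rho> y = 0"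
    using ex_bump[OF smooth_fun_on_open[OF assms(1)] assms(2)] by blast
  show ?thesis
    by (rule that[OF bump_mult_smooth[OF \<rho>(1) assms(1) \<rho>(5,6,8)] \<rho>(2,3)]) (use \<rho> in auto)
qed

lemma smooth_funs_localI:
  assumes "\<And>x. \<exists>W g. open W \<and> x \<in> W \<and> g \<in> CInf \<and> (\<forall>y\<in>W. f y = g y)"
  shows "f \<in> CInf"
  unfolding smooth_funs_iff
proof (rule smooth_fun_on_local)
  fix x :: 'a
  obtain W g where "open W" "x \<in> W" "g \<in> CInf" "\<forall>y\<in>W. f y = g y" using assms by blast
  then show "\<exists>W. x \<in> W \<and> W \<subseteq> UNIV \<and> smooth_fun_on A W f"
    using smooth_fun_on_cong[of W g f] smooth_fun_on_subset[of UNIV g W] by (auto simp: smooth_funs_iff)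
qed

end

section \<open>Tangent vectors, local frames and tensoriality\<close>

lemma sum_fun_eq: "(\<Sum>i\<in>I. f i) = (\<lambda>x. \<Sum>i\<in>I. f i x)"
  by (induction I rule: infinite_finite_induct) (auto simp: plus_fun_def zero_fun_def)

lemma linear_onD:
  assumes "linear_on S f"
  shows "x \<in> S \<Longrightarrow> y \<in> S \<Longrightarrow> f (x + y) = f x + f y" "x \<in> S \<Longrightarrow> f (c *\<^sub>R x) = c *\<^sub>R f x"
  using assms by (auto simp: linear_on_def)

lemma linear_on_zero: "linear_on S f \<Longrightarrow> x \<in> S \<Longrightarrow> f 0 = 0"
  using linear_onD(2)[of S f x 0] by simp

lemma linear_on_diff:
  assumes "linear_on S f" "subspace S" "x \<in> S" "y \<in> S"
  shows "f (x - y) = f x - f y"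
  using linear_onD(1)[OF assms(1), of "x - y" y] subspace_diff[OF assms(2-4)] assms(4) by simp

lemma linear_on_sum:
  assumes "linear_on S f" "subspace S" "\<And>i. i \<in> I \<Longrightarrow> x i \<in> S"
  shows "f (\<Sum>i\<in>I. c i *\<^sub>R x i) = (\<Sum>i\<in>I. c i *\<^sub>R f (x i))"
  using assms(3)
proof (induction I rule: infinite_finite_induct)
  case (insert i I)
  then show ?case
    using assms(1,2) by (simp add: linear_onD subspace_scale subspace_sum)
qed (use assms linear_on_zero[OF assms(1) subspace_0] in auto)

context smooth_manifold
begin

section \<open>Derivations at a point\<close>

lemma tangent_spaceD:
  assumes "v \<in> tangent_space A x"
  shows "f \<in> CInf \<Longrightarrow> g \<in> CInf \<Longrightarrow> v (\<lambda>y. f y + g y) = v f + v g"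
    "f \<in> CInf \<Longrightarrow> v (\<lambda>y. c * f y) = c * v f"
    "f \<in> CInf \<Longrightarrow> g \<in> CInf \<Longrightarrow> v (\<lambda>y. f y * g y) = f x * v g + g x * v f"
    "f \<notin> CInf \<Longrightarrow> v f = 0"
proof -
  have lin: "linear_on CInf v" using assms by (simp add: tangent_space_def)
  show "v (\<lambda>y. f y + g y) = v f + v g" if "f \<in> CInf" "g \<in> CInf"
    using linear_onD(1)[OF lin that] by (simp add: plus_fun_def)
  show "v (\<lambda>y. c * f y) = c * v f" if "f \<in> CInf"
    using linear_onD(2)[OF lin that, of c] by (simp add: scaleR_fun_def)
qed (use assms in \<open>auto simp: tangent_space_def\<close>)

lemma tangent_spaceI:
  assumes "\<And>f g. f \<in> CInf \<Longrightarrow> g \<in> CInf \<Longrightarrow> v (\<lambda>y. f y + g y) = v f + v g"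
    "\<And>f c. f \<in> CInf \<Longrightarrow> v (\<lambda>y. c * f y) = c * v f"
    "\<And>f g. f \<in> CInf \<Longrightarrow> g \<in> CInf \<Longrightarrow> v (\<lambda>y. f y * g y) = f x * v g + g x * v f"
    "\<And>f. f \<notin> CInf \<Longrightarrow> v f = 0"
  shows "v \<in> tangent_space A x"
  using assms by (auto simp: tangent_space_def linear_on_def plus_fun_def scaleR_fun_def)

lemma subspace_tangent_space: "subspace (tangent_space A x)"
proof (rule subspaceI)
  show "0 \<in> tangent_space A x" by (rule tangent_spaceI) (auto simp: zero_fun_def)
  show "v + w \<in> tangent_space A x" if "v \<in> tangent_space A x" "w \<in> tangent_space A x" for v w
    by (rule tangent_spaceI) (simp_all add: tangent_spaceD[OF that(1)] tangent_spaceD[OF that(2)]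
        algebra_simps)
  show "c *\<^sub>R v \<in> tangent_space A x" if "v \<in> tangent_space A x" for c v
    by (rule tangent_spaceI) (simp_all add: scaleR_fun_def tangent_spaceD[OF that] algebra_simps)
qed

lemma tangent_const:
  assumes "v \<in> tangent_space A x"
  shows "v (\<lambda>_. c) = 0"
proof -
  have "v (\<lambda>_. 1) = 0" using tangent_spaceD(3)[OF assms, of "\<lambda>_. 1" "\<lambda>_. 1"] by simp
  then show ?thesis using tangent_spaceD(2)[OF assms, of "\<lambda>_. 1" c] by simp
qed

lemma tangent_minus: "v \<in> tangent_space A x \<Longrightarrow> f \<in> CInf \<Longrightarrow> v (\<lambda>y. - f y) = - v f"
  using tangent_spaceD(2)[of v x f "- 1"] by simp

lemma tangent_diff:
  assumes "v \<in> tangent_space A x" "f \<in> CInf" "g \<in> CInf"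
  shows "v (\<lambda>y. f y - g y) = v f - v g"
  using tangent_spaceD(1)[OF assms(1,2) smooth_funs_minus[OF assms(3)]] tangent_minus[OF assms(1,3)]
      by simp

lemma tangent_sum:
  assumes "v \<in> tangent_space A x" "\<And>i. i \<in> I \<Longrightarrow> f i \<in> CInf"
  shows "v (\<lambda>y. \<Sum>i\<in>I. f i y) = (\<Sum>i\<in>I. v (f i))"
  using assms(2)
proof (induction I rule: infinite_finite_induct)
  case (insert i I)
  then show ?case by (simp add: tangent_spaceD(1)[OF assms(1)] smooth_funs_sum)
qed (auto simp: tangent_const[OF assms(1)])

text \<open>Apply v to \<open>\<rho> * (f - g)\<close>, which is identically 0 for a bump
  \<open>\<rho>\<close> supported where f = g. By the Leibniz rule the result is v f - v g, because
  f - g vanishes at x and \<open>\<rho>\<close> is 1 there.\<close>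

lemma tangent_local:
  assumes v: "v \<in> tangent_space A x" and "f \<in> CInf" "g \<in> CInf" and "\<forall>\<^sub>F y in nhds x. f y = g y"
  shows "v f = v g"
proof -
  obtain N where N: "open N" "x \<in> N" "\<And>y. y \<in> N \<Longrightarrow> f y = g y"
    using assms(4) by (auto simp: eventually_nhds)
  obtain \<rho> W C where \<rho>: "\<rho> \<in> CInf" "open W" "x \<in> W" "W \<subseteq> C" "closed C" "C \<subseteq> N"
    "\<And>y. y \<in> W \<Longrightarrow> \<rho> y = 1" "\<And>y. y \<notin> C \<Longrightarrow> \<rho> y = 0"
    using ex_bump[OF N(1,2)] by blast
  have "\<rho> y * (f y - g y) = 0" for y using \<rho>(6,8) N(3) by (cases "y \<in> C") auto
  then have "(\<lambda>y. \<rho> y * (f y - g y)) = (\<lambda>_. 0)" by blast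
  then have "0 = v (\<lambda>y. \<rho> y * (f y - g y))" using tangent_const[OF v] by simp
  also have "\<dots> = \<rho> x * (v f - v g) + (f x - g x) * v \<rho>"
    using tangent_spaceD(3)[OF v \<rho>(1) smooth_funs_diff[OF assms(2,3)]] tangent_diff[OF v assms(2,3)]
        by simp
  finally show ?thesis using \<rho>(3,7) N by simp
qed

text \<open>The fields and the coordinates \<xi> dual to them are global and smooth for every index,
  so that they serve as sections and as arguments of derivations without side conditions; duality
  and spanning can only hold over \<open>W\<close>.\<close>

definition local_frame :: "'i set \<Rightarrow> ('i \<Rightarrow> 'a vfield) \<Rightarrow> ('i \<Rightarrow> 'a \<Rightarrow> real) \<Rightarrow> 'a set \<Rightarrow> bool"
  where "local_frame I X \<xi> W \<longleftrightarrow> finite I \<and> open W \<and> (\<forall>i. smooth_vfield A (X i)) \<and> (\<forall>i. \<xi> i \<in> CInf) \<and>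
    (\<forall>y\<in>W. \<forall>i\<in>I. \<forall>j\<in>I. X i y (\<xi> j) = (if i = j then 1 else 0)) \<and>
    (\<forall>y\<in>W. \<forall>v\<in>tangent_space A y. v = (\<Sum>i\<in>I. v (\<xi> i) *\<^sub>R X i y))"

lemma local_frameD:
  assumes "local_frame I X \<xi> W"
  shows "finite I" "open W" "smooth_vfield A (X i)" "\<xi> i \<in> CInf"
    "y \<in> W \<Longrightarrow> i \<in> I \<Longrightarrow> j \<in> I \<Longrightarrow> X i y (\<xi> j) = (if i = j then 1 else 0)"
    "y \<in> W \<Longrightarrow> v \<in> tangent_space A y \<Longrightarrow> v = (\<Sum>i\<in>I. v (\<xi> i) *\<^sub>R X i y)"
  using assms unfolding local_frame_def by blast+

text \<open>The coordinate derivations and the coordinates centred at x, cut off by a bump. Spanning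
  is Hadamard's lemma: near y one has f = f(y) + sum of (\<xi>_b - \<xi>_b(y)) G_b with G_b(y) the
  partial derivatives, and the Leibniz rule evaluates v on this as the sum of v(\<xi>_b) G_b(y). The
  explicit formulas for \<open>X\<close> and \<xi> are recorded for comparing a bundle chart with
  its base chart.\<close>

lemma ex_local_frame:
  assumes B: "orthonormal_basis (B::'w::real_inner set)" and compat: "compatible_chart A U (\<phi>::'a \<Rightarrow> 'w)"
    and x: "x \<in> U"
  obtains X \<xi> W where "local_frame B X \<xi> W" "x \<in> W" "W \<subseteq> U"
    "\<And>y h f. y \<in> W \<Longrightarrow> f \<in> CInf \<Longrightarrow> X h y f = frechet_derivative (f \<circ> inv_into U \<phi>) (at (\<phi> y)) h"
    "\<And>y b. y \<in> W \<Longrightarrow> \<xi> b y = inner (\<phi> y - \<phi> x) b"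
proof -
  note chart = chart_open[OF compat]
  obtain \<rho> W C where \<rho>: "\<rho> \<in> CInf" "open W" "x \<in> W" "W \<subseteq> C" "closed C" "C \<subseteq> U"
    "\<And>y. y \<in> W \<Longrightarrow> \<rho> y = 1" "\<And>y. y \<notin> C \<Longrightarrow> \<rho> y = 0"
    using ex_bump[OF chart(1) x] by blast
  have WU: "W \<subseteq> U" using \<rho> by blast
  have openW: "open (\<phi> ` W)" using chart(4)[OF \<rho>(2)] WU by (simp add: Int_absorb1)
  let ?D = "\<lambda>f y. frechet_derivative (f \<circ> inv_into U \<phi>) (at (\<phi> y))"
  \<comment> \<open>Elements of \<open>tangent_space\<close> are 0 on functions that are not smooth,
    hence the case distinction; outside the support of the bump the zero derivation is
    obtained.\<close>
  define X where "X h y f = (if f \<in> CInf then \<rho> y * ?D f y h else 0)" for h y f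
  define \<xi> where "\<xi> b y = \<rho> y * inner (\<phi> y - \<phi> x) b" for b y
  have smooth: "smooth_on (\<phi> ` U) (f \<circ> inv_into U \<phi>)" if "f \<in> CInf" for f
    using smooth_fun_on_chart[OF compat, of UNIV f] that by (simp add: smooth_funs_iff)
  have deriv: "((f \<circ> inv_into U \<phi>) has_derivative ?D f y) (at (\<phi> y))" if "f \<in> CInf" "y \<in> U" for f y
    using smooth_on_has_derivative[OF smooth[OF that(1)]] that(2) by blast
  have tangent: "X h y \<in> tangent_space A y" for h y
  proof (cases "y \<in> U")
    case False
    then have "X h y = 0" using \<rho>(6,8) by (auto simp: X_def fun_eq_iff)
    then show ?thesis using subspace_0[OF subspace_tangent_space] by simp
  next
    case True
    show ?thesis
    proof (rule tangent_spaceI)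
      fix f g assume fg: "f \<in> CInf" "g \<in> CInf"
      note Df = deriv[OF fg(1) True] and Dg = deriv[OF fg(2) True]
      have "?D (\<lambda>y. f y + g y) y = (\<lambda>h. ?D f y h + ?D g y h)"
        using frechet_derivative_at[OF has_derivative_add[OF Df Dg]] by (simp add: o_def)
      then show "X h y (\<lambda>y. f y + g y) = X h y f + X h y g"
        using fg by (simp add: X_def smooth_funs_add algebra_simps)
      have "?D (\<lambda>y. f y * g y) y = (\<lambda>h. f y * ?D g y h + ?D f y h * g y)"
        using frechet_derivative_at[OF has_derivative_mult[OF Df Dg]] chart(6)[OF True] by (simp
            add: o_def)
      then show "X h y (\<lambda>y. f y * g y) = f y * X h y g + g y * X h y f"
        using fg by (simp add: X_def smooth_funs_mult algebra_simps)
    next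
      fix f c assume f: "f \<in> CInf"
      have "?D (\<lambda>y. c * f y) y = (\<lambda>h. c * ?D f y h)"
        using frechet_derivative_at[OF has_derivative_mult_right[OF deriv[OF f True]]] by (simp add:
            o_def)
      then show "X h y (\<lambda>y. c * f y) = c * X h y f"
        using f smooth_funs_mult[OF smooth_funs_const f] by (simp add: X_def)
    qed (simp add: X_def)
  qed
  have vf: "smooth_vfield A (X h)" for h
    unfolding smooth_vfield_on_def
  proof (intro conjI ballI tangent)
    fix f assume f: "f \<in> CInf"
    have "smooth_fun_on A U (\<lambda>y. ?D f y h)"
      by (rule smooth_fun_on_chart_fun[OF B compat chart(1) order_refl
          smooth_on_frechet_derivative[OF smooth[OF f]]])
    from bump_mult_smooth[OF \<rho>(1) this \<rho>(5,6,8)]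
    show "smooth_fun_on A UNIV (\<lambda>y. X h y f)" using f by (simp add: X_def smooth_funs_iff)
  qed
  have \<xi>: "\<xi> b \<in> CInf" for b
  proof -
    have "smooth_on (\<phi> ` U) (\<lambda>z. inner (z + - \<phi> x) b)"
      by (rule smooth_on_bounded_linear[OF chart(2) bounded_linear_inner_left])
         (intro smooth_on_add smooth_on_ident smooth_on_const chart(2))
    then have "smooth_on (\<phi> ` U) (\<lambda>z. inner (z - \<phi> x) b)" by simp
    from bump_mult_smooth[OF \<rho>(1) smooth_fun_on_chart_fun[OF B compat chart(1) order_refl this] \<rho>(5,6,8)]
    show ?thesis unfolding \<xi>_def .
  qed
  have X\<xi>: "X h y (\<xi> b) = inner h b" if y: "y \<in> W" for y h b
  proof -
    have "((\<lambda>z. inner (z - \<phi> x) b) has_derivative (\<lambda>h. inner h b)) (at (\<phi> y))"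
      by (auto intro!: derivative_eq_intros)
    then have "((\<xi> b \<circ> inv_into U \<phi>) has_derivative (\<lambda>h. inner h b)) (at (\<phi> y))"
      by (rule has_derivative_transform_within_open[OF _ openW])
         (use y WU \<rho>(7) chart(6) in \<open>auto simp: \<xi>_def\<close>)
    from frechet_derivative_at[OF this]
    have "?D (\<xi> b) y h = inner h b" by metis
    then show ?thesis using y \<rho>(7) \<xi> by (simp add: X_def)
  qed
  have expansion: "v = (\<Sum>b\<in>B. v (\<xi> b) *\<^sub>R X b y)" if y: "y \<in> W" and v: "v \<in> tangent_space A y" for y v
  proof
    fix f
    show "v f = (\<Sum>b\<in>B. v (\<xi> b) *\<^sub>R X b y) f"
    proof (cases "f \<in> CInf")
      case False
      then show ?thesis
        by (simp add: sum_fun_eq scaleR_fun_def tangent_spaceD(4)[OF v] X_def)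
    next
      case f: True
      have "\<phi> y \<in> \<phi> ` W" using y by auto
      then obtain r where r: "r > 0" "ball (\<phi> y) r \<subseteq> \<phi> ` W"
        using openW open_contains_ball by meson
      have "smooth_on (ball (\<phi> y) r) (f \<circ> inv_into U \<phi>)"
        by (rule smooth_on_subset[OF smooth[OF f]]) (use r WU in auto)
      then obtain g where g: "\<And>b. smooth_on (ball (\<phi> y) r) (g b)" "\<And>b. g b (\<phi> y) = ?D f y b"
        "\<And>z. z \<in> ball (\<phi> y) r \<Longrightarrow> (f \<circ> inv_into U \<phi>) z = (f \<circ> inv_into U \<phi>) (\<phi> y) + (\<Sum>b\<in>B. inner (z -
            \<phi> y) b * g b z)"
        by (rule Hadamard[OF B _ r(1)]) blast
      define N where "N = U \<inter> \<phi> -` ball (\<phi> y) r \<inter> W"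
      have "open (\<phi> -` ball (\<phi> y) r \<inter> U)"
        using chart(1,5) continuous_on_open_vimage[of U \<phi>] by blast
      then have N: "open N" "y \<in> N" "N \<subseteq> U" using \<rho>(2) y WU r(1) by (auto simp: N_def Int_commute)
      \<comment> \<open>The Hadamard factors exist only on a ball in the chart; they are replaced by
        global functions with the same germ at y, to which v applies.\<close>
      have "\<exists>G\<in>CInf. \<forall>\<^sub>F z in nhds y. G z = g b (\<phi> z)" for b
      proof -
        have "smooth_on (\<phi> ` N) (g b)" by (rule smooth_on_subset[OF g(1)]) (auto simp: N_def)
        from ex_smooth_extension[OF smooth_fun_on_chart_fun[OF B compat N(1,3) this] N(2)]
        obtain G W' where "G \<in> CInf" "open W'" "y \<in> W'" "\<And>z. z \<in> W' \<Longrightarrow> G z = g b (\<phi> z)" by metis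
        then show ?thesis using eventually_nhds by blast
      qed
      then obtain G where G: "\<And>b. G b \<in> CInf" "\<And>b. \<forall>\<^sub>F z in nhds y. G b z = g b (\<phi> z)" by metis
      let ?R = "\<lambda>z. f y + (\<Sum>b\<in>B. (\<xi> b z - \<xi> b y) * G b z)"
      have \<xi>d: "(\<lambda>z. \<xi> b z - \<xi> b y) \<in> CInf" for b using smooth_funs_diff[OF \<xi> smooth_funs_const] .
      have R: "(\<lambda>z. \<Sum>b\<in>B. (\<xi> b z - \<xi> b y) * G b z) \<in> CInf"
        by (intro smooth_funs_sum smooth_funs_mult \<xi>d G)
      have "v f = v ?R"
      proof (rule tangent_local[OF v f smooth_funs_add[OF smooth_funs_const R]])
        have "finite B" using B by (simp add: orthonormal_basis_def)
        then have "\<forall>\<^sub>F z in nhds y. \<forall>b\<in>B. G b z = g b (\<phi> z)"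
          using G(2) by (intro eventually_ball_finite) auto
        moreover have "\<forall>\<^sub>F z in nhds y. z \<in> N" using eventually_nhds_in_open[OF N(1,2)] .
        ultimately show "\<forall>\<^sub>F z in nhds y. f z = ?R z"
        proof eventually_elim
          case (elim z)
          then have z: "z \<in> U" "z \<in> W" "\<phi> z \<in> ball (\<phi> y) r" by (auto simp: N_def)
          have "inner (\<phi> z - \<phi> y) b = \<xi> b z - \<xi> b y" for b
            using z(2) y \<rho>(7) by (simp add: \<xi>_def inner_diff_left)
          then show ?case using g(3)[OF z(3)] chart(6)[OF z(1)] chart(6)[of y] y WU elim(1)
            by (simp add: subset_iff)
        qed
      qed
      also have "\<dots> = (\<Sum>b\<in>B. v (\<lambda>z. (\<xi> b z - \<xi> b y) * G b z))"
        by (simp add: tangent_spaceD(1)[OF v smooth_funs_const R] tangent_const[OF v]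
            tangent_sum[OF v] smooth_funs_mult \<xi>d G)
      also have "\<dots> = (\<Sum>b\<in>B. v (\<xi> b) * X b y f)"
      proof (rule sum.cong)
        fix b
        have "G b y = ?D f y b" using eventually_nhds_x_imp_x[OF G(2)] g(2) by simp
        then show "v (\<lambda>z. (\<xi> b z - \<xi> b y) * G b z) = v (\<xi> b) * X b y f"
          using y \<rho>(7) f
          by (simp add: tangent_spaceD(3)[OF v \<xi>d G(1)] tangent_diff[OF v \<xi> smooth_funs_const]
              tangent_const[OF v] X_def)
      qed simp
      finally show ?thesis by (simp add: sum_fun_eq scaleR_fun_def)
    qed
  qed
  show ?thesis
  proof (rule that[OF _ \<rho>(3) WU])
    show "local_frame B X \<xi> W"
      using B vf \<xi> \<rho>(2) X\<xi> expansion by (auto simp: local_frame_def orthonormal_basis_def)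
    show "X h y f = ?D f y h" if "y \<in> W" "f \<in> CInf" for y h f
      using that \<rho>(7) by (simp add: X_def)
    show "\<xi> b y = inner (\<phi> y - \<phi> x) b" if "y \<in> W" for y b
      using that \<rho>(7) by (simp add: \<xi>_def)
  qed
qed

lemma ex_frame:
  obtains I :: "'v set" and X \<xi> W where "local_frame I X \<xi> W" "x \<in> W"
proof -
  obtain B :: "'v set" where B: "orthonormal_basis B"
    using ex_orthonormal_basis[OF finite_dimensional_model] by blast
  obtain U \<phi> where U: "(U, \<phi>) \<in> A" "x \<in> U" by (rule atlas_cover)
  show ?thesis
    by (rule ex_local_frame[OF B compatible_chart_atlas[OF U(1)] U(2)]) (rule that)
qed

end

section \<open>Vector fields, 1-forms and the Courant bracket\<close>

lemma scaleR_fun_apply: "(c *\<^sub>R f) x = c *\<^sub>R f x"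
  by (simp add: scaleR_fun_def)

context smooth_manifold
begin

section \<open>Vector fields and the Lie bracket\<close>

lemma smooth_vfieldD:
  assumes "smooth_vfield A X"
  shows "X x \<in> tangent_space A x" "f \<in> CInf \<Longrightarrow> (\<lambda>x. X x f) \<in> CInf"
  using assms by (auto simp: smooth_vfield_on_def smooth_funs_iff)

lemma smooth_vfieldI:
  assumes "\<And>x. X x \<in> tangent_space A x" "\<And>f. f \<in> CInf \<Longrightarrow> (\<lambda>x. X x f) \<in> CInf"
  shows "smooth_vfield A X"
  using assms by (auto simp: smooth_vfield_on_def smooth_funs_iff)

lemma smooth_vfield_zero: "smooth_vfield A (\<lambda>_. 0)"
  by (rule smooth_vfieldI) (auto simp: zero_fun_apply subspace_0[OF subspace_tangent_space])

lemma smooth_vfield_add: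
  "smooth_vfield A X \<Longrightarrow> smooth_vfield A Y \<Longrightarrow> smooth_vfield A (\<lambda>x. X x + Y x)"
  by (rule smooth_vfieldI)
     (auto simp: plus_fun_apply intro: smooth_funs_add smooth_vfieldD subspace_add[OF
         subspace_tangent_space])

lemma smooth_vfield_scaleR:
  "g \<in> CInf \<Longrightarrow> smooth_vfield A X \<Longrightarrow> smooth_vfield A (\<lambda>x. g x *\<^sub>R X x)"
  by (rule smooth_vfieldI)
     (auto simp: scaleR_fun_apply intro: smooth_funs_mult smooth_vfieldD subspace_scale[OF
         subspace_tangent_space])

lemma smooth_vfield_sum:
  "(\<And>i. i \<in> I \<Longrightarrow> smooth_vfield A (X i)) \<Longrightarrow> smooth_vfield A (\<lambda>x. \<Sum>i\<in>I. X i x)"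
  by (induction I rule: infinite_finite_induct) (auto intro!: smooth_vfield_zero smooth_vfield_add)

lemma smooth_vfield_diff:
  assumes "smooth_vfield A X" "smooth_vfield A Y"
  shows "smooth_vfield A (\<lambda>x. X x - Y x)"
  using smooth_vfield_add[OF assms(1) smooth_vfield_scaleR[OF smooth_funs_const assms(2), of "- 1"]]
      by simp

text \<open>In the Leibniz rule the mixed products of first derivatives of f and g are symmetric in
  X and Y, so they cancel in the commutator.\<close>

lemma lie_bracket_mem_tangent_space:
  assumes X: "smooth_vfield A X" and Y: "smooth_vfield A Y"
  shows "lie_bracket X Y x \<in> tangent_space A x"
proof (rule tangent_spaceI)
  note X' = smooth_vfieldD[OF X] and Y' = smooth_vfieldD[OF Y]
  note TX = tangent_spaceD[OF X'(1)] and TY = tangent_spaceD[OF Y'(1)]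
  show "lie_bracket X Y x (\<lambda>y. f y + g y) = lie_bracket X Y x f + lie_bracket X Y x g"
    if "f \<in> CInf" "g \<in> CInf" for f g
    using that by (simp add: lie_bracket_def TX(1) TY(1) X' Y')
  show "lie_bracket X Y x (\<lambda>y. c * f y) = c * lie_bracket X Y x f" if "f \<in> CInf" for f c
    using that by (simp add: lie_bracket_def TX(2) TY(2) X' Y' algebra_simps)
  show "lie_bracket X Y x (\<lambda>y. f y * g y) = f x * lie_bracket X Y x g + g x * lie_bracket X Y x f"
    if "f \<in> CInf" "g \<in> CInf" for f g
    using that by (simp add: lie_bracket_def TX(1,3) TY(1,3) X' Y' smooth_funs_mult algebra_simps)
  \<comment> \<open>On a function that is not smooth both inner functions are constantly 0, and
    derivations kill constants.\<close>
  show "lie_bracket X Y x f = 0" if "f \<notin> CInf" for f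
    using that by (simp add: lie_bracket_def TX(4) TY(4) tangent_const[OF X'(1)] tangent_const[OF Y'(1)])
qed

lemma smooth_vfield_lie_bracket:
  assumes "smooth_vfield A X" "smooth_vfield A Y"
  shows "smooth_vfield A (lie_bracket X Y)"
proof (rule smooth_vfieldI)
  fix f assume f: "f \<in> CInf"
  show "(\<lambda>x. lie_bracket X Y x f) \<in> CInf"
    unfolding lie_bracket_def
    by (rule smooth_funs_diff[OF smooth_vfieldD(2)[OF assms(1) smooth_vfieldD(2)[OF assms(2) f]]
          smooth_vfieldD(2)[OF assms(2) smooth_vfieldD(2)[OF assms(1) f]]])
qed (rule lie_bracket_mem_tangent_space[OF assms])

lemma lie_bracket_minus: "lie_bracket X Y x = - lie_bracket Y X x"
  by (simp add: lie_bracket_def fun_eq_iff)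

lemma lie_bracket_add:
  assumes X: "smooth_vfield A X" and Y: "smooth_vfield A Y" and Z: "smooth_vfield A Z"
  shows "lie_bracket X (\<lambda>x. Y x + Z x) x = lie_bracket X Y x + lie_bracket X Z x"
proof
  note X' = smooth_vfieldD[OF X] and Y' = smooth_vfieldD[OF Y] and Z' = smooth_vfieldD[OF Z]
  note TX = tangent_spaceD[OF X'(1)] and TY = tangent_spaceD[OF Y'(1)] and TZ = tangent_spaceD[OF Z'(1)]
  fix f
  show "lie_bracket X (\<lambda>x. Y x + Z x) x f = (lie_bracket X Y x + lie_bracket X Z x) f"
    by (cases "f \<in> CInf")
       (simp_all add: lie_bracket_def TX(1,4) TY(4) TZ(4) Y' Z' tangent_const[OF X'(1)]
           tangent_const[OF Y'(1)] tangent_const[OF Z'(1)])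
qed

lemma lie_bracket_scaleR:
  assumes X: "smooth_vfield A X" and Y: "smooth_vfield A Y" and g: "g \<in> CInf"
  shows "lie_bracket X (\<lambda>x. g x *\<^sub>R Y x) x = g x *\<^sub>R lie_bracket X Y x + X x g *\<^sub>R Y x"
proof
  note X' = smooth_vfieldD[OF X] and Y' = smooth_vfieldD[OF Y]
  note TX = tangent_spaceD[OF X'(1)] and TY = tangent_spaceD[OF Y'(1)]
  fix f
  show "lie_bracket X (\<lambda>x. g x *\<^sub>R Y x) x f = (g x *\<^sub>R lie_bracket X Y x + X x g *\<^sub>R Y x) f"
    by (cases "f \<in> CInf")
       (simp_all add: lie_bracket_def scaleR_fun_apply TX(3,4) TY(4) Y' g tangent_const[OF X'(1)]
           tangent_const[OF Y'(1)] algebra_simps)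
qed

text \<open>Constant coefficients with respect to a frame of global fields. The choice in
  \<open>extension\<close> is meaningful because of this.\<close>

lemma ex_smooth_vfield_through:
  assumes v: "v \<in> tangent_space A x"
  shows "\<exists>X. smooth_vfield A X \<and> X x = v"
proof -
  obtain I :: "'v set" and X \<xi> W where F: "local_frame I X \<xi> W" "x \<in> W" by (rule ex_frame)
  have "smooth_vfield A (\<lambda>y. \<Sum>i\<in>I. v (\<xi> i) *\<^sub>R X i y)"
    by (intro smooth_vfield_sum smooth_vfield_scaleR smooth_funs_const local_frameD(3)[OF F(1)])
  then show ?thesis using local_frameD(6)[OF F(1) F(2) v] by metis
qed

lemma extension:
  assumes "v \<in> tangent_space A x"
  shows "smooth_vfield A (extension A x v)" "extension A x v x = v"
  using someI_ex[OF ex_smooth_vfield_through[OF assms]] unfolding extension_def by blast+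

section \<open>Covectors and 1-forms\<close>

lemma cotangent_spaceD:
  assumes "\<alpha> \<in> cotangent_space A x"
  shows "v \<in> tangent_space A x \<Longrightarrow> w \<in> tangent_space A x \<Longrightarrow> \<alpha> (v + w) = \<alpha> v + \<alpha> w"
    "v \<in> tangent_space A x \<Longrightarrow> \<alpha> (c *\<^sub>R v) = c * \<alpha> v" "v \<notin> tangent_space A x \<Longrightarrow> \<alpha> v = 0"
    "linear_on (tangent_space A x) \<alpha>"
  using assms linear_onD[of "tangent_space A x" \<alpha>] by (auto simp: cotangent_space_def)

lemma cotangent_spaceI:
  assumes "\<And>v w. v \<in> tangent_space A x \<Longrightarrow> w \<in> tangent_space A x \<Longrightarrow> \<alpha> (v + w) = \<alpha> v + \<alpha> w"
    "\<And>v c. v \<in> tangent_space A x \<Longrightarrow> \<alpha> (c *\<^sub>R v) = c * \<alpha> v" "\<And>v. v \<notin> tangent_space A x \<Longrightarrow> \<alpha> v = 0"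
  shows "\<alpha> \<in> cotangent_space A x"
  using assms by (auto simp: cotangent_space_def linear_on_def)

lemma cotangent_zero: "\<alpha> \<in> cotangent_space A x \<Longrightarrow> \<alpha> 0 = 0"
  using linear_on_zero cotangent_spaceD(4) subspace_0[OF subspace_tangent_space] by blast

lemma cotangent_minus: "\<alpha> \<in> cotangent_space A x \<Longrightarrow> v \<in> tangent_space A x \<Longrightarrow> \<alpha> (- v) = - \<alpha> v"
  using cotangent_spaceD(2)[of \<alpha> x v "- 1"] by simp

lemma cotangent_diff:
  "\<alpha> \<in> cotangent_space A x \<Longrightarrow> v \<in> tangent_space A x \<Longrightarrow> w \<in> tangent_space A x \<Longrightarrow> \<alpha> (v - w) = \<alpha> v - \<alpha> w"
  using linear_on_diff cotangent_spaceD(4) subspace_tangent_space by blast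

lemma cotangent_sum:
  "\<alpha> \<in> cotangent_space A x \<Longrightarrow> (\<And>i. i \<in> I \<Longrightarrow> v i \<in> tangent_space A x) \<Longrightarrow>
    \<alpha> (\<Sum>i\<in>I. c i *\<^sub>R v i) = (\<Sum>i\<in>I. c i * \<alpha> (v i))"
  using linear_on_sum[OF cotangent_spaceD(4) subspace_tangent_space, of \<alpha> x I v c] by simp

lemma cotangent_eqI:
  assumes "\<alpha> \<in> cotangent_space A x" "\<beta> \<in> cotangent_space A x" "\<And>v. v \<in> tangent_space A x \<Longrightarrow> \<alpha> v = \<beta> v"
  shows "\<alpha> = \<beta>"
  using assms cotangent_spaceD(3) by (metis ext)

lemma subspace_cotangent_space: "subspace (cotangent_space A x)"
  by (rule subspaceI; rule cotangent_spaceI)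
     (auto simp: cotangent_spaceD scaleR_fun_apply algebra_simps)

lemma smooth_form1D:
  assumes "smooth_form1 A \<alpha>"
  shows "\<alpha> x \<in> cotangent_space A x" "smooth_vfield A X \<Longrightarrow> (\<lambda>x. \<alpha> x (X x)) \<in> CInf"
  using assms by (auto simp: smooth_form1_on_def smooth_funs_iff)

lemma smooth_form1I:
  assumes "\<And>x. \<alpha> x \<in> cotangent_space A x" "\<And>X. smooth_vfield A X \<Longrightarrow> (\<lambda>x. \<alpha> x (X x)) \<in> CInf"
  shows "smooth_form1 A \<alpha>"
  using assms by (auto simp: smooth_form1_on_def smooth_funs_iff)

lemma smooth_form1_add:
  "smooth_form1 A \<alpha> \<Longrightarrow> smooth_form1 A \<beta> \<Longrightarrow> smooth_form1 A (\<lambda>x. \<alpha> x + \<beta> x)"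
  by (rule smooth_form1I)
     (auto simp: plus_fun_apply smooth_form1D intro!: smooth_funs_add subspace_add[OF
         subspace_cotangent_space])

lemma smooth_form1_scaleR:
  "g \<in> CInf \<Longrightarrow> smooth_form1 A \<alpha> \<Longrightarrow> smooth_form1 A (\<lambda>x. g x *\<^sub>R \<alpha> x)"
  by (rule smooth_form1I)
     (auto simp: scaleR_fun_apply smooth_form1D intro!: smooth_funs_mult subspace_scale[OF
         subspace_cotangent_space])

lemma smooth_form1_diff:
  assumes "smooth_form1 A \<alpha>" "smooth_form1 A \<beta>"
  shows "smooth_form1 A (\<lambda>x. \<alpha> x - \<beta> x)"
  using smooth_form1_add[OF assms(1) smooth_form1_scaleR[OF smooth_funs_const assms(2), of "- 1"]]
      by simp

lemma differential_apply: "v \<in> tangent_space A x \<Longrightarrow> differential A f x v = v f"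
  by (simp add: differential_def)

lemma differential_mem: "differential A f x \<in> cotangent_space A x"
  by (rule cotangent_spaceI)
     (auto simp: differential_def scaleR_fun_apply subspace_add[OF subspace_tangent_space]
        subspace_scale[OF subspace_tangent_space])

lemma smooth_form1_differential: "f \<in> CInf \<Longrightarrow> smooth_form1 A (differential A f)"
  by (rule smooth_form1I) (simp_all add: differential_mem differential_apply smooth_vfieldD(1)
      smooth_vfieldD(2)[of _ f])

text \<open>A functional that is \<open>C\<^sup>\<infinity>\<close>-linear at \<open>x\<close> sees only the germ at \<open>x\<close>: multiply by a bump function.\<close>

lemma module_functional_expand:
  fixes S :: "('a \<Rightarrow> 'c::real_vector) set" and \<Phi> :: "('a \<Rightarrow> 'c) \<Rightarrow> real"
  assumes S_add: "\<And>s t. s \<in> S \<Longrightarrow> t \<in> S \<Longrightarrow> (\<lambda>y. s y + t y) \<in> S"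
    and S_scale: "\<And>g s. g \<in> CInf \<Longrightarrow> s \<in> S \<Longrightarrow> (\<lambda>y. g y *\<^sub>R s y) \<in> S"
    and add: "\<And>s t. s \<in> S \<Longrightarrow> t \<in> S \<Longrightarrow> \<Phi> (\<lambda>y. s y + t y) = \<Phi> s + \<Phi> t"
    and scale: "\<And>g s. g \<in> CInf \<Longrightarrow> s \<in> S \<Longrightarrow> \<Phi> (\<lambda>y. g y *\<^sub>R s y) = g x * \<Phi> s"
    and W: "open W" "x \<in> W" and I: "finite I" and s: "s \<in> S"
    and e: "\<And>i. i \<in> I \<Longrightarrow> e i \<in> S" "\<And>i. i \<in> I \<Longrightarrow> f i \<in> CInf"
    and eq: "\<And>y. y \<in> W \<Longrightarrow> s y = (\<Sum>i\<in>I. f i y *\<^sub>R e i y)"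
  shows "\<Phi> s = (\<Sum>i\<in>I. f i x * \<Phi> (e i))"
proof -
  obtain \<rho> W' C where \<rho>: "\<rho> \<in> CInf" "open W'" "x \<in> W'" "W' \<subseteq> C" "closed C" "C \<subseteq> W"
    "\<And>y. y \<in> W' \<Longrightarrow> \<rho> y = 1" "\<And>y. y \<notin> C \<Longrightarrow> \<rho> y = 0"
    using ex_bump[OF W] by blast
  have zero: "(\<lambda>_. 0) \<in> S" "\<Phi> (\<lambda>_. 0) = 0"
    using S_scale[OF smooth_funs_const s, of 0] scale[OF smooth_funs_const s, of 0] by simp_all
  have "(\<lambda>y. \<Sum>i\<in>J. (\<rho> y * f i y) *\<^sub>R e i y) \<in> S \<and>
      \<Phi> (\<lambda>y. \<Sum>i\<in>J. (\<rho> y * f i y) *\<^sub>R e i y) = (\<Sum>i\<in>J. f i x * \<Phi> (e i))" if "J \<subseteq> I" for J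
    using finite_subset[OF that I] that
  proof (induction J)
    case empty
    then show ?case using zero by simp
  next
    case (insert i J)
    have g: "(\<lambda>y. \<rho> y * f i y) \<in> CInf" using smooth_funs_mult[OF \<rho>(1)] e(2) insert by simp
    note 1 = S_scale[OF g e(1)] and 2 = scale[OF g e(1)]
    show ?case using insert S_add[OF 1] add[OF 1] 2 \<rho>(3,7) by simp
  qed
  \<comment> \<open>The bump turns the expansion over \<open>W\<close> into an identity between
    global elements of \<open>S\<close>, and its value 1 at x makes the functional ignore
    it.\<close>
  moreover have "\<rho> y *\<^sub>R s y = (\<Sum>i\<in>I. (\<rho> y * f i y) *\<^sub>R e i y)" for y
    using \<rho>(6,8) eq by (cases "y \<in> C") (auto simp: scaleR_sum_right)
  ultimately have "\<Phi> (\<lambda>y. \<rho> y *\<^sub>R s y) = (\<Sum>i\<in>I. f i x * \<Phi> (e i))" by simp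
  then show ?thesis using scale[OF \<rho>(1) s] \<rho>(3,7) by simp
qed

text \<open>In a frame around x the functional depends only on the coefficients
  \<open>V x (\<xi> i)\<close>, that is, on the value of the field at x.\<close>

lemma tensorial:
  assumes "\<And>X Y. smooth_vfield A X \<Longrightarrow> smooth_vfield A Y \<Longrightarrow> \<Phi> (\<lambda>y. X y + Y y) = \<Phi> X + \<Phi> Y"
    and "\<And>g X. g \<in> CInf \<Longrightarrow> smooth_vfield A X \<Longrightarrow> \<Phi> (\<lambda>y. g y *\<^sub>R X y) = g x * \<Phi> X"
    and "smooth_vfield A X" "smooth_vfield A Y" "X x = Y x"
  shows "\<Phi> X = (\<Phi> Y :: real)"
proof -
  obtain I :: "'v set" and Z \<xi> W where F: "local_frame I Z \<xi> W" "x \<in> W" by (rule ex_frame)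
  note FD = local_frameD[OF F(1)]
  have *: "\<Phi> V = (\<Sum>i\<in>I. V x (\<xi> i) * \<Phi> (Z i))" if "smooth_vfield A V" for V
  proof (rule module_functional_expand[where S = "{X. smooth_vfield A X}" and W = W and e = Z and f
      = "\<lambda>i y. V y (\<xi> i)"])
    show "V y = (\<Sum>i\<in>I. V y (\<xi> i) *\<^sub>R Z i y)" if "y \<in> W" for y
      using FD(6)[OF that smooth_vfieldD(1)[OF \<open>smooth_vfield A V\<close>]] .
    show "(\<lambda>y. V y (\<xi> i)) \<in> CInf" for i
      using smooth_vfieldD(2)[OF that FD(4)] .
    show "\<Phi> (\<lambda>y. s y + t y) = \<Phi> s + \<Phi> t" if "s \<in> {X. smooth_vfield A X}" "t \<in> {X. smooth_vfield A
        X}" for s t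
      by (rule assms(1)) (use that in simp_all)
  qed (use assms(2) F(2) FD(1-3) that smooth_vfield_add smooth_vfield_scaleR in simp_all)
  show ?thesis using *[OF assms(3)] *[OF assms(4)] assms(5) by simp
qed

text \<open>The definition evaluates on a chosen extension of a vector. Replacing Y by g Y
  differentiates g once through \<alpha>(Y) and once through the bracket, with opposite signs; so
  the expression is tensorial in Y, and any field through the vector may replace the
  extension.\<close>

lemma lie_deriv1_eq:
  assumes X: "smooth_vfield A X" and \<alpha>: "smooth_form1 A \<alpha>" and Y: "smooth_vfield A Y"
  shows "lie_deriv1 A X \<alpha> x (Y x) = X x (\<lambda>y. \<alpha> y (Y y)) - \<alpha> x (lie_bracket X Y x)"
proof -
  let ?\<Phi> = "\<lambda>Y. X x (\<lambda>y. \<alpha> y (Y y)) - \<alpha> x (lie_bracket X Y x)"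
  note TX = tangent_spaceD[OF smooth_vfieldD(1)[OF X]] and \<alpha>' = smooth_form1D[OF \<alpha>]
  note L = cotangent_spaceD[OF \<alpha>'(1)]
  have "?\<Phi> (extension A x (Y x)) = ?\<Phi> Y"
  proof (rule tensorial[where \<Phi> = ?\<Phi>])
    show "?\<Phi> (\<lambda>y. Y y + Z y) = ?\<Phi> Y + ?\<Phi> Z" if "smooth_vfield A Y" "smooth_vfield A Z" for Y Z
      using that smooth_vfieldD(1)[OF that(1)] smooth_vfieldD(1)[OF that(2)]
      by (simp add: lie_bracket_add[OF X] L(1) lie_bracket_mem_tangent_space[OF X] TX(1) \<alpha>')
    show "?\<Phi> (\<lambda>y. g y *\<^sub>R Y y) = g x * ?\<Phi> Y" if "g \<in> CInf" "smooth_vfield A Y" for g Y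
      using that smooth_vfieldD(1)[OF that(2)]
      by (simp add: lie_bracket_scaleR[OF X] L(1,2) lie_bracket_mem_tangent_space[OF X] TX(3) \<alpha>'
          subspace_scale[OF subspace_tangent_space] algebra_simps)
  qed (use Y extension smooth_vfieldD(1)[OF Y] in auto)
  then show ?thesis
    using smooth_vfieldD(1)[OF Y] by (simp add: lie_deriv1_def Let_def)
qed

lemma ext_deriv1_eq:
  assumes \<alpha>: "smooth_form1 A \<alpha>" and X: "smooth_vfield A X" and Y: "smooth_vfield A Y"
  shows "ext_deriv1 A \<alpha> x (X x) (Y x) =
    X x (\<lambda>y. \<alpha> y (Y y)) - Y x (\<lambda>y. \<alpha> y (X y)) - \<alpha> x (lie_bracket X Y x)"
proof -
  let ?\<Phi> = "\<lambda>X Y. X x (\<lambda>y. \<alpha> y (Y y)) - Y x (\<lambda>y. \<alpha> y (X y)) - \<alpha> x (lie_bracket X Y x)"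
  note \<alpha>' = smooth_form1D[OF \<alpha>]
  note L = cotangent_spaceD[OF \<alpha>'(1)]
  have tens: "?\<Phi> X Y = ?\<Phi> X Y'"
    if X: "smooth_vfield A X" and Y: "smooth_vfield A Y" "smooth_vfield A Y'" "Y x = Y' x" for X Y Y'
  proof (rule tensorial[where \<Phi> = "?\<Phi> X", OF _ _ Y])
    note TX = tangent_spaceD[OF smooth_vfieldD(1)[OF X]]
    show "?\<Phi> X (\<lambda>y. Y y + Z y) = ?\<Phi> X Y + ?\<Phi> X Z" if "smooth_vfield A Y" "smooth_vfield A Z" for Y Z
      using that smooth_vfieldD(1)[OF that(1)] smooth_vfieldD(1)[OF that(2)]
      by (simp add: lie_bracket_add[OF X] L(1) lie_bracket_mem_tangent_space[OF X] TX(1) \<alpha>')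
    show "?\<Phi> X (\<lambda>y. g y *\<^sub>R Y y) = g x * ?\<Phi> X Y" if "g \<in> CInf" "smooth_vfield A Y" for g Y
      using that smooth_vfieldD(1)[OF that(2)]
      by (simp add: lie_bracket_scaleR[OF X] L(1,2) lie_bracket_mem_tangent_space[OF X] TX(3) \<alpha>'
          scaleR_fun_apply
          subspace_scale[OF subspace_tangent_space] algebra_simps)
  qed
  have antisym: "?\<Phi> X Y = - ?\<Phi> Y X" if "smooth_vfield A X" "smooth_vfield A Y" for X Y
    using cotangent_minus[OF \<alpha>'(1) lie_bracket_mem_tangent_space[OF that(2,1)]]
    by (simp add: lie_bracket_minus[of X Y])
  let ?X = "extension A x (X x)" and ?Y = "extension A x (Y x)"
  note e = extension[OF smooth_vfieldD(1)[OF X]] extension[OF smooth_vfieldD(1)[OF Y]]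
  \<comment> \<open>Tensoriality is available in the second argument only: the extension of Y is
    exchanged first, and antisymmetry then brings that of X into the same position.\<close>
  have "?\<Phi> ?X ?Y = ?\<Phi> ?X Y" using tens[OF e(1,3) Y e(4)] .
  also have "\<dots> = - ?\<Phi> Y ?X" using antisym[OF e(1) Y] .
  also have "?\<Phi> Y ?X = ?\<Phi> Y X" using tens[OF Y e(1) X e(2)] .
  also have "- ?\<Phi> Y X = ?\<Phi> X Y" using antisym[OF X Y] by linarith
  finally show ?thesis
    using smooth_vfieldD(1)[OF X] smooth_vfieldD(1)[OF Y] by (simp add: ext_deriv1_def Let_def)
qed

text \<open>Linearity at a point is hidden by the definition, since the chosen extensions of v, w
  and v + w are unrelated. By \<open>lie_deriv1_eq\<close> the sum of fields through v and w may be
  used for v + w.\<close>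

lemma smooth_form1_lie_deriv1:
  assumes X: "smooth_vfield A X" and \<alpha>: "smooth_form1 A \<alpha>"
  shows "smooth_form1 A (lie_deriv1 A X \<alpha>)"
proof (rule smooth_form1I)
  note \<alpha>' = smooth_form1D[OF \<alpha>] and X' = smooth_vfieldD[OF X]
  note TX = tangent_spaceD[OF X'(1)] and L = cotangent_spaceD[OF \<alpha>'(1)]
  show "(\<lambda>x. lie_deriv1 A X \<alpha> x (Y x)) \<in> CInf" if Y: "smooth_vfield A Y" for Y
    unfolding lie_deriv1_eq[OF X \<alpha> Y]
    by (rule smooth_funs_diff[OF X'(2)[OF \<alpha>'(2)[OF Y]] \<alpha>'(2)[OF smooth_vfield_lie_bracket[OF X Y]]])
  show "lie_deriv1 A X \<alpha> x \<in> cotangent_space A x" for x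
  proof (rule cotangent_spaceI)
    fix v w assume "v \<in> tangent_space A x" "w \<in> tangent_space A x"
    then obtain V W where VW: "smooth_vfield A V" "V x = v" "smooth_vfield A W" "W x = w"
      using ex_smooth_vfield_through by metis
    note V = smooth_vfieldD(1)[OF VW(1)] and W = smooth_vfieldD(1)[OF VW(3)]
    show "lie_deriv1 A X \<alpha> x (v + w) = lie_deriv1 A X \<alpha> x v + lie_deriv1 A X \<alpha> x w"
      using lie_deriv1_eq[OF X \<alpha> smooth_vfield_add[OF VW(1,3)], of x]
        lie_deriv1_eq[OF X \<alpha> VW(1), of x] lie_deriv1_eq[OF X \<alpha> VW(3), of x] VW
      by (simp add: lie_bracket_add[OF X] L(1) V W TX(1) \<alpha>' lie_bracket_mem_tangent_space[OF X])
  next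
    fix v c assume "v \<in> tangent_space A x"
    then obtain V where VW: "smooth_vfield A V" "V x = v" using ex_smooth_vfield_through by metis
    note V = smooth_vfieldD(1)[OF VW(1)]
    show "lie_deriv1 A X \<alpha> x (c *\<^sub>R v) = c * lie_deriv1 A X \<alpha> x v"
      using lie_deriv1_eq[OF X \<alpha> smooth_vfield_scaleR[OF smooth_funs_const VW(1)], of x c]
        lie_deriv1_eq[OF X \<alpha> VW(1), of x] VW
      by (simp add: lie_bracket_scaleR[OF X VW(1) smooth_funs_const] tangent_const[OF X'(1)] L(2) V
          TX(2) \<alpha>'
          lie_bracket_mem_tangent_space[OF X] right_diff_distrib)
  qed (simp add: lie_deriv1_def)
qed

lemma smooth_form1_ext_deriv1:
  assumes X: "smooth_vfield A X" and \<alpha>: "smooth_form1 A \<alpha>"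
  shows "smooth_form1 A (\<lambda>x. ext_deriv1 A \<alpha> x (X x))"
proof (rule smooth_form1I)
  note \<alpha>' = smooth_form1D[OF \<alpha>] and X' = smooth_vfieldD[OF X]
  note TX = tangent_spaceD[OF X'(1)] and L = cotangent_spaceD[OF \<alpha>'(1)]
  show "(\<lambda>x. ext_deriv1 A \<alpha> x (X x) (Y x)) \<in> CInf" if Y: "smooth_vfield A Y" for Y
    unfolding ext_deriv1_eq[OF \<alpha> X Y]
    by (rule smooth_funs_diff[OF smooth_funs_diff[OF X'(2)[OF \<alpha>'(2)[OF Y]] smooth_vfieldD(2)[OF Y
        \<alpha>'(2)[OF X]]]
          \<alpha>'(2)[OF smooth_vfield_lie_bracket[OF X Y]]])
  show "ext_deriv1 A \<alpha> x (X x) \<in> cotangent_space A x" for x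
  proof (rule cotangent_spaceI)
    fix v w assume "v \<in> tangent_space A x" "w \<in> tangent_space A x"
    then obtain V W where VW: "smooth_vfield A V" "V x = v" "smooth_vfield A W" "W x = w"
      using ex_smooth_vfield_through by metis
    note V = smooth_vfieldD(1)[OF VW(1)] and W = smooth_vfieldD(1)[OF VW(3)]
    show "ext_deriv1 A \<alpha> x (X x) (v + w) = ext_deriv1 A \<alpha> x (X x) v + ext_deriv1 A \<alpha> x (X x) w"
      using ext_deriv1_eq[OF \<alpha> X smooth_vfield_add[OF VW(1,3)], of x]
        ext_deriv1_eq[OF \<alpha> X VW(1), of x] ext_deriv1_eq[OF \<alpha> X VW(3), of x] VW
      by (simp add: lie_bracket_add[OF X] L(1) V W TX(1) \<alpha>' lie_bracket_mem_tangent_space[OF X])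
  next
    fix v c assume "v \<in> tangent_space A x"
    then obtain V where VW: "smooth_vfield A V" "V x = v" using ex_smooth_vfield_through by metis
    note V = smooth_vfieldD(1)[OF VW(1)]
    have "(c *\<^sub>R v) f = c * v f" for f :: "'a \<Rightarrow> real" by (simp add: scaleR_fun_apply)
    then show "ext_deriv1 A \<alpha> x (X x) (c *\<^sub>R v) = c * ext_deriv1 A \<alpha> x (X x) v"
      using ext_deriv1_eq[OF \<alpha> X smooth_vfield_scaleR[OF smooth_funs_const VW(1)], of x c]
        ext_deriv1_eq[OF \<alpha> X VW(1), of x] VW
      by (simp add: lie_bracket_scaleR[OF X VW(1) smooth_funs_const] tangent_const[OF X'(1)] L(2) V
          TX(2) \<alpha>'
          lie_bracket_mem_tangent_space[OF X] right_diff_distrib)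
  qed (simp add: ext_deriv1_def)
qed

section \<open>Sections and the Courant bracket\<close>

abbreviation "smooth_section \<equiv> smooth_section_on A UNIV"

lemma smooth_section_iff:
  "smooth_section s \<longleftrightarrow> smooth_vfield A (\<lambda>x. fst (s x)) \<and> smooth_form1 A (\<lambda>x. snd (s x))"
  by (simp add: smooth_section_on_def o_def)

lemma smooth_sectionD:
  assumes "smooth_section s"
  shows "smooth_vfield A (\<lambda>x. fst (s x))" "smooth_form1 A (\<lambda>x. snd (s x))"
    "fst (s x) \<in> tangent_space A x" "snd (s x) \<in> cotangent_space A x"
  using assms smooth_vfieldD(1)[of "\<lambda>x. fst (s x)"] smooth_form1D(1)[of "\<lambda>x. snd (s x)"]
  unfolding smooth_section_iff by blast+

lemma smooth_section_add: "smooth_section s \<Longrightarrow> smooth_section t \<Longrightarrow> smooth_section (\<lambda>x. s x + t x)"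
  by (simp add: smooth_section_iff smooth_vfield_add smooth_form1_add)

lemma smooth_section_scaleR: "g \<in> CInf \<Longrightarrow> smooth_section s \<Longrightarrow> smooth_section (\<lambda>x. g x *\<^sub>R s x)"
  by (simp add: smooth_section_iff smooth_vfield_scaleR smooth_form1_scaleR)

lemma smooth_section_courant_bracket:
  assumes "smooth_section s" "smooth_section t"
  shows "smooth_section (courant_bracket A s t)"
  using smooth_sectionD(1,2)[OF assms(1)] smooth_sectionD(1,2)[OF assms(2)]
  by (simp add: smooth_section_iff courant_bracket_def o_def smooth_vfield_lie_bracket
      smooth_form1_diff smooth_form1_lie_deriv1 smooth_form1_ext_deriv1)

text \<open>On isotropic sections this is \<open>2 \<langle>[s, t], r\<rangle>\<close>, written so that cyclic invariance is evident.\<close>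

definition courant_tensor ::
    "('a \<Rightarrow> 'a tvec \<times> 'a covec) \<Rightarrow> ('a \<Rightarrow> 'a tvec \<times> 'a covec) \<Rightarrow> ('a \<Rightarrow> 'a tvec \<times> 'a covec) \<Rightarrow> 'a \<Rightarrow> real"
  where "courant_tensor s t r x =
    fst (s x) (\<lambda>y. snd (t y) (fst (r y))) + fst (t x) (\<lambda>y. snd (r y) (fst (s y))) + fst (r x) (\<lambda>y.
        snd (s y) (fst (t y))) +
    snd (s x) (lie_bracket (\<lambda>y. fst (t y)) (\<lambda>y. fst (r y)) x) +
    snd (t x) (lie_bracket (\<lambda>y. fst (r y)) (\<lambda>y. fst (s y)) x) +
    snd (r x) (lie_bracket (\<lambda>y. fst (s y)) (\<lambda>y. fst (t y)) x)"

lemma courant_tensor_cyclic: "courant_tensor s t r x = courant_tensor t r s x"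
  by (simp add: courant_tensor_def)

text \<open>For s = (X, \<alpha>), t = (Y, \<beta>) and r = (Z, \<zeta>), the formulas for the two
  derivatives give the terms of the tensor, except that - Y(\<alpha>(Z)) stands in place of
  Y(\<zeta>(X)). These agree because \<zeta>(X) = - \<alpha>(Z); the equation is differentiated
  along Y, so isotropy is assumed at every point.\<close>

lemma pairing_courant_bracket:
  assumes s: "smooth_section s" and t: "smooth_section t" and r: "smooth_section r"
    and "\<And>y. pairing (s y) (r y) = 0"
  shows "2 * pairing (courant_bracket A s t x) (r x) = courant_tensor s t r x"
proof -
  note sD = smooth_sectionD[OF s] and tD = smooth_sectionD[OF t] and rD = smooth_sectionD[OF r]
  have sr: "snd (r y) (fst (s y)) = - snd (s y) (fst (r y))" for y
    using assms(4)[of y] by (simp add: pairing_def)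
  have 1: "fst (t x) (\<lambda>y. snd (r y) (fst (s y))) = - fst (t x) (\<lambda>y. snd (s y) (fst (r y)))"
    unfolding sr by (rule tangent_minus[OF tD(3)]) (rule smooth_form1D(2)[OF sD(2) rD(1)])
  have 2: "snd (t x) (lie_bracket (\<lambda>y. fst (r y)) (\<lambda>y. fst (s y)) x) = - snd (t x) (lie_bracket (\<lambda>y.
      fst (s y)) (\<lambda>y. fst (r y)) x)"
    using cotangent_minus[OF tD(4) lie_bracket_mem_tangent_space[OF sD(1) rD(1)]]
    by (simp add: lie_bracket_minus[of "\<lambda>y. fst (r y)"])
  show ?thesis
    using lie_deriv1_eq[OF sD(1) tD(2) rD(1), of x] ext_deriv1_eq[OF sD(2) tD(1) rD(1), of x]
    by (simp add: pairing_def courant_bracket_def o_def courant_tensor_def 1 2)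
qed

lemma courant_tensor_add:
  assumes s: "smooth_section s" and s': "smooth_section s'" and t: "smooth_section t" and r:
      "smooth_section r"
  shows "courant_tensor (\<lambda>y. s y + s' y) t r x = courant_tensor s t r x + courant_tensor s' t r x"
proof -
  note sD = smooth_sectionD[OF s] and sD' = smooth_sectionD[OF s'] and tD = smooth_sectionD[OF t]
      and rD = smooth_sectionD[OF r]
  note rL = cotangent_spaceD[OF rD(4)] and tL = cotangent_spaceD[OF tD(4)]
  note rT = tangent_spaceD[OF rD(3)] and tT = tangent_spaceD[OF tD(3)]
  have 1: "lie_bracket (\<lambda>y. fst (s y) + fst (s' y)) (\<lambda>y. fst (t y)) x =
      lie_bracket (\<lambda>y. fst (s y)) (\<lambda>y. fst (t y)) x + lie_bracket (\<lambda>y. fst (s' y)) (\<lambda>y. fst (t y)) x"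
    using lie_bracket_add[OF tD(1) sD(1) sD'(1), of x] by (simp add: lie_bracket_minus[of _ "\<lambda>y. fst
        (t y)"])
  show ?thesis
    by (simp add: courant_tensor_def 1 lie_bracket_add[OF rD(1) sD(1) sD'(1)]
        rL(1) tL(1) sD sD' lie_bracket_mem_tangent_space[OF sD(1) tD(1)]
            lie_bracket_mem_tangent_space[OF sD'(1) tD(1)]
        lie_bracket_mem_tangent_space[OF rD(1) sD(1)] lie_bracket_mem_tangent_space[OF rD(1) sD'(1)]
        tT(1) rT(1) smooth_form1D(2)[OF rD(2)] smooth_form1D(2)[OF sD(2) tD(1)] smooth_form1D(2)[OF
            sD'(2) tD(1)])
qed

text \<open>The derivatives of g along t cancel between a differentiated pairing and a bracket.
  Those along r come from another pairing and bracket and add up to twice the pairing of s and t,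
  which vanishes at x.\<close>

lemma courant_tensor_scaleR:
  assumes s: "smooth_section s" and t: "smooth_section t" and r: "smooth_section r" and g: "g \<in> CInf"
    and st: "pairing (s x) (t x) = 0" and sr: "pairing (s x) (r x) = 0"
  shows "courant_tensor (\<lambda>y. g y *\<^sub>R s y) t r x = g x * courant_tensor s t r x"
proof -
  note sD = smooth_sectionD[OF s] and tD = smooth_sectionD[OF t] and rD = smooth_sectionD[OF r]
  note rL = cotangent_spaceD[OF rD(4)] and tL = cotangent_spaceD[OF tD(4)]
  note rT = tangent_spaceD[OF rD(3)] and tT = tangent_spaceD[OF tD(3)]
  note brackets = lie_bracket_mem_tangent_space[OF tD(1) sD(1)] lie_bracket_mem_tangent_space[OF
      rD(1) sD(1)]
  have 1: "lie_bracket (\<lambda>y. g y *\<^sub>R fst (s y)) (\<lambda>y. fst (t y)) x =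
      - (g x *\<^sub>R lie_bracket (\<lambda>y. fst (t y)) (\<lambda>y. fst (s y)) x + fst (t x) g *\<^sub>R fst (s x))"
    using lie_bracket_scaleR[OF tD(1) sD(1) g, of x] by (simp add: lie_bracket_minus[of _ "\<lambda>y. fst
        (t y)"])
  have 2: "snd (r x) (lie_bracket (\<lambda>y. g y *\<^sub>R fst (s y)) (\<lambda>y. fst (t y)) x) =
      - (g x * snd (r x) (lie_bracket (\<lambda>y. fst (t y)) (\<lambda>y. fst (s y)) x) + fst (t x) g * snd (r x)
          (fst (s x)))"
    unfolding 1 using brackets sD
    by (subst cotangent_minus[OF rD(4)])
       (simp_all add: rL(1,2) subspace_add[OF subspace_tangent_space] subspace_scale[OF
           subspace_tangent_space])
  have 3: "snd (t x) (lie_bracket (\<lambda>y. fst (r y)) (\<lambda>y. g y *\<^sub>R fst (s y)) x) =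
      g x * snd (t x) (lie_bracket (\<lambda>y. fst (r y)) (\<lambda>y. fst (s y)) x) + fst (r x) g * snd (t x) (fst
          (s x))"
    using brackets sD by (simp add: lie_bracket_scaleR[OF rD(1) sD(1) g] tL subspace_scale[OF
        subspace_tangent_space])
  have 4: "fst (t x) (\<lambda>y. snd (r y) (g y *\<^sub>R fst (s y))) = g x * fst (t x) (\<lambda>y. snd (r y) (fst (s
      y))) + snd (r x) (fst (s x)) * fst (t x) g"
    using smooth_sectionD(3)[OF s] cotangent_spaceD(2)[OF smooth_sectionD(4)[OF r]]
    by (simp add: tT(3)[OF g smooth_form1D(2)[OF rD(2) sD(1)]])
  have 5: "fst (r x) (\<lambda>y. g y * snd (s y) (fst (t y))) = g x * fst (r x) (\<lambda>y. snd (s y) (fst (t y)))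
      + snd (s x) (fst (t x)) * fst (r x) g"
    using rT(3)[OF g smooth_form1D(2)[OF sD(2) tD(1)], of x] by simp
  have 6: "snd (r x) (lie_bracket (\<lambda>y. fst (s y)) (\<lambda>y. fst (t y)) x) = - snd (r x) (lie_bracket (\<lambda>y.
      fst (t y)) (\<lambda>y. fst (s y)) x)"
    using cotangent_minus[OF rD(4) brackets(1)] by (simp add: lie_bracket_minus[of "\<lambda>y. fst (s y)"])
  have 7: "snd (t x) (fst (s x)) = - snd (s x) (fst (t x))"
    using st by (simp add: pairing_def)
  show ?thesis
    by (simp add: courant_tensor_def 2 3 4 5 6 7 scaleR_fun_apply algebra_simps)
qed

end

section \<open>Bundle charts and adapted frames\<close>

lemma orthonormal_basis_prod:
  assumes "orthonormal_basis (B::'b::real_inner set)" "orthonormal_basis (C::'c::real_inner set)"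
  shows "orthonormal_basis ((\<lambda>b. (b, 0)) ` B \<union> Pair 0 ` C)"
  unfolding orthonormal_basis_def
proof (intro conjI allI)
  \<comment> \<open>Unit vectors are nonzero, so the two embedded bases are disjoint and the
    expansion splits into two sums.\<close>
  have nz: "b \<noteq> 0" if "b \<in> B" for b
  proof -
    have "inner b b = 1" using assms(1) that by (simp add: orthonormal_basis_def)
    then show ?thesis by auto
  qed
  have nz': "c \<noteq> 0" if "c \<in> C" for c
  proof -
    have "inner c c = 1" using assms(2) that by (simp add: orthonormal_basis_def)
    then show ?thesis by auto
  qed
  show "finite ((\<lambda>b. (b, 0)) ` B \<union> Pair 0 ` C)" using assms by (simp add: orthonormal_basis_def)
  show "\<forall>b\<in>(\<lambda>b. (b, 0)) ` B \<union> Pair 0 ` C. \<forall>c\<in>(\<lambda>b. (b, 0)) ` B \<union> Pair 0 ` C. inner b c = (if b = c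
      then 1 else 0)"
  proof -
    have "inner b b' = (if b = b' then 1 else 0)" if "b \<in> B" "b' \<in> B" for b b'
      using assms(1) that by (simp add: orthonormal_basis_def)
    moreover have "inner c c' = (if c = c' then 1 else 0)" if "c \<in> C" "c' \<in> C" for c c'
      using assms(2) that by (simp add: orthonormal_basis_def)
    moreover have "0 \<notin> B" "0 \<notin> C" using nz nz' by auto
    ultimately show ?thesis by (auto split: if_splits)
  qed
  fix x :: "'b \<times> 'c"
  have "(\<lambda>b. (b, 0::'c)) ` B \<inter> Pair (0::'b) ` C = {}" using nz by auto
  then have "(\<Sum>b\<in>(\<lambda>b. (b, 0)) ` B \<union> Pair 0 ` C. inner x b *\<^sub>R b) =
      (\<Sum>b\<in>(\<lambda>b. (b, 0)) ` B. inner x b *\<^sub>R b) + (\<Sum>b\<in>Pair 0 ` C. inner x b *\<^sub>R b)"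
    using assms by (intro sum.union_disjoint) (auto simp: orthonormal_basis_def)
  also have "(\<Sum>b\<in>(\<lambda>b. (b, 0)) ` B. inner x b *\<^sub>R b) = (\<Sum>b\<in>B. (inner (fst x) b *\<^sub>R b, 0))"
    by (subst sum.reindex) (auto simp: inj_on_def inner_prod_def)
  also have "(\<Sum>b\<in>Pair 0 ` C. inner x b *\<^sub>R b) = (\<Sum>b\<in>C. (0, inner (snd x) b *\<^sub>R b))"
    by (subst sum.reindex) (auto simp: inj_on_def inner_prod_def)
  also have "(\<Sum>b\<in>B. (inner (fst x) b *\<^sub>R b, 0)) = (fst x, 0::'c)"
    using assms(1) by (simp add: sum_prod orthonormal_basis_def)
  also have "(\<Sum>b\<in>C. (0, inner (snd x) b *\<^sub>R b)) = (0::'b, snd x)"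
    using assms(2) by (simp add: sum_prod orthonormal_basis_def)
  finally show "(\<Sum>b\<in>(\<lambda>b. (b, 0)) ` B \<union> Pair 0 ` C. inner x b *\<^sub>R b) = x" by simp
qed

lemma smooth_on_map_prod_id:
  fixes g :: "'b::real_inner \<Rightarrow> 'w::real_normed_vector"
  assumes B: "orthonormal_basis (B::'b set)" and S: "open S" and g: "smooth_on S g"
  shows "smooth_on (S \<times> (UNIV::'f::real_normed_vector set)) (map_prod g id)"
proof -
  have o: "open (S \<times> (UNIV::'f set))" using S by (intro open_Times) auto
  have fst: "smooth_on (S \<times> (UNIV::'f set)) fst"
    by (rule smooth_on_subset[OF smooth_on_bounded_linear_self[OF bounded_linear_fst]]) auto
  have gf: "smooth_on (S \<times> (UNIV::'f set)) (\<lambda>z. g (fst z))"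
    by (rule smooth_on_compose[OF B o S fst g]) auto
  have 1: "smooth_on (S \<times> (UNIV::'f set)) (\<lambda>z. (g (fst z), 0::'f))"
    by (rule smooth_on_bounded_linear[OF o _ gf]) (intro bounded_linear_Pair bounded_linear_ident
        bounded_linear_zero)
  have 2: "smooth_on (S \<times> (UNIV::'f set)) (\<lambda>z. (0::'w, snd z))"
    by (rule smooth_on_subset[OF smooth_on_bounded_linear_self])
       (auto intro: bounded_linear_Pair bounded_linear_zero bounded_linear_snd)
  have "(\<lambda>z. (g (fst z), 0::'f) + (0, snd z)) = map_prod g id" by (auto simp: fun_eq_iff)
  then show ?thesis using smooth_on_add[OF o 1 2] by simp
qed

lemma inv_into_map_prod_id:
  assumes "inj_on \<phi> V" "z \<in> \<phi> ` V \<times> UNIV"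
  shows "inv_into (V \<times> UNIV) (map_prod \<phi> id) z = map_prod (inv_into V \<phi>) id z"
proof -
  obtain x \<xi> where z: "x \<in> V" "z = map_prod \<phi> id (x, \<xi>)" using assms(2) by auto
  have "inj_on (map_prod \<phi> id) (V \<times> UNIV)" using assms(1) by (auto simp: inj_on_def)
  then have "inv_into (V \<times> UNIV) (map_prod \<phi> id) z = (x, \<xi>)"
    unfolding z(2) by (rule inv_into_f_f) (use z in auto)
  then show ?thesis using z assms(1) by (simp add: inv_into_f_f)
qed

text \<open>Only what the argument needs is asked of the charts, so that it applies equally to
  \<open>prod_model_atlas\<close>, in either role.\<close>

lemma smooth_map_on_imp_continuous_on:
  fixes A :: "('a::t2_space, 'v::real_normed_vector) chart set"
  assumes f: "smooth_map_on A B S f"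
    and A: "\<And>U \<phi>. (U, \<phi>) \<in> A \<Longrightarrow> continuous_on U \<phi> \<and> inj_on \<phi> U"
    and B: "\<And>V \<psi>. (V, \<psi>) \<in> B \<Longrightarrow> continuous_on (\<psi> ` V) (inv_into V \<psi>) \<and> inj_on \<psi> V"
  shows "continuous_on S f"
proof (rule continuous_at_imp_continuous_on, rule ballI)
  fix x assume "x \<in> S"
  then have "\<exists>(U, \<phi>)\<in>A. \<exists>(V, \<psi>)\<in>B. \<exists>W. open W \<and> x \<in> W \<and> W \<subseteq> U \<inter> S \<and> f ` W \<subseteq> V \<and>
      smooth_on (\<phi> ` W) (\<psi> \<circ> f \<circ> inv_into U \<phi>)"
    using f by (auto simp: smooth_map_on_def)
  then obtain U \<phi> V \<psi> W where W: "(U, \<phi>) \<in> A" "(V, \<psi>) \<in> B" "open W" "x \<in> W" "W \<subseteq> U \<inter> S" "f ` W \<subseteq> V"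
    "smooth_on (\<phi> ` W) (\<psi> \<circ> f \<circ> inv_into U \<phi>)"
    by (elim bexE case_prodE exE conjE) auto
  have c1: "continuous_on W \<phi>" using A[OF W(1)] W(5) continuous_on_subset by blast
  have c2: "continuous_on (\<phi> ` W) (\<psi> \<circ> f \<circ> inv_into U \<phi>)" by (rule smooth_on_imp_continuous_on[OF W(7)])
  have eq: "inv_into U \<phi> (\<phi> y) = y" if "y \<in> W" for y using A[OF W(1)] W(5) that by (auto simp:
      inv_into_f_f)
  have "continuous_on W ((\<psi> \<circ> f \<circ> inv_into U \<phi>) \<circ> \<phi>)" by (rule continuous_on_compose[OF c1 c2])
  moreover have "((\<psi> \<circ> f \<circ> inv_into U \<phi>) \<circ> \<phi>) ` W \<subseteq> \<psi> ` V" using eq W(6) by auto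
  ultimately have "continuous_on W (\<lambda>y. inv_into V \<psi> (((\<psi> \<circ> f \<circ> inv_into U \<phi>) \<circ> \<phi>) y))"
    using continuous_on_compose2 B[OF W(2)] by blast
  moreover have "inv_into V \<psi> (((\<psi> \<circ> f \<circ> inv_into U \<phi>) \<circ> \<phi>) y) = f y" if "y \<in> W" for y
    using eq that W(6) B[OF W(2)] by (auto simp: inv_into_f_f)
  ultimately have "continuous_on W f" by (simp cong: continuous_on_cong)
  then show "isCont f x" using W(3,4) by (simp add: continuous_on_eq_continuous_at)
qed

locale smooth_bundle =
  fixes A\<^sub>E :: "('e::{t2_space,second_countable_topology}, 'm::real_inner) chart set"
    and A\<^sub>P :: "('p::{t2_space,second_countable_topology}, 'b::real_inner) chart set"
    and p :: "'e \<Rightarrow> 'p"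
    and vadd :: "'e \<Rightarrow> 'e \<Rightarrow> 'e" and vscale :: "real \<Rightarrow> 'e \<Rightarrow> 'e"
    and Triv :: "('p set \<times> ('e \<Rightarrow> 'f::real_inner)) set"
  assumes vector_bundle: "smooth_vector_bundle A\<^sub>E A\<^sub>P p vadd vscale Triv"
begin

sublocale E: smooth_manifold A\<^sub>E
  by unfold_locales (use vector_bundle in \<open>simp add: smooth_vector_bundle_def\<close>)

sublocale P: smooth_manifold A\<^sub>P
  by unfold_locales (use vector_bundle in \<open>simp add: smooth_vector_bundle_def\<close>)

section \<open>The projection and charts adapted to it\<close>

lemma smooth_map_projection: "smooth_map_on A\<^sub>E A\<^sub>P UNIV p"
  using vector_bundle by (simp add: smooth_vector_bundle_def)

lemma continuous_projection: "continuous_on UNIV p"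
  by (rule smooth_map_on_imp_continuous_on[OF smooth_map_projection])
     (use E.chart_open[OF E.compatible_chart_atlas] P.chart_open[OF P.compatible_chart_atlas] in
       \<open>simp_all add: homeomorphism_def\<close>)

lemma open_vimage_projection: "open U \<Longrightarrow> open (p -` U)"
  using continuous_projection by (simp add: continuous_on_open_vimage)

lemma smooth_fun_projection:
  assumes "g \<in> P.CInf"
  shows "g \<circ> p \<in> E.CInf"
  unfolding E.smooth_funs_iff
proof (rule E.smooth_fun_onI_atlas)
  fix x :: 'e
  have "\<exists>(U, \<phi>)\<in>A\<^sub>E. \<exists>(V, \<psi>)\<in>A\<^sub>P. \<exists>W. open W \<and> x \<in> W \<and> W \<subseteq> U \<inter> UNIV \<and> p ` W \<subseteq> V \<and>
      smooth_on (\<phi> ` W) (\<psi> \<circ> p \<circ> inv_into U \<phi>)"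
    using smooth_map_projection by (simp add: smooth_map_on_def)
  then obtain U \<phi> V \<psi> W where W: "(U, \<phi>) \<in> A\<^sub>E" "(V, \<psi>) \<in> A\<^sub>P" "open W" "x \<in> W" "W \<subseteq> U" "p ` W \<subseteq> V"
    "smooth_on (\<phi> ` W) (\<psi> \<circ> p \<circ> inv_into U \<phi>)"
    by (elim bexE case_prodE exE conjE) auto
  obtain B :: "'b set" where B: "orthonormal_basis B"
    using ex_orthonormal_basis[OF P.finite_dimensional_model] by blast
  note cE = E.chart_open[OF E.compatible_chart_atlas[OF W(1)]]
    and cP = P.chart_open[OF P.compatible_chart_atlas[OF W(2)]]
  have o: "open (\<phi> ` W)" using cE(4)[OF W(3)] W(5) by (simp add: Int_absorb1)
  have g: "smooth_on (\<psi> ` V) (g \<circ> inv_into V \<psi>)"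
    using P.smooth_fun_on_chart[OF P.compatible_chart_atlas[OF W(2)], of UNIV g] assms by (simp add:
        P.smooth_funs_iff)
  have "smooth_on (\<phi> ` W) (\<lambda>z. (g \<circ> inv_into V \<psi>) ((\<psi> \<circ> p \<circ> inv_into U \<phi>) z))"
    by (rule smooth_on_compose[OF B o cP(2) W(7) g]) (use W(5,6) cE(6) in \<open>auto simp: subset_iff
        image_subset_iff\<close>)
  then have "smooth_on (\<phi> ` W) (g \<circ> p \<circ> inv_into U \<phi>)"
    by (rule smooth_on_cong[OF o, rotated]) (use W(5,6) cE(6) cP(6) in \<open>auto simp: subset_iff
        image_subset_iff\<close>)
  then show "\<exists>U \<phi> W. (U, \<phi>) \<in> A\<^sub>E \<and> open W \<and> x \<in> W \<and> W \<subseteq> U \<inter> UNIV \<and> smooth_on (\<phi> ` W) (g \<circ> p \<circ>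
      inv_into U \<phi>)"
    using W by blast
qed

text \<open>The trivialization and its inverse are known to be smooth only with respect to
  unspecified charts around each point. Both transition maps are therefore factored, locally,
  through those charts and the transition maps of the two atlases.\<close>

lemma bundle_chart:
  assumes triv: "local_trivialization A\<^sub>E A\<^sub>P p vadd vscale U (\<tau> :: 'e \<Rightarrow> 'f)" and chart: "(V, \<phi>) \<in> A\<^sub>P"
  shows "compatible_chart A\<^sub>E (p -` (U \<inter> V)) (\<lambda>e. (\<phi> (p e), \<tau> e))"
proof -
  define \<Psi> where "\<Psi> = (\<lambda>e. (p e, \<tau> e))"
  define \<Theta> where "\<Theta> = inv_into (p -` U) \<Psi>"
  define N where "N = p -` (U \<inter> V)"
  define \<psi> where "\<psi> = (\<lambda>e. (\<phi> (p e), \<tau> e))"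
  have tr: "open U" "bij_betw \<Psi> (p -` U) (U \<times> UNIV)"
    "smooth_map_on A\<^sub>E (prod_model_atlas A\<^sub>P) (p -` U) \<Psi>"
    "smooth_map_on (prod_model_atlas A\<^sub>P) A\<^sub>E (U \<times> UNIV) \<Theta>"
    using triv by (simp_all add: local_trivialization_def \<Psi>_def \<Theta>_def)
  note cP = P.chart_open[OF P.compatible_chart_atlas[OF chart]]
  obtain B :: "'b set" where B: "orthonormal_basis B"
    using ex_orthonormal_basis[OF P.finite_dimensional_model] by blast
  obtain B' :: "'m set" where B': "orthonormal_basis B'"
    using ex_orthonormal_basis[OF E.finite_dimensional_model] by blast
  obtain C :: "'f set" where C: "orthonormal_basis C"
    using ex_orthonormal_basis vector_bundle unfolding smooth_vector_bundle_def by blast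
  note BC = orthonormal_basis_prod[OF B C]
  have \<Theta>\<Psi>: "\<Theta> (\<Psi> e) = e" if "p e \<in> U" for e
    using tr(2) that by (simp add: \<Theta>_def bij_betw_def inv_into_f_f)
  have \<Psi>\<Theta>: "\<Psi> (\<Theta> z) = z" "p (\<Theta> z) = fst z" if "z \<in> U \<times> UNIV" for z
  proof -
    have "z \<in> \<Psi> ` (p -` U)" using tr(2) that by (simp add: bij_betw_def)
    then show "\<Psi> (\<Theta> z) = z" by (simp add: \<Theta>_def f_inv_into_f)
    then show "p (\<Theta> z) = fst z" by (metis \<Psi>_def fst_conv)
  qed
  have prod_charts: "continuous_on V' \<psi>' \<and> inj_on \<psi>' V'" "continuous_on (\<psi>' ` V') (inv_into V' \<psi>') \<and>
      inj_on \<psi>' V'"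
    if prod: "(V', \<psi>') \<in> prod_model_atlas A\<^sub>P" for V' and \<psi>' :: "'p \<times> 'f \<Rightarrow> 'b \<times> 'f"
  proof -
    obtain V0 \<phi>0 where V0: "(V0, \<phi>0) \<in> A\<^sub>P" "V' = V0 \<times> UNIV" "\<psi>' = map_prod \<phi>0 id"
      using prod by (auto simp: prod_model_atlas_def)
    note c0 = P.chart_open[OF P.compatible_chart_atlas[OF V0(1)]]
    have inj: "inj_on \<psi>' V'" using c0(7) by (auto simp: V0 inj_on_def)
    have "continuous_on V' (\<lambda>z. \<phi>0 (fst z))"
      by (rule continuous_on_compose2[OF c0(5)]) (auto simp: V0 intro: continuous_intros)
    then have "continuous_on V' (\<lambda>z. (\<phi>0 (fst z), snd z))" by (intro continuous_intros)
    moreover have "(\<lambda>z. (\<phi>0 (fst z), snd z)) = \<psi>'" by (auto simp: V0)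
    ultimately show "continuous_on V' \<psi>' \<and> inj_on \<psi>' V'" using inj by metis
    have im: "\<psi>' ` V' = \<phi>0 ` V0 \<times> UNIV" by (force simp: V0)
    have "continuous_on (\<phi>0 ` V0) (inv_into V0 \<phi>0)" using c0(3) by (simp add: homeomorphism_def)
    then have "continuous_on (\<psi>' ` V') (\<lambda>z. inv_into V0 \<phi>0 (fst z))"
      by (rule continuous_on_compose2) (auto simp: im intro: continuous_intros)
    then have "continuous_on (\<psi>' ` V') (\<lambda>z. (inv_into V0 \<phi>0 (fst z), snd z))" by (intro
        continuous_intros)
    then have "continuous_on (\<psi>' ` V') (inv_into V' \<psi>')"
    proof (rule continuous_on_eq)
      fix z assume "z \<in> \<psi>' ` V'"
      then show "(inv_into V0 \<phi>0 (fst z), snd z) = inv_into V' \<psi>' z"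
        using inv_into_map_prod_id[OF c0(7), of z] unfolding im unfolding V0 by (simp add:
            map_prod_def split_beta)
    qed
    then show "continuous_on (\<psi>' ` V') (inv_into V' \<psi>') \<and> inj_on \<psi>' V'" using inj by simp
  qed
  have E_charts: "continuous_on V' \<psi>' \<and> inj_on \<psi>' V'" "continuous_on (\<psi>' ` V') (inv_into V' \<psi>') \<and>
      inj_on \<psi>' V'"
    if "(V', \<psi>') \<in> A\<^sub>E" for V' \<psi>'
    using E.chart_open[OF E.compatible_chart_atlas[OF that]] by (simp_all add: homeomorphism_def)
  have cont\<Psi>: "continuous_on (p -` U) \<Psi>"
    by (rule smooth_map_on_imp_continuous_on[OF tr(3) E_charts(1) prod_charts(2)])
  have cont\<Theta>: "continuous_on (U \<times> UNIV) \<Theta>"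
    by (rule smooth_map_on_imp_continuous_on[OF tr(4) prod_charts(1) E_charts(2)])
  have openUV: "open (U \<inter> V)" using tr(1) cP(1) by blast
  have openN: "open N" unfolding N_def by (rule open_vimage_projection[OF openUV])
  have im: "\<psi> ` N = \<phi> ` (V \<inter> U) \<times> UNIV"
  proof
    show "\<psi> ` N \<subseteq> \<phi> ` (V \<inter> U) \<times> UNIV" by (auto simp: \<psi>_def N_def)
    show "\<phi> ` (V \<inter> U) \<times> UNIV \<subseteq> \<psi> ` N"
    proof clarify
      fix x \<xi> assume x: "x \<in> V" "x \<in> U"
      then have "\<Psi> (\<Theta> (x, \<xi>)) = (x, \<xi>)" "p (\<Theta> (x, \<xi>)) = x" using \<Psi>\<Theta>[of "(x, \<xi>)"] by auto
      then have "\<psi> (\<Theta> (x, \<xi>)) = (\<phi> x, \<xi>)" "\<Theta> (x, \<xi>) \<in> N" using x by (auto simp: \<psi>_def \<Psi>_def N_def)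
      then show "(\<phi> x, \<xi>) \<in> \<psi> ` N" by (metis imageI)
    qed
  qed
  have open_im: "open (\<psi> ` N)" unfolding im using cP(4)[OF tr(1)] by (intro open_Times) auto
  have inj: "inj_on \<psi> N"
  proof (rule inj_onI)
    fix e e' assume e: "e \<in> N" "e' \<in> N" "\<psi> e = \<psi> e'"
    then have "\<Psi> e = \<Psi> e'" using cP(7) by (auto simp: \<psi>_def \<Psi>_def N_def inj_on_def)
    moreover have "p e \<in> U" "p e' \<in> U" using e by (auto simp: N_def)
    ultimately show "e = e'" using \<Theta>\<Psi> by metis
  qed
  have inv: "inv_into N \<psi> z = \<Theta> (map_prod (inv_into V \<phi>) id z)" if z: "z \<in> \<psi> ` N" for z
  proof -
    obtain e where e: "e \<in> N" "z = \<psi> e" using z by auto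
    have "map_prod (inv_into V \<phi>) id z = \<Psi> e" using e cP(6) by (simp add: \<psi>_def \<Psi>_def N_def)
    then show ?thesis using e inj \<Theta>\<Psi>[of e] by (simp add: inv_into_f_f N_def)
  qed
  have hom: "homeomorphism N (\<psi> ` N) \<psi> (inv_into N \<psi>)"
    unfolding homeomorphism_def
  proof (intro conjI ballI)
    have "continuous_on N \<Psi>" using cont\<Psi> by (rule continuous_on_subset) (auto simp: N_def)
    then have "continuous_on N (\<lambda>e. snd (\<Psi> e))" by (intro continuous_intros)
    moreover have "continuous_on N (\<lambda>e. \<phi> (p e))"
      by (rule continuous_on_compose2[OF cP(5) continuous_on_subset[OF continuous_projection]])
          (auto simp: N_def)
    ultimately show "continuous_on N \<psi>" unfolding \<psi>_def \<Psi>_def by (auto intro!: continuous_intros)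
    have "continuous_on (\<phi> ` V) (inv_into V \<phi>)" using cP(3) by (simp add: homeomorphism_def)
    then have "continuous_on (\<psi> ` N) (\<lambda>z. inv_into V \<phi> (fst z))"
      by (rule continuous_on_compose2) (auto simp: im intro: continuous_intros)
    then have "continuous_on (\<psi> ` N) (\<lambda>z. (inv_into V \<phi> (fst z), snd z))" by (intro continuous_intros)
    then have "continuous_on (\<psi> ` N) (\<lambda>z. \<Theta> (inv_into V \<phi> (fst z), snd z))"
      by (rule continuous_on_compose2[OF cont\<Theta>]) (use cP(6) in \<open>auto simp: im\<close>)
    then show "continuous_on (\<psi> ` N) (inv_into N \<psi>)"
      by (rule continuous_on_eq) (auto simp: inv map_prod_def split_beta)
    show "inv_into N \<psi> ` \<psi> ` N = N" using inj by (force simp: inv_into_f_f)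
  qed (use inj in \<open>auto simp: inv_into_f_f f_inv_into_f\<close>)
  have open_sub: "open (\<psi> ` M)" if "open M" "M \<subseteq> N" for M
    using homeomorphism_open_image[OF hom openN open_im that] .
  have "smooth_on (\<psi> ` (N \<inter> K)) (\<theta> \<circ> inv_into N \<psi>) \<and> smooth_on (\<theta> ` (N \<inter> K)) (\<psi> \<circ> inv_into K \<theta>)"
    if K: "(K, \<theta>) \<in> A\<^sub>E" for K \<theta>
  proof
    note cK = E.chart_open[OF E.compatible_chart_atlas[OF K]]
    show "smooth_on (\<theta> ` (N \<inter> K)) (\<psi> \<circ> inv_into K \<theta>)"
    proof (rule smooth_on_local)
      fix z assume "z \<in> \<theta> ` (N \<inter> K)"
      then obtain e where e: "e \<in> N" "e \<in> K" "z = \<theta> e" by auto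
      then have "e \<in> p -` U" by (simp add: N_def)
      then have "\<exists>(K', \<theta>')\<in>A\<^sub>E. \<exists>(V', \<phi>')\<in>prod_model_atlas A\<^sub>P. \<exists>W. open W \<and> e \<in> W \<and> W \<subseteq> K' \<inter> p -` U \<and>
          \<Psi> ` W \<subseteq> V' \<and>
          smooth_on (\<theta>' ` W) (\<phi>' \<circ> \<Psi> \<circ> inv_into K' \<theta>')"
        using tr(3) by (simp add: smooth_map_on_def)
      then obtain K' \<theta>' V' \<phi>' W where W: "(K', \<theta>') \<in> A\<^sub>E" "(V', \<phi>') \<in> A\<^sub>P" "open W" "e \<in> W" "W \<subseteq> K'"
        "\<Psi> ` W \<subseteq> V' \<times> UNIV" "smooth_on (\<theta>' ` W) (map_prod \<phi>' id \<circ> \<Psi> \<circ> inv_into K' \<theta>')"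
        by (elim bexE case_prodE exE conjE) (auto simp: prod_model_atlas_def)
      note cK' = E.chart_open[OF E.compatible_chart_atlas[OF W(1)]]
        and cV' = P.chart_open[OF P.compatible_chart_atlas[OF W(2)]]
      have WK': "e' \<in> K'" "p e' \<in> V'" if "e' \<in> W" for e'
        using W(5,6) that by (auto simp: \<Psi>_def)
      \<comment> \<open>On \<open>M\<close> the transition factors as \<theta> to \<theta>', then
        the trivialization in coordinates, then \<phi>' to \<phi> times the identity of the
        fibre.\<close>
      define M where "M = W \<inter> N \<inter> K"
      have oM: "open M" using W(3) openN cK(1) by (auto simp: M_def)
      have o1: "open (\<theta> ` M)" using cK(4)[OF oM] by (simp add: M_def Int_absorb1)
      have o2: "open (\<theta>' ` W)" using cK'(4)[OF W(3)] W(5) by (simp add: Int_absorb1)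
      have t: "smooth_on (\<theta> ` M) (\<theta>' \<circ> inv_into K \<theta>)"
        by (rule smooth_on_subset[of "\<theta> ` (K \<inter> K')"])
           (use E.compatible_chart_atlas[OF K] W(1,5) in \<open>auto simp: compatible_chart_def M_def\<close>)
      have s1: "smooth_on (\<theta> ` M) (\<lambda>z. (map_prod \<phi>' id \<circ> \<Psi> \<circ> inv_into K' \<theta>') ((\<theta>' \<circ> inv_into K \<theta>) z))"
        by (rule smooth_on_compose[OF B' o1 o2 t W(7)]) (use cK(6) in \<open>auto simp: M_def\<close>)
      have o3: "open (\<phi>' ` (V' \<inter> V))" using cV'(4)[OF cP(1)] .
      have "smooth_on (\<phi>' ` (V' \<inter> V)) (\<phi> \<circ> inv_into V' \<phi>')"
        using P.compatible_chart_atlas[OF W(2)] chart by (auto simp: compatible_chart_def)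
      from smooth_on_map_prod_id[OF B o3 this]
      have s2: "smooth_on (\<phi>' ` (V' \<inter> V) \<times> (UNIV :: 'f set)) (map_prod (\<phi> \<circ> inv_into V' \<phi>') id)" .
      have o4: "open (\<phi>' ` (V' \<inter> V) \<times> (UNIV :: 'f set))" using o3 by (intro open_Times) auto
      have "smooth_on (\<theta> ` M) (\<lambda>z. map_prod (\<phi> \<circ> inv_into V' \<phi>') id
          ((map_prod \<phi>' id \<circ> \<Psi> \<circ> inv_into K' \<theta>') ((\<theta>' \<circ> inv_into K \<theta>) z)))"
        by (rule smooth_on_compose[OF BC o1 o4 s1 s2])
           (use cK(6) cK'(6) WK' in \<open>auto simp: M_def N_def \<Psi>_def\<close>)
      then have "smooth_on (\<theta> ` M) (\<psi> \<circ> inv_into K \<theta>)"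
        by (rule smooth_on_cong[OF o1, rotated])
           (use cK(6) cK'(6) cV'(6) WK' in \<open>auto simp: M_def N_def \<Psi>_def \<psi>_def\<close>)
      moreover have "z \<in> \<theta> ` M" using e W(4) by (auto simp: M_def)
      ultimately show "\<exists>W. open W \<and> z \<in> W \<and> smooth_on W (\<psi> \<circ> inv_into K \<theta>)" using o1 by blast
    qed
    show "smooth_on (\<psi> ` (N \<inter> K)) (\<theta> \<circ> inv_into N \<psi>)"
    proof (rule smooth_on_local)
      fix z assume "z \<in> \<psi> ` (N \<inter> K)"
      then obtain e where e: "e \<in> N" "e \<in> K" "z = \<psi> e" by auto
      then have "\<Psi> e \<in> U \<times> UNIV" by (simp add: N_def \<Psi>_def)
      then have "\<exists>(V', \<phi>')\<in>prod_model_atlas A\<^sub>P. \<exists>(K', \<theta>')\<in>A\<^sub>E. \<exists>W. open W \<and> \<Psi> e \<in> W \<and> W \<subseteq> V' \<inter> U \<times>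
          UNIV \<and> \<Theta> ` W \<subseteq> K' \<and>
          smooth_on (\<phi>' ` W) (\<theta>' \<circ> \<Theta> \<circ> inv_into V' \<phi>')"
        by (rule bspec[OF tr(4)[unfolded smooth_map_on_def]])
      then obtain K' \<theta>' V' \<phi>' W where W: "(K', \<theta>') \<in> A\<^sub>E" "(V', \<phi>') \<in> A\<^sub>P" "open W" "\<Psi> e \<in> W" "W \<subseteq> V'
          \<times> UNIV" "W \<subseteq> U \<times> UNIV"
        "\<Theta> ` W \<subseteq> K'" "smooth_on (map_prod \<phi>' id ` W) (\<theta>' \<circ> \<Theta> \<circ> inv_into (V' \<times> UNIV) (map_prod \<phi>' id))"
        by (elim bexE case_prodE exE conjE) (auto simp: prod_model_atlas_def)
      note cK' = E.chart_open[OF E.compatible_chart_atlas[OF W(1)]]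
        and cV' = P.chart_open[OF P.compatible_chart_atlas[OF W(2)]]
      \<comment> \<open>The reverse chain: \<phi> to \<phi>' times the identity of the fibre, then
        the inverse trivialization in coordinates, then \<theta>' to \<theta>.\<close>
      define M where "M = (p -` U \<inter> \<Psi> -` W) \<inter> N \<inter> K"
      have "open (\<Psi> -` W \<inter> p -` U)"
        using cont\<Psi> W(3) open_vimage_projection[OF tr(1)] by (simp add: continuous_on_open_vimage)
      then have oM: "open M" using openN cK(1) by (auto simp: M_def Int_commute)
      have o1: "open (\<psi> ` M)" using open_sub[OF oM] by (auto simp: M_def)
      have o2: "open (map_prod \<phi>' id ` W)"
      proof (rule homeomorphism_open_image[OF _ _ _ W(3,5)])
        have imV': "map_prod \<phi>' id ` (V' \<times> UNIV) = \<phi>' ` V' \<times> (UNIV :: 'f set)" by force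
        have "(V' \<times> UNIV, map_prod \<phi>' id) \<in> (prod_model_atlas A\<^sub>P :: ('p \<times> 'f, 'b \<times> 'f) chart set)"
          using W(2) by (force simp: prod_model_atlas_def)
        note pc = prod_charts[OF this]
        show "homeomorphism (V' \<times> (UNIV :: 'f set)) (\<phi>' ` V' \<times> UNIV) (map_prod \<phi>' id) (inv_into (V'
            \<times> UNIV) (map_prod \<phi>' id))"
          unfolding homeomorphism_def imV'[symmetric] using pc
          by (force simp: inv_into_f_f f_inv_into_f)
        show "open (V' \<times> (UNIV :: 'f set))" "open (\<phi>' ` V' \<times> (UNIV :: 'f set))"
          using cV'(1,2) by (auto intro!: open_Times)
      qed
      have MV: "p e \<in> V'" if "e \<in> M" for e using that W(5) by (auto simp: M_def \<Psi>_def)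
      have o3: "open (\<phi> ` (V \<inter> V'))" using cP(4)[OF cV'(1)] .
      have "smooth_on (\<phi> ` (V \<inter> V')) (\<phi>' \<circ> inv_into V \<phi>)"
        using P.compatible_chart_atlas[OF chart] W(2) by (auto simp: compatible_chart_def)
      from smooth_on_map_prod_id[OF B o3 this]
      have s1: "smooth_on (\<psi> ` M) (map_prod (\<phi>' \<circ> inv_into V \<phi>) (id :: 'f \<Rightarrow> 'f))"
        by (rule smooth_on_subset) (use MV in \<open>auto simp: M_def N_def \<psi>_def\<close>)
      have \<psi>M: "map_prod (\<phi>' \<circ> inv_into V \<phi>) id (\<psi> e) = map_prod \<phi>' id (\<Psi> e)" if "e \<in> M" for e
        using that cP(6) by (simp add: M_def N_def \<psi>_def \<Psi>_def)
      have s2: "smooth_on (\<psi> ` M) (\<lambda>z. (\<theta>' \<circ> \<Theta> \<circ> inv_into (V' \<times> UNIV) (map_prod \<phi>' id)) (map_prod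
          (\<phi>' \<circ> inv_into V \<phi>) id z))"
      proof (rule smooth_on_compose[OF BC o1 o2 s1 W(8)], rule image_subsetI)
        fix z assume "z \<in> \<psi> ` M"
        then obtain e where "e \<in> M" "z = \<psi> e" by auto
        then show "map_prod (\<phi>' \<circ> inv_into V \<phi>) id z \<in> map_prod \<phi>' id ` W"
          using \<psi>M unfolding M_def by (metis IntD1 IntD2 imageI vimageD)
      qed
      have eq: "(\<theta>' \<circ> \<Theta> \<circ> inv_into (V' \<times> UNIV) (map_prod \<phi>' id)) (map_prod (\<phi>' \<circ> inv_into V \<phi>) id (\<psi>
          e)) = \<theta>' e" if "e \<in> M" for e
      proof -
        have "inv_into (V' \<times> UNIV) (map_prod \<phi>' id) (map_prod \<phi>' id (\<Psi> e)) = map_prod (inv_into V'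
            \<phi>') id (map_prod \<phi>' id (\<Psi> e))"
          by (rule inv_into_map_prod_id[OF cV'(7)]) (use MV[OF that] in \<open>simp add: \<Psi>_def\<close>)
        also have "\<dots> = \<Psi> e" using MV[OF that] cV'(6) by (simp add: \<Psi>_def)
        finally show ?thesis using \<psi>M[OF that] \<Theta>\<Psi>[of e] that by (simp add: M_def N_def)
      qed
      have MK': "M \<subseteq> K'"
      proof
        fix e assume e: "e \<in> M"
        then have "\<Theta> (\<Psi> e) \<in> K'" using W(7) by (auto simp: M_def)
        then show "e \<in> K'" using \<Theta>\<Psi>[of e] e by (simp add: M_def N_def)
      qed
      have o5: "open (\<theta>' ` (K' \<inter> K))" using cK'(4)[OF cK(1)] .
      have t: "smooth_on (\<theta>' ` (K' \<inter> K)) (\<theta> \<circ> inv_into K' \<theta>')"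
        using E.compatible_chart_atlas[OF W(1)] K by (auto simp: compatible_chart_def)
      have "smooth_on (\<psi> ` M) (\<lambda>z. (\<theta> \<circ> inv_into K' \<theta>')
          ((\<theta>' \<circ> \<Theta> \<circ> inv_into (V' \<times> UNIV) (map_prod \<phi>' id)) (map_prod (\<phi>' \<circ> inv_into V \<phi>) id z)))"
      proof (rule smooth_on_compose[OF B' o1 o5 s2 t], rule image_subsetI)
        fix z assume "z \<in> \<psi> ` M"
        then obtain e where "e \<in> M" "z = \<psi> e" by auto
        then show "(\<theta>' \<circ> \<Theta> \<circ> inv_into (V' \<times> UNIV) (map_prod \<phi>' id)) (map_prod (\<phi>' \<circ> inv_into V \<phi>) id
            z) \<in> \<theta>' ` (K' \<inter> K)"
          using eq MK' by (auto simp: M_def)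
      qed
      then have "smooth_on (\<psi> ` M) (\<theta> \<circ> inv_into N \<psi>)"
      proof (rule smooth_on_cong[OF o1, rotated])
        fix z assume "z \<in> \<psi> ` M"
        then obtain e where e: "e \<in> M" "z = \<psi> e" by auto
        then show "(\<theta> \<circ> inv_into K' \<theta>') ((\<theta>' \<circ> \<Theta> \<circ> inv_into (V' \<times> UNIV) (map_prod \<phi>' id)) (map_prod
            (\<phi>' \<circ> inv_into V \<phi>) id z)) = (\<theta> \<circ> inv_into N \<psi>) z"
          using eq[OF e(1)] MK' cK'(6) inj by (auto simp: M_def inv_into_f_f)
      qed
      moreover have "z \<in> \<psi> ` M" using e W(4) by (auto simp: M_def N_def)
      ultimately show "\<exists>W. open W \<and> z \<in> W \<and> smooth_on W (\<theta> \<circ> inv_into N \<psi>)" using o1 by blast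
    qed
  qed
  then show ?thesis
    using openN open_im hom unfolding compatible_chart_def N_def \<psi>_def by blast
qed

section \<open>Pushforward and adapted frames\<close>

abbreviation "push \<equiv> pushforward A\<^sub>P p"

lemma push_apply: "g \<in> P.CInf \<Longrightarrow> push v g = v (g \<circ> p)"
  by (simp add: pushforward_def)

lemma push_mem:
  assumes v: "v \<in> tangent_space A\<^sub>E e"
  shows "push v \<in> tangent_space A\<^sub>P (p e)"
proof (rule P.tangent_spaceI)
  note vD = E.tangent_spaceD[OF v]
  show "push v (\<lambda>y. f y + g y) = push v f + push v g" if "f \<in> P.CInf" "g \<in> P.CInf" for f g
    using vD(1)[OF smooth_fun_projection[OF that(1)] smooth_fun_projection[OF that(2)]] that
    by (simp add: push_apply P.smooth_funs_add o_def)
  show "push v (\<lambda>y. c * f y) = c * push v f" if "f \<in> P.CInf" for c f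
    using vD(2)[OF smooth_fun_projection[OF that]] that P.smooth_funs_mult[OF P.smooth_funs_const that]
    by (simp add: push_apply o_def)
  show "push v (\<lambda>y. f y * g y) = f (p e) * push v g + g (p e) * push v f" if "f \<in> P.CInf" "g \<in>
      P.CInf" for f g
    using vD(3)[OF smooth_fun_projection[OF that(1)] smooth_fun_projection[OF that(2)]] that
    by (simp add: push_apply P.smooth_funs_mult o_def)
qed (simp add: pushforward_def)

lemma push_add: "push (v + w) = push v + push w"
  by (auto simp: pushforward_def fun_eq_iff)

lemma push_scaleR: "push (c *\<^sub>R v) = c *\<^sub>R push v"
  by (auto simp: pushforward_def fun_eq_iff scaleR_fun_apply)

lemma push_zero [simp]: "push 0 = 0"
  by (auto simp: pushforward_def fun_eq_iff)

lemma push_diff: "push (v - w) = push v - push w"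
  by (auto simp: pushforward_def fun_eq_iff)

lemma push_sum: "push (\<Sum>i\<in>I. c i *\<^sub>R v i) = (\<Sum>i\<in>I. c i *\<^sub>R push (v i))"
  by (induction I rule: infinite_finite_induct)
     (simp_all only: sum.infinite sum.empty sum.insert push_add push_scaleR push_zero not_False_eq_True)

text \<open>The coordinate fields of a bundle chart. Base directions project onto the coordinate
  fields of the base chart, fibre directions project to 0. The base coefficients are expressed
  through \<open>push\<close> so that they match expansions on P.\<close>

lemma ex_adapted_frame:
  obtains B :: "'b set" and C :: "'f set" and XH XV \<zeta> Y \<eta> W W' where
    "finite C" "open W" "e \<in> W" "P.local_frame B Y \<eta> W'" "\<And>y. y \<in> W \<Longrightarrow> p y \<in> W'"
    "\<And>b. smooth_vfield A\<^sub>E (XH b)" "\<And>c. smooth_vfield A\<^sub>E (XV c)" "\<And>c. \<zeta> c \<in> E.CInf"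
    "\<And>y b. y \<in> W \<Longrightarrow> push (XH b y) = Y b (p y)" "\<And>y c. y \<in> W \<Longrightarrow> push (XV c y) = 0"
    "\<And>y c c'. y \<in> W \<Longrightarrow> c \<in> C \<Longrightarrow> c' \<in> C \<Longrightarrow> XV c y (\<zeta> c') = (if c = c' then 1 else 0)"
    "\<And>y v. y \<in> W \<Longrightarrow> v \<in> tangent_space A\<^sub>E y \<Longrightarrow>
      v = (\<Sum>b\<in>B. push v (\<eta> b) *\<^sub>R XH b y) + (\<Sum>c\<in>C. v (\<zeta> c) *\<^sub>R XV c y)"
proof -
  obtain B :: "'b set" where B: "orthonormal_basis B"
    using ex_orthonormal_basis[OF P.finite_dimensional_model] by blast
  obtain C :: "'f set" where C: "orthonormal_basis C"
    using ex_orthonormal_basis vector_bundle unfolding smooth_vector_bundle_def by blast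
  have "p e \<in> (\<Union>(U, \<tau>)\<in>Triv. U)" using vector_bundle by (simp add: smooth_vector_bundle_def)
  then obtain U and \<tau> :: "'e \<Rightarrow> 'f" where U: "(U, \<tau>) \<in> Triv" "p e \<in> U" by auto
  have triv: "local_trivialization A\<^sub>E A\<^sub>P p vadd vscale U \<tau>"
    using vector_bundle U(1) by (auto simp: smooth_vector_bundle_def)
  obtain V \<phi> where V: "(V, \<phi>) \<in> A\<^sub>P" "p e \<in> V" by (rule P.atlas_cover)
  define N where "N = p -` (U \<inter> V)"
  define \<psi> where "\<psi> = (\<lambda>e. (\<phi> (p e), \<tau> e))"
  have compat: "compatible_chart A\<^sub>E N \<psi>"
    unfolding N_def \<psi>_def by (rule bundle_chart[OF triv V(1)])
  note cE = E.chart_open[OF compat] and cP = P.chart_open[OF P.compatible_chart_atlas[OF V(1)]]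
  have eN: "e \<in> N" using U V by (simp add: N_def)
  let ?BC = "(\<lambda>b. (b, 0)) ` B \<union> Pair 0 ` C"
  have nz: "0 \<notin> B"
  proof
    assume "0 \<in> B"
    then have "inner (0::'b) 0 = 1" using B unfolding orthonormal_basis_def by metis
    then show False by simp
  qed
  show ?thesis
  proof (rule E.ex_local_frame[OF orthonormal_basis_prod[OF B C] compat eN],
      rule P.ex_local_frame[OF B P.compatible_chart_atlas[OF V(1)] V(2)])
    fix X \<xi> W Y \<eta> W'
    assume X: "E.local_frame ?BC X \<xi> W" "e \<in> W" "W \<subseteq> N"
      and XD: "\<And>y h f. y \<in> W \<Longrightarrow> f \<in> E.CInf \<Longrightarrow> X h y f = frechet_derivative (f \<circ> inv_into N \<psi>) (at (\<psi> y)) h"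
      and \<xi>: "\<And>y b. y \<in> W \<Longrightarrow> \<xi> b y = inner (\<psi> y - \<psi> e) b"
      and Y: "P.local_frame B Y \<eta> W'" "p e \<in> W'" "W' \<subseteq> V"
      and YD: "\<And>y h f. y \<in> W' \<Longrightarrow> f \<in> P.CInf \<Longrightarrow> Y h y f = frechet_derivative (f \<circ> inv_into V \<phi>) (at (\<phi>
          y)) h"
      and \<eta>: "\<And>y b. y \<in> W' \<Longrightarrow> \<eta> b y = inner (\<phi> y - \<phi> (p e)) b"
    note XF = E.local_frameD[OF X(1)] and YF = P.local_frameD[OF Y(1)]
    \<comment> \<open>In bundle coordinates p is the first projection, so a function pulled back
      from P is insensitive to the fibre component of a direction.\<close>
    have deriv: "((g \<circ> p \<circ> inv_into N \<psi>) has_derivative (\<lambda>h. frechet_derivative (g \<circ> inv_into V \<phi>)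
        (at (\<phi> (p y))) (fst h))) (at (\<psi> y))"
      if g: "g \<in> P.CInf" and y: "y \<in> N" for g y
    proof -
      have "smooth_on (\<phi> ` V) (g \<circ> inv_into V \<phi>)"
        using P.smooth_fun_on_chart[OF P.compatible_chart_atlas[OF V(1)], of UNIV g] g by (simp add:
            P.smooth_funs_iff)
      from smooth_on_has_derivative[OF this, of "\<phi> (p y)"]
      have D: "((g \<circ> inv_into V \<phi>) has_derivative frechet_derivative (g \<circ> inv_into V \<phi>) (at (\<phi> (p
          y)))) (at (fst (\<psi> y)))"
        using y by (simp add: \<psi>_def N_def)
      have fst: "(fst has_derivative fst) (at (\<psi> y))" by (auto intro!: derivative_eq_intros)
      have "((\<lambda>z. (g \<circ> inv_into V \<phi>) (fst z)) has_derivative (\<lambda>h. frechet_derivative (g \<circ> inv_into V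
          \<phi>) (at (\<phi> (p y))) (fst h))) (at (\<psi> y))"
        by (rule has_derivative_compose[OF fst D])
      then show ?thesis
      proof (rule has_derivative_transform_within_open[OF _ cE(2)])
        show "\<psi> y \<in> \<psi> ` N" using y by simp
        fix z assume "z \<in> \<psi> ` N"
        then obtain e' where "e' \<in> N" "z = \<psi> e'" by auto
        then show "(g \<circ> inv_into V \<phi>) (fst z) = (g \<circ> p \<circ> inv_into N \<psi>) z"
          using cE(6) cP(6) by (simp add: \<psi>_def N_def)
      qed
    qed
    have pushX: "push (X h y) g = frechet_derivative (g \<circ> inv_into V \<phi>) (at (\<phi> (p y))) (fst h)"
      if "g \<in> P.CInf" "y \<in> W" for h y g
    proof -
      have yN: "y \<in> N" using that X by blast
      show ?thesis
        using that XD[OF that(2) smooth_fun_projection[OF that(1)]]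
          fun_cong[OF frechet_derivative_at[OF deriv[OF that(1) yN]], of h]
        by (simp add: push_apply o_assoc)
    qed
    have lin: "linear (frechet_derivative (g \<circ> inv_into V \<phi>) (at (\<phi> (p y))))" if "g \<in> P.CInf" "y \<in>
        N" for g y
    proof -
      have "smooth_on (\<phi> ` V) (g \<circ> inv_into V \<phi>)"
        using P.smooth_fun_on_chart[OF P.compatible_chart_atlas[OF V(1)], of UNIV g] that by (simp
            add: P.smooth_funs_iff)
      from smooth_on_has_derivative[OF this, of "\<phi> (p y)"] that(2) show ?thesis
        using has_derivative_linear by (auto simp: N_def)
    qed
    show ?thesis
    proof (rule that[of C "W \<inter> p -` W'" B Y \<eta> W' "\<lambda>b. X (b, 0)" "\<lambda>c. X (0, c)" "\<lambda>c. \<xi> (0, c)"])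
      show "finite C" using C by (simp add: orthonormal_basis_def)
      show "open (W \<inter> p -` W')" using XF(2) open_vimage_projection[OF YF(2)] by blast
      show "e \<in> W \<inter> p -` W'" using X Y by simp
      show "P.local_frame B Y \<eta> W'" by (rule Y(1))
      show "push (X (b, 0) y) = Y b (p y)" if "y \<in> W \<inter> p -` W'" for y b
      proof
        fix g
        show "push (X (b, 0) y) g = Y b (p y) g"
          using that pushX[of g y "(b, 0)"] YD[of "p y" g b] P.tangent_spaceD(4)[OF
              P.smooth_vfieldD(1)[OF YF(3)]]
          by (cases "g \<in> P.CInf") (auto simp: pushforward_def)
      qed
      show "push (X (0, c) y) = 0" if "y \<in> W \<inter> p -` W'" for y c
      proof
        fix g
        show "push (X (0, c) y) g = 0 g"
          using that pushX[of g y "(0, c)"] linear_0[OF lin[of g y]] X(3)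
          by (cases "g \<in> P.CInf") (auto simp: pushforward_def)
      qed
      show "X (0, c) y (\<xi> (0, c')) = (if c = c' then 1 else 0)" if "y \<in> W \<inter> p -` W'" "c \<in> C" "c' \<in>
          C" for y c c'
        using XF(5)[of y "(0, c)" "(0, c')"] that by auto
      show "v = (\<Sum>b\<in>B. push v (\<eta> b) *\<^sub>R X (b, 0) y) + (\<Sum>c\<in>C. v (\<xi> (0, c)) *\<^sub>R X (0, c) y)"
        if y: "y \<in> W \<inter> p -` W'" and v: "v \<in> tangent_space A\<^sub>E y" for y v
      proof -
        \<comment> \<open>The cut-off base coordinate and the cut-off bundle coordinate agree only
          near y, which is enough for a derivation at y.\<close>
        have \<eta>p: "push v (\<eta> b) = v (\<xi> (b, 0))" for b
          unfolding push_apply[OF YF(4)]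
        proof (rule E.tangent_local[OF v smooth_fun_projection[OF YF(4)] XF(4)])
          have "open (W \<inter> p -` W')" using XF(2) open_vimage_projection[OF YF(2)] by blast
          from eventually_nhds_in_open[OF this y]
          show "\<forall>\<^sub>F z in nhds y. (\<eta> b \<circ> p) z = \<xi> (b, 0) z"
            by eventually_elim (simp add: \<eta> \<xi> \<psi>_def)
        qed
        have "(\<lambda>b. (b, 0::'f)) ` B \<inter> Pair (0::'b) ` C = {}" using nz by auto
        then have split: "(\<Sum>i\<in>?BC. v (\<xi> i) *\<^sub>R X i y) =
            (\<Sum>i\<in>(\<lambda>b. (b, 0)) ` B. v (\<xi> i) *\<^sub>R X i y) + (\<Sum>i\<in>Pair 0 ` C. v (\<xi> i) *\<^sub>R X i y)"
          using B C by (intro sum.union_disjoint) (auto simp: orthonormal_basis_def)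
        have "v = (\<Sum>i\<in>?BC. v (\<xi> i) *\<^sub>R X i y)" by (rule XF(6)[OF IntD1[OF y] v])
        also note split
        also have "(\<Sum>i\<in>(\<lambda>b. (b, 0)) ` B. v (\<xi> i) *\<^sub>R X i y) = (\<Sum>b\<in>B. push v (\<eta> b) *\<^sub>R X (b, 0) y)"
          by (subst sum.reindex) (auto simp: inj_on_def \<eta>p)
        also have "(\<Sum>i\<in>Pair 0 ` C. v (\<xi> i) *\<^sub>R X i y) = (\<Sum>c\<in>C. v (\<xi> (0, c)) *\<^sub>R X (0, c) y)"
          by (subst sum.reindex) (auto simp: inj_on_def)
        finally show ?thesis .
      qed
    qed (use XF in auto)
  qed
qed

end

section \<open>The induced Lagrangian subbundle\<close>

lemma alternating_bilinear_onD:
  assumes "alternating_bilinear_on S \<beta>" "subspace S"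
  shows "x \<in> S \<Longrightarrow> linear_on S (\<beta> x)" "y \<in> S \<Longrightarrow> linear_on S (\<lambda>x. \<beta> x y)" "x \<in> S \<Longrightarrow> \<beta> x x = 0"
    "x \<in> S \<Longrightarrow> y \<in> S \<Longrightarrow> \<beta> x y = - \<beta> y x"
proof -
  show 1: "x \<in> S \<Longrightarrow> linear_on S (\<beta> x)" "y \<in> S \<Longrightarrow> linear_on S (\<lambda>x. \<beta> x y)" "x \<in> S \<Longrightarrow> \<beta> x x = 0" for x y
    using assms(1) by (auto simp: alternating_bilinear_on_def)
  assume xy: "x \<in> S" "y \<in> S"
  then have s: "x + y \<in> S" using assms(2) by (simp add: subspace_add)
  have "\<beta> (x + y) (x + y) = \<beta> x (x + y) + \<beta> y (x + y)" using linear_onD(1)[OF 1(2)[OF s] xy] .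
  also have "\<dots> = \<beta> x y + \<beta> y x"
    using linear_onD(1)[OF 1(1)[OF xy(1)] xy] linear_onD(1)[OF 1(1)[OF xy(2)] xy] 1(3) xy by simp
  finally show "\<beta> x y = - \<beta> y x" using 1(3)[OF s] by simp
qed

locale geometric_bundle = smooth_bundle A\<^sub>E A\<^sub>P p vadd vscale Triv
  for A\<^sub>E :: "('e::{t2_space,second_countable_topology}, 'm::real_inner) chart set"
    and A\<^sub>P :: "('p::{t2_space,second_countable_topology}, 'b::real_inner) chart set"
    and p :: "'e \<Rightarrow> 'p"
    and vadd :: "'e \<Rightarrow> 'e \<Rightarrow> 'e" and vscale :: "real \<Rightarrow> 'e \<Rightarrow> 'e"
    and Triv :: "('p set \<times> ('e \<Rightarrow> 'f::real_inner)) set" +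
  fixes \<gamma> :: "'e \<Rightarrow> 'e tvec \<Rightarrow> 'e tvec"
    and PiV :: "'e \<Rightarrow> 'e covec \<Rightarrow> 'e covec \<Rightarrow> real"
    and F :: "'e \<Rightarrow> 'p tvec \<Rightarrow> 'p tvec \<Rightarrow> real"
  assumes geometric: "geometric_data A\<^sub>E A\<^sub>P p \<gamma> PiV F"
begin

abbreviation "T \<equiv> tangent_space A\<^sub>E"
abbreviation "T' \<equiv> cotangent_space A\<^sub>E"
abbreviation "lift \<equiv> horizontal_lift_at A\<^sub>E A\<^sub>P p \<gamma>"
abbreviation "hr \<equiv> hor A\<^sub>E A\<^sub>P p \<gamma>"
abbreviation "sh \<equiv> sharp A\<^sub>E PiV"
abbreviation "con \<equiv> horizontal_contraction A\<^sub>E A\<^sub>P p F"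
abbreviation "dirac \<equiv> induced_dirac A\<^sub>E A\<^sub>P p \<gamma> PiV F"

section \<open>Horizontal lifts\<close>

lemma connection:
  shows "linear_on (T e) (\<gamma> e)" "v \<in> T e \<Longrightarrow> \<gamma> e v \<in> T e" "v \<in> T e \<Longrightarrow> push (\<gamma> e v) = 0"
    "v \<in> T e \<Longrightarrow> push v = 0 \<Longrightarrow> \<gamma> e v = v"
    "smooth_vfield A\<^sub>E X \<Longrightarrow> smooth_vfield A\<^sub>E (\<lambda>e. \<gamma> e (X e))"
proof -
  have g: "linear_on (T e) (\<gamma> e)" "\<gamma> e ` T e \<subseteq> vertical_space A\<^sub>E A\<^sub>P p e"
    "\<And>v. v \<in> vertical_space A\<^sub>E A\<^sub>P p e \<Longrightarrow> \<gamma> e v = v"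
    "\<And>X. smooth_vfield A\<^sub>E X \<Longrightarrow> smooth_vfield A\<^sub>E (\<lambda>e. \<gamma> e (X e))"
    using geometric unfolding geometric_data_def ehresmann_connection_def by blast+
  show "linear_on (T e) (\<gamma> e)" by (rule g(1))
  show "v \<in> T e \<Longrightarrow> \<gamma> e v \<in> T e" "v \<in> T e \<Longrightarrow> push (\<gamma> e v) = 0"
    using g(2) by (auto simp: vertical_space_def)
  show "v \<in> T e \<Longrightarrow> push v = 0 \<Longrightarrow> \<gamma> e v = v" using g(3) by (simp add: vertical_space_def)
  show "smooth_vfield A\<^sub>E X \<Longrightarrow> smooth_vfield A\<^sub>E (\<lambda>e. \<gamma> e (X e))" by (rule g(4))
qed

text \<open>The coefficients of u in a base frame, pulled back to E, with the base directions of an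
  adapted frame. The resulting field need not be horizontal; subtracting its vertical part gives
  existence and smoothness of the horizontal lift.\<close>

lemma ex_local_lift:
  assumes u: "smooth_vfield A\<^sub>P u"
  obtains X W where "smooth_vfield A\<^sub>E X" "open W" "e \<in> W" "\<And>y. y \<in> W \<Longrightarrow> push (X y) = u (p y)"
proof (rule ex_adapted_frame)
  fix B :: "'b set" and C :: "'f set" and XH XV \<zeta> Y \<eta> W W'
  assume W: "open W" "e \<in> W" "P.local_frame B Y \<eta> W'" "\<And>y. y \<in> W \<Longrightarrow> p y \<in> W'"
    "\<And>b. smooth_vfield A\<^sub>E (XH b)" "\<And>y b. y \<in> W \<Longrightarrow> push (XH b y) = Y b (p y)"
  note YF = P.local_frameD[OF W(3)]
  have "(\<lambda>y. u (p y) (\<eta> b)) \<in> E.CInf" for b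
    using smooth_fun_projection[OF P.smooth_vfieldD(2)[OF u YF(4)]] by (simp add: o_def)
  then have "smooth_vfield A\<^sub>E (\<lambda>y. \<Sum>b\<in>B. u (p y) (\<eta> b) *\<^sub>R XH b y)"
    by (intro E.smooth_vfield_sum E.smooth_vfield_scaleR W(5))
  then show ?thesis
    by (rule that[OF _ W(1,2)])
       (simp add: push_sum W(6) YF(6)[OF W(4) P.smooth_vfieldD(1)[OF u], symmetric])
qed

text \<open>Two horizontal vectors over w differ by a vertical vector, which the connection both
  fixes and kills.\<close>

lemma lift_unique:
  assumes "v \<in> T e" "\<gamma> e v = 0" "push v = w"
  shows "lift e w = v"
  unfolding horizontal_lift_at_def
proof (rule the_equality)
  show "v \<in> horizontal_space A\<^sub>E \<gamma> e \<and> push v = w" using assms by (simp add: horizontal_space_def)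
  fix v' assume "v' \<in> horizontal_space A\<^sub>E \<gamma> e \<and> push v' = w"
  then have v': "v' \<in> T e" "\<gamma> e v' = 0" "push v' = w" by (auto simp: horizontal_space_def)
  have "\<gamma> e (v' - v) = v' - v"
    by (rule connection(4)) (use assms v' E.subspace_tangent_space in \<open>auto simp: push_diff
        subspace_diff\<close>)
  moreover have "\<gamma> e (v' - v) = \<gamma> e v' - \<gamma> e v"
    by (rule linear_on_diff[OF connection(1) E.subspace_tangent_space v'(1) assms(1)])
  ultimately show "v' = v" using assms v' by simp
qed

lemma lift_push:
  assumes "v \<in> T e"
  shows "lift e (push v) = v - \<gamma> e v"
proof (rule lift_unique)
  note g = connection(2)[OF assms]
  show "v - \<gamma> e v \<in> T e" using assms g E.subspace_tangent_space subspace_diff by blast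
  show "\<gamma> e (v - \<gamma> e v) = 0"
    using linear_on_diff[OF connection(1) E.subspace_tangent_space assms g] connection(4)[OF g
        connection(3)[OF assms]] by simp
  show "push (v - \<gamma> e v) = push v" using connection(3)[OF assms] by (simp add: push_diff)
qed

text \<open>Every base vector is the value of a vector field, which lifts locally; so
  \<open>push\<close> is onto, and removing the vertical part of a preimage leaves a horizontal
  one.\<close>

lemma lift:
  assumes "w \<in> tangent_space A\<^sub>P (p e)"
  shows "lift e w \<in> T e" "\<gamma> e (lift e w) = 0" "push (lift e w) = w"
proof -
  obtain u where u: "smooth_vfield A\<^sub>P u" "u (p e) = w" using P.ex_smooth_vfield_through[OF assms] by
      blast
  obtain X W where "smooth_vfield A\<^sub>E X" "e \<in> W" "\<And>y. y \<in> W \<Longrightarrow> push (X y) = u (p y)"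
    using ex_local_lift[OF u(1)] by metis
  then have v: "X e \<in> T e" "push (X e) = w" using E.smooth_vfieldD(1) u by auto
  note g = connection(2)[OF v(1)]
  have eq: "lift e w = X e - \<gamma> e (X e)" using lift_push[OF v(1)] v(2) by simp
  show "lift e w \<in> T e" unfolding eq using v g E.subspace_tangent_space subspace_diff by blast
  show "\<gamma> e (lift e w) = 0"
    unfolding eq using linear_on_diff[OF connection(1) E.subspace_tangent_space v(1) g]
      connection(4)[OF g connection(3)[OF v(1)]] by simp
  show "push (lift e w) = w" unfolding eq using v(2) connection(3)[OF v(1)] by (simp add: push_diff)
qed

lemma linear_on_lift: "linear_on (tangent_space A\<^sub>P (p e)) (lift e)"
  unfolding linear_on_def
proof (intro conjI ballI allI)
  fix w w' assume w: "w \<in> tangent_space A\<^sub>P (p e)" and w': "w' \<in> tangent_space A\<^sub>P (p e)"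
  show "lift e (w + w') = lift e w + lift e w'"
    by (rule lift_unique)
       (use lift[OF w] lift[OF w'] linear_onD(1)[OF connection(1)] in \<open>auto simp: push_add
           subspace_add[OF E.subspace_tangent_space]\<close>)
next
  fix c w assume w: "w \<in> tangent_space A\<^sub>P (p e)"
  show "lift e (c *\<^sub>R w) = c *\<^sub>R lift e w"
    by (rule lift_unique)
       (use lift[OF w] linear_onD(2)[OF connection(1)] in \<open>auto simp: push_scaleR subspace_scale[OF
           E.subspace_tangent_space]\<close>)
qed

lemma hor_apply: "hr u e = lift e (u (p e))"
  by (simp add: hor_def)

text \<open>Near each point the horizontal lift is X minus its vertical part, for any smooth X that
  projects to u there; the connection preserves smooth fields.\<close>

lemma smooth_vfield_hor:
  assumes u: "smooth_vfield A\<^sub>P u"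
  shows "smooth_vfield A\<^sub>E (hr u)"
proof (rule E.smooth_vfieldI)
  show "hr u e \<in> T e" for e using lift(1)[OF P.smooth_vfieldD(1)[OF u]] by (simp add: hor_apply)
  fix f assume f: "f \<in> E.CInf"
  show "(\<lambda>e. hr u e f) \<in> E.CInf"
  proof (rule E.smooth_funs_localI)
    fix e
    obtain X W where X: "smooth_vfield A\<^sub>E X" "open W" "e \<in> W" "\<And>y. y \<in> W \<Longrightarrow> push (X y) = u (p y)"
      using ex_local_lift[OF u] by metis
    have "smooth_vfield A\<^sub>E (\<lambda>y. X y - \<gamma> y (X y))"
      by (rule E.smooth_vfield_diff[OF X(1) connection(5)[OF X(1)]])
    from E.smooth_vfieldD(2)[OF this f]
    have "(\<lambda>y. (X y - \<gamma> y (X y)) f) \<in> E.CInf" .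
    moreover have "hr u y f = (X y - \<gamma> y (X y)) f" if "y \<in> W" for y
      using lift_push[OF E.smooth_vfieldD(1)[OF X(1)], of y] X(4)[OF that] by (simp add: hor_apply)
    ultimately show "\<exists>W g. open W \<and> e \<in> W \<and> g \<in> E.CInf \<and> (\<forall>y\<in>W. hr u y f = g y)"
      using X(2,3) by blast
  qed
qed

lemma push_hor: "smooth_vfield A\<^sub>P u \<Longrightarrow> push (hr u e) = u (p e)"
  using lift(3)[OF P.smooth_vfieldD(1)] by (simp add: hor_apply)

section \<open>The vertical bivector and its sharp map\<close>

lemma bivector:
  shows "\<alpha> \<in> T' e \<Longrightarrow> linear_on (T' e) (PiV e \<alpha>)" "\<beta> \<in> T' e \<Longrightarrow> linear_on (T' e) (\<lambda>\<alpha>. PiV e \<alpha> \<beta>)"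
    "\<alpha> \<in> T' e \<Longrightarrow> \<beta> \<in> T' e \<Longrightarrow> PiV e \<alpha> \<beta> = - PiV e \<beta> \<alpha>"
    "\<alpha> \<in> T' e \<Longrightarrow> \<beta> \<in> T' e \<Longrightarrow> (\<And>v. v \<in> T e \<Longrightarrow> push v = 0 \<Longrightarrow> \<alpha> v = 0) \<Longrightarrow> PiV e \<alpha> \<beta> = 0"
    "smooth_form1 A\<^sub>E a \<Longrightarrow> smooth_form1 A\<^sub>E b \<Longrightarrow> (\<lambda>e. PiV e (a e) (b e)) \<in> E.CInf"
proof -
  have g: "vertical_bivector_field A\<^sub>E A\<^sub>P p PiV" using geometric by (simp add: geometric_data_def)
  then have a: "alternating_bilinear_on (T' e) (PiV e)" by (simp add: vertical_bivector_field_def)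
  note aD = alternating_bilinear_onD[OF a E.subspace_cotangent_space]
  show "\<alpha> \<in> T' e \<Longrightarrow> linear_on (T' e) (PiV e \<alpha>)" "\<beta> \<in> T' e \<Longrightarrow> linear_on (T' e) (\<lambda>\<alpha>. PiV e \<alpha> \<beta>)"
    "\<alpha> \<in> T' e \<Longrightarrow> \<beta> \<in> T' e \<Longrightarrow> PiV e \<alpha> \<beta> = - PiV e \<beta> \<alpha>"
    by (fact aD)+
  show "\<alpha> \<in> T' e \<Longrightarrow> \<beta> \<in> T' e \<Longrightarrow> (\<And>v. v \<in> T e \<Longrightarrow> push v = 0 \<Longrightarrow> \<alpha> v = 0) \<Longrightarrow> PiV e \<alpha> \<beta> = 0"
    using g by (simp add: vertical_bivector_field_def vertical_space_def)
  show "smooth_form1 A\<^sub>E a \<Longrightarrow> smooth_form1 A\<^sub>E b \<Longrightarrow> (\<lambda>e. PiV e (a e) (b e)) \<in> E.CInf"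
    using g by (simp add: vertical_bivector_field_def E.smooth_funs_iff)
qed

text \<open>Differentials of functions separate tangent vectors, because a tangent vector is the
  function of its values \<open>v f\<close>.\<close>

lemma sharp_unique:
  assumes "v \<in> T e" "\<And>\<beta>. \<beta> \<in> T' e \<Longrightarrow> \<beta> v = PiV e \<alpha> \<beta>"
  shows "sh e \<alpha> = v"
  unfolding sharp_def
proof (rule the_equality)
  show "v \<in> T e \<and> (\<forall>\<beta>\<in>T' e. \<beta> v = PiV e \<alpha> \<beta>)" using assms by blast
  fix w assume w: "w \<in> T e \<and> (\<forall>\<beta>\<in>T' e. \<beta> w = PiV e \<alpha> \<beta>)"
  show "w = v"
  proof
    fix f
    have "differential A\<^sub>E f e w = differential A\<^sub>E f e v"
      using w assms(2)[OF E.differential_mem] E.differential_mem by simp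
    then show "w f = v f" using w assms(1) by (simp add: E.differential_apply)
  qed
qed

text \<open>Reflexivity in finite dimension: the linear form that \<alpha> induces on covectors is
  evaluation at a tangent vector, whose coefficients in a frame are its values on the dual
  coordinate differentials.\<close>

lemma sharp:
  assumes \<alpha>: "\<alpha> \<in> T' e"
  shows "sh e \<alpha> \<in> T e" "\<beta> \<in> T' e \<Longrightarrow> \<beta> (sh e \<alpha>) = PiV e \<alpha> \<beta>"
proof -
  obtain I :: "'m set" and X \<xi> W where fr: "E.local_frame I X \<xi> W" "e \<in> W" by (rule E.ex_frame)
  note FD = E.local_frameD[OF fr(1)]
  have X: "X i e \<in> T e" for i using E.smooth_vfieldD(1)[OF FD(3)] .
  define v where "v = (\<Sum>i\<in>I. PiV e \<alpha> (differential A\<^sub>E (\<xi> i) e) *\<^sub>R X i e)"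
  have v: "v \<in> T e"
    unfolding v_def by (intro subspace_sum subspace_scale E.subspace_tangent_space X)
  have eq: "\<beta> v = PiV e \<alpha> \<beta>" if \<beta>: "\<beta> \<in> T' e" for \<beta>
  proof -
    have exp: "\<beta> = (\<Sum>i\<in>I. \<beta> (X i e) *\<^sub>R differential A\<^sub>E (\<xi> i) e)"
    proof (rule E.cotangent_eqI[OF \<beta>])
      show "(\<Sum>i\<in>I. \<beta> (X i e) *\<^sub>R differential A\<^sub>E (\<xi> i) e) \<in> T' e"
        by (intro subspace_sum subspace_scale E.subspace_cotangent_space E.differential_mem)
      fix w assume w: "w \<in> T e"
      have "\<beta> w = \<beta> (\<Sum>i\<in>I. w (\<xi> i) *\<^sub>R X i e)" using FD(6)[OF fr(2) w] by simp
      also have "\<dots> = (\<Sum>i\<in>I. w (\<xi> i) * \<beta> (X i e))" by (rule E.cotangent_sum[OF \<beta> X])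
      finally show "\<beta> w = (\<Sum>i\<in>I. \<beta> (X i e) *\<^sub>R differential A\<^sub>E (\<xi> i) e) w"
        using w by (simp add: sum_fun_eq scaleR_fun_apply E.differential_apply mult.commute)
    qed
    have "PiV e \<alpha> \<beta> = PiV e \<alpha> (\<Sum>i\<in>I. \<beta> (X i e) *\<^sub>R differential A\<^sub>E (\<xi> i) e)" using exp by simp
    also have "\<dots> = (\<Sum>i\<in>I. \<beta> (X i e) *\<^sub>R PiV e \<alpha> (differential A\<^sub>E (\<xi> i) e))"
      by (rule linear_on_sum[OF bivector(1)[OF \<alpha>] E.subspace_cotangent_space E.differential_mem])
    also have "\<dots> = \<beta> v" unfolding v_def by (subst E.cotangent_sum[OF \<beta> X]) (simp add: mult.commute)
    finally show ?thesis by simp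
  qed
  have "sh e \<alpha> = v" by (rule sharp_unique[OF v eq])
  then show "sh e \<alpha> \<in> T e" "\<beta> \<in> T' e \<Longrightarrow> \<beta> (sh e \<alpha>) = PiV e \<alpha> \<beta>" using v eq by auto
qed

lemma sharp_apply: "\<alpha> \<in> T' e \<Longrightarrow> sh e \<alpha> f = PiV e \<alpha> (differential A\<^sub>E f e)"
  using sharp(2)[OF _ E.differential_mem, of \<alpha> e f] sharp(1)[of \<alpha> e] by (simp add: E.differential_apply)

lemma linear_on_sharp: "linear_on (T' e) (sh e)"
  unfolding linear_on_def
proof (intro conjI ballI allI)
  fix \<alpha> \<beta> assume ab: "\<alpha> \<in> T' e" "\<beta> \<in> T' e"
  show "sh e (\<alpha> + \<beta>) = sh e \<alpha> + sh e \<beta>"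
    by (rule sharp_unique)
       (use ab sharp in \<open>auto simp: subspace_add[OF E.subspace_tangent_space] E.cotangent_spaceD(1)
           linear_onD(1)[OF bivector(2)]\<close>)
next
  fix c \<alpha> assume a: "\<alpha> \<in> T' e"
  show "sh e (c *\<^sub>R \<alpha>) = c *\<^sub>R sh e \<alpha>"
    by (rule sharp_unique)
       (use a sharp in \<open>auto simp: subspace_scale[OF E.subspace_tangent_space] E.cotangent_spaceD(2)
           linear_onD(2)[OF bivector(2)]\<close>)
qed

text \<open>The differential of \<open>g \<circ> p\<close> annihilates vertical vectors, so a
  vertical bivector vanishes on it.\<close>

lemma push_sharp:
  assumes "\<alpha> \<in> T' e"
  shows "push (sh e \<alpha>) = 0"
proof
  fix g
  show "push (sh e \<alpha>) g = 0 g"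
  proof (cases "g \<in> P.CInf")
    case True
    have "PiV e (differential A\<^sub>E (g \<circ> p) e) \<alpha> = 0"
    proof (rule bivector(4)[OF E.differential_mem assms])
      fix v assume v: "v \<in> T e" "push v = 0"
      then show "differential A\<^sub>E (g \<circ> p) e v = 0"
        using push_apply[OF True, of v] by (simp add: E.differential_apply)
    qed
    then show ?thesis
      using bivector(3)[OF assms E.differential_mem, of "g \<circ> p"] sharp_apply[OF assms] by (simp add:
          push_apply True)
  qed (simp add: pushforward_def)
qed

lemma smooth_vfield_sharp:
  assumes "smooth_form1 A\<^sub>E a"
  shows "smooth_vfield A\<^sub>E (\<lambda>e. sh e (a e))"
proof (rule E.smooth_vfieldI)
  note a = E.smooth_form1D(1)[OF assms]
  show "sh e (a e) \<in> T e" for e using sharp(1)[OF a] .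
  show "(\<lambda>e. sh e (a e) f) \<in> E.CInf" if "f \<in> E.CInf" for f
    unfolding sharp_apply[OF a] by (rule bivector(5)[OF assms E.smooth_form1_differential[OF that]])
qed

section \<open>The horizontal 2-form and its contractions\<close>

lemma two_form:
  shows "w \<in> tangent_space A\<^sub>P (p e) \<Longrightarrow> linear_on (tangent_space A\<^sub>P (p e)) (F e w)"
    "w' \<in> tangent_space A\<^sub>P (p e) \<Longrightarrow> linear_on (tangent_space A\<^sub>P (p e)) (\<lambda>w. F e w w')"
    "w \<in> tangent_space A\<^sub>P (p e) \<Longrightarrow> w' \<in> tangent_space A\<^sub>P (p e) \<Longrightarrow> F e w w' = - F e w' w"
    "smooth_vfield A\<^sub>P u \<Longrightarrow> smooth_vfield A\<^sub>P v \<Longrightarrow> (\<lambda>e. F e (u (p e)) (v (p e))) \<in> E.CInf"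
proof -
  have g: "form2_with_values A\<^sub>E A\<^sub>P p F" using geometric by (simp add: geometric_data_def)
  then have a: "alternating_bilinear_on (tangent_space A\<^sub>P (p e)) (F e)" by (simp add:
      form2_with_values_def)
  note aD = alternating_bilinear_onD[OF a P.subspace_tangent_space]
  show "w \<in> tangent_space A\<^sub>P (p e) \<Longrightarrow> linear_on (tangent_space A\<^sub>P (p e)) (F e w)"
    "w' \<in> tangent_space A\<^sub>P (p e) \<Longrightarrow> linear_on (tangent_space A\<^sub>P (p e)) (\<lambda>w. F e w w')"
    "w \<in> tangent_space A\<^sub>P (p e) \<Longrightarrow> w' \<in> tangent_space A\<^sub>P (p e) \<Longrightarrow> F e w w' = - F e w' w"
    by (fact aD)+
  show "smooth_vfield A\<^sub>P u \<Longrightarrow> smooth_vfield A\<^sub>P v \<Longrightarrow> (\<lambda>e. F e (u (p e)) (v (p e))) \<in> E.CInf"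
    using g by (simp add: form2_with_values_def E.smooth_funs_iff)
qed

lemma contraction_apply: "v \<in> T e \<Longrightarrow> con e w v = F e w (push v)"
  by (simp add: horizontal_contraction_def)

lemma contraction_mem:
  assumes "w \<in> tangent_space A\<^sub>P (p e)"
  shows "con e w \<in> T' e"
  by (rule E.cotangent_spaceI)
     (use linear_onD[OF two_form(1)[OF assms]] push_mem in
       \<open>auto simp: horizontal_contraction_def push_add push_scaleR subspace_add[OF
           E.subspace_tangent_space] subspace_scale[OF E.subspace_tangent_space]\<close>)

lemma contraction_vertical: "w \<in> tangent_space A\<^sub>P (p e) \<Longrightarrow> v \<in> T e \<Longrightarrow> push v = 0 \<Longrightarrow> con e w v = 0"
  using linear_on_zero[OF two_form(1) subspace_0[OF P.subspace_tangent_space]] by (simp add: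
      contraction_apply)

lemma linear_on_contraction: "linear_on (tangent_space A\<^sub>P (p e)) (con e)"
  unfolding linear_on_def
  by (auto simp: horizontal_contraction_def fun_eq_iff scaleR_fun_apply linear_onD[OF two_form(2)]
      push_mem)

lemma smooth_form1_contraction:
  assumes u: "smooth_vfield A\<^sub>P u"
  shows "smooth_form1 A\<^sub>E (\<lambda>e. con e (u (p e)))"
proof (rule E.smooth_form1I)
  note uT = P.smooth_vfieldD(1)[OF u]
  show "con e (u (p e)) \<in> T' e" for e using contraction_mem[OF uT] .
  fix X assume X: "smooth_vfield A\<^sub>E X"
  note XT = E.smooth_vfieldD(1)[OF X]
  show "(\<lambda>e. con e (u (p e)) (X e)) \<in> E.CInf"
    unfolding contraction_apply[OF XT]
  proof (rule E.smooth_funs_localI)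
    fix e
    obtain I :: "'b set" and Y \<eta> W where fr: "P.local_frame I Y \<eta> W" "p e \<in> W" by (rule P.ex_frame)
    note FD = P.local_frameD[OF fr(1)]
    \<comment> \<open>Smoothness of \<open>F\<close> is given on fields pulled back from P, but
      \<open>push (X y)\<close> may vary along the fibres. Its expansion in a base frame moves this
      variation into smooth coefficients.\<close>
    let ?g = "\<lambda>y. \<Sum>i\<in>I. X y (\<eta> i \<circ> p) * F y (u (p y)) (Y i (p y))"
    have "F y (u (p y)) (push (X y)) = ?g y" if "p y \<in> W" for y
    proof -
      have "F y (u (p y)) (push (X y)) = F y (u (p y)) (\<Sum>i\<in>I. push (X y) (\<eta> i) *\<^sub>R Y i (p y))"
        using FD(6)[OF that push_mem[OF XT]] by simp
      also have "\<dots> = ?g y"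
        by (subst linear_on_sum[OF two_form(1)[OF uT] P.subspace_tangent_space
            P.smooth_vfieldD(1)[OF FD(3)]])
           (simp add: push_apply FD(4))
      finally show ?thesis .
    qed
    moreover have "?g \<in> E.CInf"
      by (intro E.smooth_funs_sum E.smooth_funs_mult two_form(4)[OF u FD(3)] E.smooth_vfieldD(2)[OF X]
          smooth_fun_projection FD(4))
    ultimately show "\<exists>W g. open W \<and> e \<in> W \<and> g \<in> E.CInf \<and> (\<forall>y\<in>W. F y (u (p y)) (push (X y)) = g y)"
      using fr(2) open_vimage_projection[OF FD(2)] by (intro exI[of _ "p -` W"] exI[of _ ?g]) auto
  qed
qed

section \<open>The subspaces of the induced structure\<close>

lemma diracI:
  assumes "w \<in> tangent_space A\<^sub>P (p e)" "\<alpha> \<in> T' e" "\<And>v. v \<in> T e \<Longrightarrow> \<gamma> e v = 0 \<Longrightarrow> \<alpha> v = 0"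
  shows "(lift e w + sh e \<alpha>, con e w + \<alpha>) \<in> dirac e"
  using assms unfolding induced_dirac_def horizontal_space_def by blast

lemma diracE:
  assumes "s \<in> dirac e"
  obtains w \<alpha> where "s = (lift e w + sh e \<alpha>, con e w + \<alpha>)" "w \<in> tangent_space A\<^sub>P (p e)" "\<alpha> \<in> T' e"
    "\<And>v. v \<in> T e \<Longrightarrow> \<gamma> e v = 0 \<Longrightarrow> \<alpha> v = 0"
  using assms unfolding induced_dirac_def horizontal_space_def by blast

lemma dirac_subset:
  assumes "s \<in> dirac e"
  shows "fst s \<in> T e" "snd s \<in> T' e"
proof -
  obtain w \<alpha> where s: "s = (lift e w + sh e \<alpha>, con e w + \<alpha>)" "w \<in> tangent_space A\<^sub>P (p e)" "\<alpha> \<in> T' e"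
    using diracE[OF assms] by metis
  show "fst s \<in> T e" "snd s \<in> T' e"
    unfolding s(1) fst_conv snd_conv
    by (intro subspace_add E.subspace_tangent_space E.subspace_cotangent_space lift(1) sharp(1)
        contraction_mem s(2,3))+
qed

text \<open>The mixed terms vanish: the contraction of \<open>F\<close> kills vertical vectors and
  \<alpha> kills horizontal ones. What remains is antisymmetric in the two elements, once through
  \<open>F\<close> and once through the bivector.\<close>

lemma dirac_isotropic:
  assumes "s \<in> dirac e" "t \<in> dirac e"
  shows "pairing s t = 0"
proof -
  have half: "snd s (fst t) = F e w w' + PiV e \<alpha>' \<alpha>"
    if s: "s = (lift e w + sh e \<alpha>, con e w + \<alpha>)" "w \<in> tangent_space A\<^sub>P (p e)" "\<alpha> \<in> T' e"
        "\<And>v. v \<in> T e \<Longrightarrow> \<gamma> e v = 0 \<Longrightarrow> \<alpha> v = 0"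
      and t: "t = (lift e w' + sh e \<alpha>', con e w' + \<alpha>')" "w' \<in> tangent_space A\<^sub>P (p e)" "\<alpha>' \<in> T' e"
    for s t w \<alpha> w' \<alpha>'
  proof -
    note L = lift[OF t(2)] and S = sharp[OF t(3)]
    note c = contraction_mem[OF s(2)]
    have "con e w (lift e w' + sh e \<alpha>') = F e w w'"
      using E.cotangent_spaceD(1)[OF c L(1) S(1)] contraction_vertical[OF s(2) S(1) push_sharp[OF t(3)]]
        contraction_apply[OF L(1)] L(3) by simp
    moreover have "\<alpha> (lift e w' + sh e \<alpha>') = PiV e \<alpha>' \<alpha>"
      using E.cotangent_spaceD(1)[OF s(3) L(1) S(1)] s(4)[OF L(1,2)] S(2)[OF s(3)] by simp
    ultimately show ?thesis unfolding s(1) t(1) by simp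
  qed
  obtain w \<alpha> where s: "s = (lift e w + sh e \<alpha>, con e w + \<alpha>)" "w \<in> tangent_space A\<^sub>P (p e)" "\<alpha> \<in> T' e"
      "\<And>v. v \<in> T e \<Longrightarrow> \<gamma> e v = 0 \<Longrightarrow> \<alpha> v = 0"
    using diracE[OF assms(1)] by metis
  obtain w' \<alpha>' where t: "t = (lift e w' + sh e \<alpha>', con e w' + \<alpha>')" "w' \<in> tangent_space A\<^sub>P (p e)" "\<alpha>'
      \<in> T' e"
      "\<And>v. v \<in> T e \<Longrightarrow> \<gamma> e v = 0 \<Longrightarrow> \<alpha>' v = 0"
    using diracE[OF assms(2)] by metis
  show ?thesis
    using half[OF s t(1-3)] half[OF t s(1-3)] two_form(3)[OF s(2) t(2)] bivector(3)[OF s(3) t(3)]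
    by (simp add: pairing_def)
qed

text \<open>The parameters are forced: w is the projection of v, and \<alpha> is \<beta> minus the
  contraction of \<open>F\<close> with w. Pairing with the elements over horizontal vectors shows
  that \<alpha> kills Hor; pairing with the elements (sharp \<epsilon>, \<epsilon>) identifies the
  vertical part of v with sharp \<alpha>.\<close>

lemma dirac_perp:
  assumes v: "v \<in> T e" and \<beta>: "\<beta> \<in> T' e" and perp: "\<And>s. s \<in> dirac e \<Longrightarrow> pairing (v, \<beta>) s = 0"
  shows "(v, \<beta>) \<in> dirac e"
proof -
  define w where "w = push v"
  define \<alpha> where "\<alpha> = \<beta> - con e w"
  have w: "w \<in> tangent_space A\<^sub>P (p e)" unfolding w_def by (rule push_mem[OF v])
  note c = contraction_mem[OF w]
  have \<alpha>: "\<alpha> \<in> T' e" unfolding \<alpha>_def by (rule subspace_diff[OF E.subspace_cotangent_space \<beta> c])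
  have hor0: "\<alpha> x = 0" if x: "x \<in> T e" "\<gamma> e x = 0" for x
  proof -
    have px: "push x \<in> tangent_space A\<^sub>P (p e)" by (rule push_mem[OF x(1)])
    have l: "lift e (push x) = x" using lift_push[OF x(1)] x(2) by simp
    have z: "0 \<in> T' e" by (rule subspace_0[OF E.subspace_cotangent_space])
    have "sh e 0 = 0" by (rule linear_on_zero[OF linear_on_sharp z])
    moreover have "(lift e (push x) + sh e 0, con e (push x) + 0) \<in> dirac e"
      by (rule diracI[OF px z]) simp
    ultimately have "(x, con e (push x)) \<in> dirac e" using l by (metis add_0_right)
    from perp[OF this] have "\<beta> x + con e (push x) v = 0" by (simp add: pairing_def)
    then show ?thesis
      using two_form(3)[OF px w] contraction_apply[OF v] contraction_apply[OF x(1)] by (simp add: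
          \<alpha>_def w_def)
  qed
  have "v - lift e w = sh e \<alpha>"
  proof (rule sharp_unique[symmetric])
    have lv: "v - lift e w = \<gamma> e v" using lift_push[OF v] by (simp add: w_def)
    show "v - lift e w \<in> T e" unfolding lv by (rule connection(2)[OF v])
    fix \<delta> assume \<delta>: "\<delta> \<in> T' e"
    \<comment> \<open>An arbitrary \<delta> is not admissible, since it need not kill Hor. Composing
      it with the connection makes it admissible and leaves it unchanged on vertical vectors, which
      are all that the bivector sees.\<close>
    define \<epsilon> where "\<epsilon> = (\<lambda>x. if x \<in> T e then \<delta> (\<gamma> e x) else 0)"
    have \<epsilon>: "\<epsilon> \<in> T' e"
      by (rule E.cotangent_spaceI)
         (use connection(2) linear_onD[OF connection(1)] E.cotangent_spaceD[OF \<delta>] in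
           \<open>auto simp: \<epsilon>_def subspace_add[OF E.subspace_tangent_space] subspace_scale[OF
               E.subspace_tangent_space]\<close>)
    have \<epsilon>0: "\<epsilon> x = 0" if "x \<in> T e" "\<gamma> e x = 0" for x
      using that E.cotangent_zero[OF \<delta>] by (simp add: \<epsilon>_def)
    have z: "0 \<in> tangent_space A\<^sub>P (p e)" by (rule subspace_0[OF P.subspace_tangent_space])
    have z0: "lift e 0 = 0" "con e 0 = 0"
      by (rule linear_on_zero[OF linear_on_lift z], rule linear_on_zero[OF linear_on_contraction z])
    have "(lift e 0 + sh e \<epsilon>, con e 0 + \<epsilon>) \<in> dirac e" by (rule diracI[OF z \<epsilon> \<epsilon>0])
    then have "(sh e \<epsilon>, \<epsilon>) \<in> dirac e" unfolding z0 by (metis add_0_left)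
    from perp[OF this] have "\<beta> (sh e \<epsilon>) + \<epsilon> v = 0" by (simp add: pairing_def)
    moreover have "\<beta> (sh e \<epsilon>) = \<alpha> (sh e \<epsilon>)"
      using contraction_vertical[OF w sharp(1)[OF \<epsilon>] push_sharp[OF \<epsilon>]] by (simp add: \<alpha>_def)
    moreover have "\<alpha> (sh e \<epsilon>) = - PiV e \<alpha> \<epsilon>" using sharp(2)[OF \<epsilon> \<alpha>] bivector(3)[OF \<epsilon> \<alpha>] by simp
    moreover have "PiV e \<alpha> \<epsilon> = PiV e \<alpha> \<delta>"
    proof -
      have d: "\<delta> - \<epsilon> \<in> T' e" by (rule subspace_diff[OF E.subspace_cotangent_space \<delta> \<epsilon>])
      have "PiV e (\<delta> - \<epsilon>) \<alpha> = 0"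
        by (rule bivector(4)[OF d \<alpha>]) (simp add: \<epsilon>_def connection(4))
      then have "PiV e \<alpha> (\<delta> - \<epsilon>) = 0" using bivector(3)[OF \<alpha> d] by simp
      then show ?thesis
        using linear_on_diff[OF bivector(1)[OF \<alpha>] E.subspace_cotangent_space \<delta> \<epsilon>] by simp
    qed
    ultimately show "\<delta> (v - lift e w) = PiV e \<alpha> \<delta>" unfolding lv using v by (simp add: \<epsilon>_def)
  qed
  then have "v = lift e w + sh e \<alpha>" by (metis add_diff_cancel_left' diff_add_cancel add.commute)
  moreover have "\<beta> = con e w + \<alpha>" by (simp add: \<alpha>_def)
  ultimately show ?thesis using diracI[OF w \<alpha> hor0] by metis
qed

lemma pairing_linear:
  assumes "fst s \<in> T e" "snd s \<in> T' e" "fst t \<in> T e" "snd t \<in> T' e" "fst r \<in> T e" "snd r \<in> T' e"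
  shows "pairing (s + t) r = pairing s r + pairing t r" "pairing (c *\<^sub>R s) r = c * pairing s r"
  using assms by (simp_all add: pairing_def E.cotangent_spaceD(1,2) scaleR_fun_apply field_simps)

lemma pairing_commute: "pairing s t = pairing t s"
  by (simp add: pairing_def)

text \<open>An orthogonal complement is closed under linear combinations because the pairing is
  bilinear; the parametrization by w and \<alpha> is bypassed.\<close>

lemma subspace_dirac: "subspace (dirac e)"
proof (rule subspaceI)
  note sub = E.subspace_tangent_space[of e] E.subspace_cotangent_space[of e]
  have "(0, 0) \<in> dirac e"
    by (rule dirac_perp)
       (use sub E.cotangent_zero[OF dirac_subset(2)] in \<open>simp_all add: pairing_def subspace_0 del:
           split_paired_All\<close>)
  then show "0 \<in> dirac e" by (simp only: zero_prod_def)
  fix s t assume s: "s \<in> dirac e" and t: "t \<in> dirac e"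
  have "(fst (s + t), snd (s + t)) \<in> dirac e"
  proof (rule dirac_perp)
    show "fst (s + t) \<in> T e" "snd (s + t) \<in> T' e"
      unfolding fst_add snd_add by (intro subspace_add sub dirac_subset s t)+
    fix r assume r: "r \<in> dirac e"
    show "pairing (fst (s + t), snd (s + t)) r = 0"
      unfolding prod.collapse
      using pairing_linear(1)[OF dirac_subset[OF s] dirac_subset[OF t] dirac_subset[OF r]]
        dirac_isotropic[OF s r] dirac_isotropic[OF t r] by simp
  qed
  then show "s + t \<in> dirac e" by (simp only: prod.collapse)
next
  note sub = E.subspace_tangent_space[of e] E.subspace_cotangent_space[of e]
  fix c s assume s: "s \<in> dirac e"
  have "(fst (c *\<^sub>R s), snd (c *\<^sub>R s)) \<in> dirac e"
  proof (rule dirac_perp)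
    show "fst (c *\<^sub>R s) \<in> T e" "snd (c *\<^sub>R s) \<in> T' e"
      unfolding fst_scaleR snd_scaleR by (intro subspace_scale sub dirac_subset s)+
    fix r assume r: "r \<in> dirac e"
    show "pairing (fst (c *\<^sub>R s), snd (c *\<^sub>R s)) r = 0"
      unfolding prod.collapse
      using pairing_linear(2)[OF dirac_subset[OF s] dirac_subset[OF s] dirac_subset[OF r]]
          dirac_isotropic[OF s r] by simp
  qed
  then show "c *\<^sub>R s \<in> dirac e" by (simp only: prod.collapse)
qed

text \<open>An isotropic space containing D is orthogonal to D, hence contained in it by
  \<open>dirac_perp\<close>.\<close>

lemma maximal_isotropic_dirac: "maximal_isotropic_subspace A\<^sub>E e (dirac e)"
  unfolding maximal_isotropic_subspace_def
proof (intro conjI allI impI)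
  show "isotropic_subspace A\<^sub>E e (dirac e)"
    unfolding isotropic_subspace_def
    using dirac_subset subspace_dirac dirac_isotropic by (auto simp: mem_Times_iff)
  fix L assume L: "isotropic_subspace A\<^sub>E e L \<and> dirac e \<subseteq> L"
  have "s \<in> dirac e" if s: "s \<in> L" for s
  proof -
    have "(fst s, snd s) \<in> dirac e"
      by (rule dirac_perp) (use L s in \<open>auto simp: isotropic_subspace_def\<close>)
    then show ?thesis by simp
  qed
  then show "L = dirac e" using L by blast
qed

section \<open>Generating sections and local frames\<close>

definition vdiff :: "('e \<Rightarrow> real) \<Rightarrow> 'e form1"
  where "vdiff f e = (\<lambda>v. if v \<in> T e then \<gamma> e v f else 0)"

text \<open>The Hamiltonian vector field; with this sign \<open>ham f e g\<close> is the bracket of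
  f and g, that is \<Pi>(df, dg).\<close>

definition ham :: "('e \<Rightarrow> real) \<Rightarrow> 'e vfield"
  where "ham f e = sh e (differential A\<^sub>E f e)"

lemma vdiff_apply: "v \<in> T e \<Longrightarrow> vdiff f e v = \<gamma> e v f"
  by (simp add: vdiff_def)

lemma vdiff_vertical: "v \<in> T e \<Longrightarrow> push v = 0 \<Longrightarrow> vdiff f e v = v f"
  by (simp add: vdiff_def connection(4))

lemma vdiff_mem: "vdiff f e \<in> T' e"
  by (rule E.cotangent_spaceI)
     (use linear_onD[OF connection(1)] in
       \<open>auto simp: vdiff_def subspace_add[OF E.subspace_tangent_space] subspace_scale[OF
           E.subspace_tangent_space] scaleR_fun_apply\<close>)

lemma smooth_form1_vdiff:
  assumes "f \<in> E.CInf"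
  shows "smooth_form1 A\<^sub>E (vdiff f)"
proof (rule E.smooth_form1I)
  fix X assume X: "smooth_vfield A\<^sub>E X"
  show "(\<lambda>e. vdiff f e (X e)) \<in> E.CInf"
    unfolding vdiff_apply[OF E.smooth_vfieldD(1)[OF X]]
    by (rule E.smooth_vfieldD(2)[OF connection(5)[OF X] assms])
qed (rule vdiff_mem)

text \<open>The difference of \<open>differential\<close> and \<open>vdiff\<close> annihilates
  vertical vectors, since the connection fixes these; a vertical bivector cannot tell the two
  covectors apart.\<close>

lemma sharp_vdiff: "sh e (vdiff f e) = ham f e"
proof (rule sharp_unique)
  note d = E.differential_mem[of f e]
  show "ham f e \<in> T e" unfolding ham_def by (rule sharp(1)[OF d])
  fix \<beta> assume \<beta>: "\<beta> \<in> T' e"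
  have m: "differential A\<^sub>E f e - vdiff f e \<in> T' e"
    by (rule subspace_diff[OF E.subspace_cotangent_space d vdiff_mem])
  have "PiV e (differential A\<^sub>E f e - vdiff f e) \<beta> = 0"
    by (rule bivector(4)[OF m \<beta>]) (simp add: E.differential_apply vdiff_vertical)
  then have "PiV e (differential A\<^sub>E f e) \<beta> = PiV e (vdiff f e) \<beta>"
    using linear_on_diff[OF bivector(2)[OF \<beta>] E.subspace_cotangent_space d vdiff_mem] by simp
  then show "\<beta> (ham f e) = PiV e (vdiff f e) \<beta>" unfolding ham_def using sharp(2)[OF d \<beta>] by simp
qed

lemma ham:
  shows "ham f e \<in> T e" "push (ham f e) = 0" "f \<in> E.CInf \<Longrightarrow> smooth_vfield A\<^sub>E (ham f)"
    "ham f e g = PiV e (differential A\<^sub>E f e) (differential A\<^sub>E g e)" "ham f e g = - ham g e f"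
proof -
  note d = E.differential_mem
  show "ham f e \<in> T e" "push (ham f e) = 0"
    unfolding ham_def by (rule sharp(1)[OF d], rule push_sharp[OF d])
  show "f \<in> E.CInf \<Longrightarrow> smooth_vfield A\<^sub>E (ham f)"
    using smooth_vfield_sharp[OF E.smooth_form1_differential] unfolding ham_def[abs_def] by simp
  show eq: "ham f e g = PiV e (differential A\<^sub>E f e) (differential A\<^sub>E g e)" for f g
    unfolding ham_def by (rule sharp_apply[OF d])
  show "ham f e g = - ham g e f" unfolding eq by (rule bivector(3)[OF d d])
qed

definition hor_section :: "'p vfield \<Rightarrow> 'e \<Rightarrow> 'e tvec \<times> 'e covec"
  where "hor_section u e = (hr u e, con e (u (p e)))"

definition vert_section :: "('e \<Rightarrow> real) \<Rightarrow> 'e \<Rightarrow> 'e tvec \<times> 'e covec"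
  where "vert_section f e = (ham f e, vdiff f e)"

lemma hor_section:
  assumes u: "smooth_vfield A\<^sub>P u"
  shows "hor_section u \<in> sections A\<^sub>E dirac"
proof -
  have "hor_section u e \<in> dirac e" for e
  proof -
    have z: "0 \<in> T' e" by (rule subspace_0[OF E.subspace_cotangent_space])
    have "sh e 0 = 0" by (rule linear_on_zero[OF linear_on_sharp z])
    moreover have "(lift e (u (p e)) + sh e 0, con e (u (p e)) + 0) \<in> dirac e"
      by (rule diracI[OF P.smooth_vfieldD(1)[OF u] z]) simp
    ultimately show ?thesis unfolding hor_section_def hor_apply by (metis add_0_right)
  qed
  then show ?thesis
    by (simp add: sections_def E.smooth_section_iff hor_section_def smooth_vfield_hor[OF u]
        smooth_form1_contraction[OF u])
qed

lemma vert_section: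
  assumes f: "f \<in> E.CInf"
  shows "vert_section f \<in> sections A\<^sub>E dirac"
proof -
  have "vert_section f e \<in> dirac e" for e
  proof -
    have z: "0 \<in> tangent_space A\<^sub>P (p e)" by (rule subspace_0[OF P.subspace_tangent_space])
    have z0: "lift e 0 = 0" "con e 0 = 0"
      by (rule linear_on_zero[OF linear_on_lift z], rule linear_on_zero[OF linear_on_contraction z])
    have "(lift e 0 + sh e (vdiff f e), con e 0 + vdiff f e) \<in> dirac e"
      by (rule diracI[OF z vdiff_mem]) (simp add: vdiff_apply)
    then show ?thesis unfolding z0 vert_section_def sharp_vdiff by (metis add_0_left)
  qed
  then show ?thesis
    using ham(3)[OF f] smooth_form1_vdiff[OF f]
    by (simp add: sections_def E.smooth_section_iff vert_section_def)
qed

text \<open>The coefficients are explicit, base coordinates of the vector part and values of the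
  covector part on vertical frame fields, so along a smooth section they are smooth functions.
  Independence is stated by coefficients, since the frame is a family over two index sets.\<close>

lemma ex_dirac_frame:
  obtains B :: "'b set" and C :: "'f set" and XV \<zeta> Y \<eta> W where
    "finite B" "finite C" "open W" "e \<in> W" "\<And>b. smooth_vfield A\<^sub>P (Y b)" "\<And>b. \<eta> b \<in> P.CInf"
    "\<And>c. \<zeta> c \<in> E.CInf" "\<And>c. smooth_vfield A\<^sub>E (XV c)"
    "\<And>y s. y \<in> W \<Longrightarrow> s \<in> dirac y \<Longrightarrow> s = (\<Sum>b\<in>B. push (fst s) (\<eta> b) *\<^sub>R hor_section (Y b) y) +
      (\<Sum>c\<in>C. snd s (XV c y) *\<^sub>R vert_section (\<zeta> c) y)"
    "\<And>y a a' b. y \<in> W \<Longrightarrow> b \<in> B \<Longrightarrow> (\<Sum>b\<in>B. a b *\<^sub>R hor_section (Y b) y) + (\<Sum>c\<in>C. a' c *\<^sub>R vert_section (\<zeta>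
        c) y) = 0 \<Longrightarrow> a b = 0"
    "\<And>y a a' c. y \<in> W \<Longrightarrow> c \<in> C \<Longrightarrow> (\<Sum>b\<in>B. a b *\<^sub>R hor_section (Y b) y) + (\<Sum>c\<in>C. a' c *\<^sub>R vert_section (\<zeta>
        c) y) = 0 \<Longrightarrow> a' c = 0"
proof (rule ex_adapted_frame)
  fix B :: "'b set" and C :: "'f set" and XH XV \<zeta> Y \<eta> W W'
  assume fr: "finite C" "open W" "e \<in> W" "P.local_frame B Y \<eta> W'" "\<And>y. y \<in> W \<Longrightarrow> p y \<in> W'"
    "\<And>c. smooth_vfield A\<^sub>E (XV c)" "\<And>c. \<zeta> c \<in> E.CInf" "\<And>y c. y \<in> W \<Longrightarrow> push (XV c y) = 0"
    "\<And>y c c'. y \<in> W \<Longrightarrow> c \<in> C \<Longrightarrow> c' \<in> C \<Longrightarrow> XV c y (\<zeta> c') = (if c = c' then 1 else 0)"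
    "\<And>y v. y \<in> W \<Longrightarrow> v \<in> T y \<Longrightarrow> v = (\<Sum>b\<in>B. push v (\<eta> b) *\<^sub>R XH b y) + (\<Sum>c\<in>C. v (\<zeta> c) *\<^sub>R XV c y)"
  note YF = P.local_frameD[OF fr(4)]
  have XVT: "XV c y \<in> T y" for c y using E.smooth_vfieldD(1)[OF fr(6)] .
  have YT: "Y b x \<in> tangent_space A\<^sub>P x" for b x using P.smooth_vfieldD(1)[OF YF(3)] .
  have expand: "s = (\<Sum>b\<in>B. push (fst s) (\<eta> b) *\<^sub>R hor_section (Y b) y) + (\<Sum>c\<in>C. snd s (XV c y) *\<^sub>R
      vert_section (\<zeta> c) y)"
    if y: "y \<in> W" and s: "s \<in> dirac y" for y s
  proof -
    obtain w \<alpha> where s: "s = (lift y w + sh y \<alpha>, con y w + \<alpha>)" and w: "w \<in> tangent_space A\<^sub>P (p y)"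
        and \<alpha>: "\<alpha> \<in> T' y"
        and hor0: "\<And>v. v \<in> T y \<Longrightarrow> \<gamma> y v = 0 \<Longrightarrow> \<alpha> v = 0"
      using diracE[OF s] by metis
    have pw: "push (fst s) = w" using lift(3)[OF w] push_sharp[OF \<alpha>] unfolding s fst_conv push_add
        by (metis add_0_right)
    have w_eq: "w = (\<Sum>b\<in>B. w (\<eta> b) *\<^sub>R Y b (p y))" using YF(6)[OF fr(5)[OF y] w] .
    \<comment> \<open>The contraction of \<open>F\<close> vanishes on vertical fields, so these read
      off \<alpha> alone.\<close>
    have \<alpha>c: "snd s (XV c y) = \<alpha> (XV c y)" for c
      using contraction_vertical[OF w XVT fr(8)[OF y]] by (simp add: s)
    have \<alpha>_eq: "\<alpha> = (\<Sum>c\<in>C. \<alpha> (XV c y) *\<^sub>R vdiff (\<zeta> c) y)"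
    proof (rule E.cotangent_eqI[OF \<alpha>])
      show "(\<Sum>c\<in>C. \<alpha> (XV c y) *\<^sub>R vdiff (\<zeta> c) y) \<in> T' y"
        by (intro subspace_sum subspace_scale E.subspace_cotangent_space vdiff_mem)
      fix v assume v: "v \<in> T y"
      note g = connection(2)[OF v]
      have d: "v - \<gamma> y v \<in> T y" by (rule subspace_diff[OF E.subspace_tangent_space v g])
      have "\<gamma> y (v - \<gamma> y v) = 0"
        using linear_on_diff[OF connection(1) E.subspace_tangent_space v g] connection(4)[OF g
            connection(3)[OF v]] by simp
      \<comment> \<open>Since \<alpha> kills the horizontal part of v, only the fibre directions of
        the adapted frame contribute.\<close>
      then have "\<alpha> v = \<alpha> (\<gamma> y v)" using hor0[OF d] E.cotangent_diff[OF \<alpha> v g] by simp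
      also have "\<gamma> y v = (\<Sum>c\<in>C. \<gamma> y v (\<zeta> c) *\<^sub>R XV c y)"
        by (rule trans[OF fr(10)[OF y g]])
           (simp only: connection(3)[OF v] zero_fun_apply scaleR_zero_left sum.neutral_const add_0_left)
      also have "\<alpha> \<dots> = (\<Sum>c\<in>C. \<gamma> y v (\<zeta> c) * \<alpha> (XV c y))" by (rule E.cotangent_sum[OF \<alpha> XVT])
      finally show "\<alpha> v = (\<Sum>c\<in>C. \<alpha> (XV c y) *\<^sub>R vdiff (\<zeta> c) y) v"
        by (simp add: sum_fun_eq scaleR_fun_apply vdiff_apply[OF v] mult.commute)
    qed
    have 1: "lift y w = (\<Sum>b\<in>B. w (\<eta> b) *\<^sub>R hr (Y b) y)"
      unfolding hor_apply by (subst w_eq, rule linear_on_sum[OF linear_on_lift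
          P.subspace_tangent_space YT])
    have 2: "con y w = (\<Sum>b\<in>B. w (\<eta> b) *\<^sub>R con y (Y b (p y)))"
      by (subst w_eq, rule linear_on_sum[OF linear_on_contraction P.subspace_tangent_space YT])
    have 3: "sh y \<alpha> = (\<Sum>c\<in>C. \<alpha> (XV c y) *\<^sub>R ham (\<zeta> c) y)"
      unfolding sharp_vdiff[symmetric]
      by (subst \<alpha>_eq, rule linear_on_sum[OF linear_on_sharp E.subspace_cotangent_space vdiff_mem])
    show ?thesis
    proof (rule prod_eqI)
      show "fst s = fst ((\<Sum>b\<in>B. push (fst s) (\<eta> b) *\<^sub>R hor_section (Y b) y) + (\<Sum>c\<in>C. snd s (XV c y)
          *\<^sub>R vert_section (\<zeta> c) y))"
        unfolding pw \<alpha>c fst_add fst_sum fst_scaleR hor_section_def vert_section_def fst_conv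
        unfolding 1[symmetric] 3[symmetric] s fst_conv ..
      show "snd s = snd ((\<Sum>b\<in>B. push (fst s) (\<eta> b) *\<^sub>R hor_section (Y b) y) + (\<Sum>c\<in>C. snd s (XV c y)
          *\<^sub>R vert_section (\<zeta> c) y))"
        unfolding pw \<alpha>c snd_add snd_sum snd_scaleR hor_section_def vert_section_def snd_conv
        unfolding 2[symmetric] \<alpha>_eq[symmetric] s snd_conv ..
    qed
  qed
  have independent: "(b \<in> B \<longrightarrow> a b = 0) \<and> (c \<in> C \<longrightarrow> a' c = 0)"
    if y: "y \<in> W" and z: "(\<Sum>b\<in>B. a b *\<^sub>R hor_section (Y b) y) + (\<Sum>c\<in>C. a' c *\<^sub>R vert_section (\<zeta> c) y)
        = 0" for y a a' b c
  proof -
    have "fst ((\<Sum>b\<in>B. a b *\<^sub>R hor_section (Y b) y) + (\<Sum>c\<in>C. a' c *\<^sub>R vert_section (\<zeta> c) y)) = 0" using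
        z by simp
    then have f: "(\<Sum>b\<in>B. a b *\<^sub>R hr (Y b) y) + (\<Sum>c\<in>C. a' c *\<^sub>R ham (\<zeta> c) y) = 0"
      unfolding fst_add fst_sum fst_scaleR hor_section_def vert_section_def fst_conv .
    have s: "(\<Sum>b\<in>B. a b *\<^sub>R con y (Y b (p y))) + (\<Sum>c\<in>C. a' c *\<^sub>R vdiff (\<zeta> c) y) = 0"
      using arg_cong[OF z, of snd]
      unfolding snd_add snd_sum snd_scaleR hor_section_def vert_section_def snd_conv snd_zero .
    \<comment> \<open>Pushing forward kills the Hamiltonian fields and leaves a combination of the
      base frame.\<close>
    have "push ((\<Sum>b\<in>B. a b *\<^sub>R hr (Y b) y) + (\<Sum>c\<in>C. a' c *\<^sub>R ham (\<zeta> c) y)) = (\<Sum>b\<in>B. a b *\<^sub>R Y b (p y))"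
      unfolding push_add push_sum push_hor[OF YF(3)] ham(2) by simp
    then have w0: "(\<Sum>b\<in>B. a b *\<^sub>R Y b (p y)) = 0" unfolding f using push_zero by metis
    have ab: "a b = 0" if b: "b \<in> B" for b
    proof -
      have "0 = (\<Sum>i\<in>B. a i *\<^sub>R Y i (p y)) (\<eta> b)" unfolding w0 by (simp add: zero_fun_apply)
      also have "\<dots> = (\<Sum>i\<in>B. if i = b then a i else 0)"
        unfolding sum_fun_eq scaleR_fun_apply by (rule sum.cong) (use YF(5)[OF fr(5)[OF y] _ b] in auto)
      also have "\<dots> = a b" using YF(1) b by simp
      finally show ?thesis by simp
    qed
    have "a' c = 0" if c: "c \<in> C" for c
    proof -
      \<comment> \<open>The vertical coefficients are read off from the covector parts: where the
        bivector degenerates, the Hamiltonian fields may be dependent.\<close>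
      have z0: "(\<Sum>b\<in>B. a b *\<^sub>R con y (Y b (p y))) = 0" by (rule sum.neutral) (simp add: ab)
      have "(\<Sum>c\<in>C. a' c *\<^sub>R vdiff (\<zeta> c) y) = 0" using s unfolding z0 add_0_left .
      then have "0 = (\<Sum>i\<in>C. a' i *\<^sub>R vdiff (\<zeta> i) y) (XV c y)" by (simp add: zero_fun_apply)
      also have "\<dots> = (\<Sum>i\<in>C. if i = c then a' i else 0)"
        unfolding sum_fun_eq scaleR_fun_apply vdiff_vertical[OF XVT fr(8)[OF y]]
        by (rule sum.cong) (use fr(9)[OF y c] in auto)
      also have "\<dots> = a' c" using fr(1) c by simp
      finally show ?thesis by simp
    qed
    then show ?thesis using ab by blast
  qed
  show ?thesis
    by (rule that[OF YF(1) fr(1-3) YF(3,4) fr(7,6) expand]) (use independent in blast)+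
qed

end

section \<open>Smoothness and involutivity\<close>

text \<open>\<open>independent\<close> speaks of a set and would not notice a repeated member of the
  family, so injectivity belongs to the conclusion.\<close>

lemma independent_family:
  fixes s :: "'i \<Rightarrow> 'v::real_vector"
  assumes I: "finite I" and indep: "\<And>a i. (\<Sum>i\<in>I. a i *\<^sub>R s i) = 0 \<Longrightarrow> i \<in> I \<Longrightarrow> a i = 0"
  shows "inj_on s I" "independent (s ` I)"
proof -
  show inj: "inj_on s I"
  proof (rule inj_onI, rule ccontr)
    fix i j assume ij: "i \<in> I" "j \<in> I" "s i = s j" "i \<noteq> j"
    define a :: "'i \<Rightarrow> real" where "a k = (if k = i then 1 else 0) - (if k = j then 1 else 0)" for k
    have "(\<Sum>k\<in>I. a k *\<^sub>R s k) = (\<Sum>k\<in>I. (if k = i then s k else 0) - (if k = j then s k else 0))"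
      by (rule sum.cong) (auto simp: a_def)
    also have "\<dots> = s i - s j" using I ij by (simp add: sum_subtractf)
    finally have "a i = 0" using indep ij by simp
    then show False using ij by (simp add: a_def)
  qed
  show "independent (s ` I)"
  proof (rule independent_if_scalars_zero)
    show "finite (s ` I)" using I by simp
    fix f x assume "(\<Sum>x\<in>s ` I. f x *\<^sub>R x) = 0" "x \<in> s ` I"
    then show "f x = 0" using indep[of "\<lambda>i. f (s i)"] by (auto simp: sum.reindex[OF inj])
  qed
qed

text \<open>The Lie derivative of \<open>Q\<close> along \<open>P\<close>. There is one shuffle with
  two indices in front and there are two with one; the last term is the usual one with the arguments
  of \<open>Q\<close> exchanged, which accounts for its sign.\<close>

lemma schouten_vfield_bivector:
  "schouten 1 2 P Q [f, g] x = P [Q [f, g]] x - Q [P [f], g] x + Q [P [g], f] x"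
proof -
  have 1: "{S::nat set. S \<subseteq> {..<2} \<and> card S = 2} = {{0, 1}}"
  proof -
    have "S = {..<2}" if "S \<subseteq> {..<2}" "card S = 2" for S :: "nat set"
      using that card_subset_eq[of "{..<2::nat}" S] by simp
    then show ?thesis by (auto simp: lessThan_nat_numeral)
  qed
  have 2: "{S::nat set. S \<subseteq> {..<2} \<and> card S = 1} = {{0}, {1}}"
    by (auto simp: card_1_singleton_iff)
  have s: "shuffle_sign 2 {0, 1} = 1" "shuffle_sign 2 {0} = 1" "shuffle_sign 2 {1} = - 1"
  proof -
    have *: "{(i, j). i \<in> {0, 1::nat} \<and> j \<in> {..<2} - {0, 1} \<and> j < i} = {}" by auto
    show "shuffle_sign 2 {0, 1} = 1" unfolding shuffle_sign_def * by simp
    have *: "{(i, j). i \<in> {0::nat} \<and> j \<in> {..<2} - {0} \<and> j < i} = {}" by auto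
    show "shuffle_sign 2 {0} = 1" unfolding shuffle_sign_def * by simp
    have *: "{(i, j). i \<in> {1::nat} \<and> j \<in> {..<2} - {1} \<and> j < i} = {(1, 0)}" by auto
    show "shuffle_sign 2 {1} = - 1" unfolding shuffle_sign_def * by simp
  qed
  have n: "nths [f, g] {0, 1} = [f, g]" "nths [f, g] (- {0, 1}) = []"
    "nths [f, g] {0} = [f]" "nths [f, g] (- {0}) = [g]" "nths [f, g] {1} = [g]" "nths [f, g] (- {1})
        = [f]"
    by (simp_all add: nths_Cons)
  have e: "1 + 2 - 1 = (2::nat)" "(1 - 1) * (2 - 1) = (0::nat)" and d: "{0::nat} \<noteq> {1}" by auto
  show ?thesis
    unfolding schouten_def Let_def e 1 2
    using d by (simp only: sum.insert sum.empty finite.intros insert_iff empty_iff simp_thms n s) simp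
qed

text \<open>Twice the Jacobiator: for p = q = 2 the sign (-1)^((p-1)(q-1)) is -1, so the two equal
  sums are added.\<close>

lemma schouten_bivector_bivector:
  "schouten 2 2 P P [f, g, h] x = 2 * (P [P [f, g], h] x - P [P [f, h], g] x + P [P [g, h], f] x)"
proof -
  have 1: "{S::nat set. S \<subseteq> {..<3} \<and> card S = 2} = {{0, 1}, {0, 2}, {1, 2}}"
  proof (rule set_eqI)
    fix S :: "nat set"
    have three: "{..<3::nat} = {0, 1, 2}" by auto
    have "S \<subseteq> {..<3} \<longleftrightarrow> S \<in> Pow {0, 1, 2}" by (simp add: three)
    also have "\<dots> \<longleftrightarrow> S \<in> {{}, {0}, {1}, {2}, {0, 1}, {0, 2}, {1, 2}, {0, 1, 2}}"
      by (simp add: Pow_insert insert_commute)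
    finally have mem: "S \<subseteq> {..<3} \<longleftrightarrow> S \<in> {{}, {0}, {1}, {2}, {0, 1}, {0, 2}, {1, 2}, {0, 1, 2}}" .
    show "S \<in> {S. S \<subseteq> {..<3} \<and> card S = 2} \<longleftrightarrow> S \<in> {{0, 1}, {0, 2}, {1, 2}}"
    proof
      assume "S \<in> {S. S \<subseteq> {..<3} \<and> card S = 2}"
      then have "S \<in> {{}, {0}, {1}, {2}, {0, 1}, {0, 2}, {1, 2}, {0, 1, 2}}" and c: "card S = 2"
        using mem by simp_all
      then show "S \<in> {{0, 1}, {0, 2}, {1, 2}}" by (elim insertE emptyE) (use c in simp_all)
    next
      assume "S \<in> {{0, 1}, {0, 2}, {1, 2}}"
      then show "S \<in> {S. S \<subseteq> {..<3} \<and> card S = 2}" by (elim insertE emptyE) simp_all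
    qed
  qed
  have s: "shuffle_sign 3 {0, 1} = 1" "shuffle_sign 3 {0, 2} = - 1" "shuffle_sign 3 {1, 2} = 1"
  proof -
    have *: "{(i, j). i \<in> {0, 1::nat} \<and> j \<in> {..<3} - {0, 1} \<and> j < i} = {}" by auto
    show "shuffle_sign 3 {0, 1} = 1" unfolding shuffle_sign_def * by simp
    have *: "{(i, j). i \<in> {0, 2::nat} \<and> j \<in> {..<3} - {0, 2} \<and> j < i} = {(2, 1)}" by auto
    show "shuffle_sign 3 {0, 2} = - 1" unfolding shuffle_sign_def * by simp
    have *: "{(i, j). i \<in> {1, 2::nat} \<and> j \<in> {..<3} - {1, 2} \<and> j < i} = {(1, 0), (2, 0)}" by auto
    show "shuffle_sign 3 {1, 2} = 1" unfolding shuffle_sign_def * by simp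
  qed
  have n: "nths [f, g, h] {0, 1} = [f, g]" "nths [f, g, h] (- {0, 1}) = [h]"
    "nths [f, g, h] {0, 2} = [f, h]" "nths [f, g, h] (- {0, 2}) = [g]"
    "nths [f, g, h] {1, 2} = [g, h]" "nths [f, g, h] (- {1, 2}) = [f]"
    by (simp_all add: nths_Cons numeral_2_eq_2)
  have d: "{0, 1::nat} \<noteq> {0, 2}" "{0, 1::nat} \<noteq> {1, 2}" "{0, 2::nat} \<noteq> {1, 2}"
    by (simp_all add: doubleton_eq_iff)
  have "(\<Sum>S | S \<subseteq> {..<3} \<and> card S = 2. shuffle_sign 3 S * P (P (nths [f, g, h] S) # nths [f, g, h]
      (- S)) x) =
      P [P [f, g], h] x - P [P [f, h], g] x + P [P [g, h], f] x"
    unfolding 1 using d by (simp only: sum.insert sum.empty finite.intros insert_iff empty_iff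
        simp_thms n s)
  then show ?thesis by (simp add: schouten_def Let_def)
qed

context geometric_bundle
begin

section \<open>Smoothness of the subbundle\<close>

lemma smooth_section_on_subset:
  assumes "E.smooth_section s" "open U"
  shows "smooth_section_on A\<^sub>E U s"
  using assms E.smooth_fun_on_subset[of UNIV _ U]
  by (auto simp: smooth_section_on_def smooth_vfield_on_def smooth_form1_on_def)

lemma smooth_subbundle_dirac: "smooth_subbundle A\<^sub>E dirac"
  unfolding smooth_subbundle_def
proof
  fix e
  show "\<exists>U k s. open U \<and> e \<in> U \<and> (\<forall>i<k::nat. smooth_section_on A\<^sub>E U (s i)) \<and>
      (\<forall>y\<in>U. inj_on (\<lambda>i. s i y) {..<k} \<and> independent ((\<lambda>i. s i y) ` {..<k}) \<and> span ((\<lambda>i. s i y) `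
          {..<k}) = dirac y)"
  proof (rule ex_dirac_frame)
    fix B :: "'b set" and C :: "'f set" and XV \<zeta> Y \<eta> W
    assume fin: "finite B" "finite C" and W: "open W" "e \<in> W" and Y: "\<And>b. smooth_vfield A\<^sub>P (Y b)"
      and \<zeta>: "\<And>c. \<zeta> c \<in> E.CInf"
      and expand: "\<And>y s. y \<in> W \<Longrightarrow> s \<in> dirac y \<Longrightarrow> s = (\<Sum>b\<in>B. push (fst s) (\<eta> b) *\<^sub>R hor_section (Y b) y) +
        (\<Sum>c\<in>C. snd s (XV c y) *\<^sub>R vert_section (\<zeta> c) y)"
      and indB: "\<And>y a a' b. y \<in> W \<Longrightarrow> b \<in> B \<Longrightarrow> (\<Sum>b\<in>B. a b *\<^sub>R hor_section (Y b) y) + (\<Sum>c\<in>C. a' c *\<^sub>R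
          vert_section (\<zeta> c) y) = 0 \<Longrightarrow> a b = 0"
      and indC: "\<And>y a a' c. y \<in> W \<Longrightarrow> c \<in> C \<Longrightarrow> (\<Sum>b\<in>B. a b *\<^sub>R hor_section (Y b) y) + (\<Sum>c\<in>C. a' c *\<^sub>R
          vert_section (\<zeta> c) y) = 0 \<Longrightarrow> a' c = 0"
    define t where "t j = (case j of Inl b \<Rightarrow> hor_section (Y b) | Inr c \<Rightarrow> vert_section (\<zeta> c))" for j
    have t: "t j \<in> sections A\<^sub>E dirac" for j
      using hor_section[OF Y] vert_section[OF \<zeta>] by (cases j) (auto simp: t_def)
    have sum_t: "(\<Sum>j\<in>B <+> C. a j *\<^sub>R t j y) =
        (\<Sum>b\<in>B. a (Inl b) *\<^sub>R hor_section (Y b) y) + (\<Sum>c\<in>C. a (Inr c) *\<^sub>R vert_section (\<zeta> c) y)" for a y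
      by (subst sum.Plus[OF fin]) (simp only: t_def sum.case o_def)
    \<comment> \<open>The definition asks for sections numbered from 0 to k - 1, so the disjoint
      union of the two index sets is enumerated by \<open>h\<close>.\<close>
    define k where "k = card (B <+> C)"
    obtain h where h: "bij_betw h {..<k} (B <+> C)"
      using ex_bij_betw_nat_finite[OF finite_Plus[OF fin]] by (auto simp: k_def atLeast0LessThan)
    have frame: "inj_on (\<lambda>i. t (h i) y) {..<k} \<and> independent ((\<lambda>i. t (h i) y) ` {..<k}) \<and>
        span ((\<lambda>i. t (h i) y) ` {..<k}) = dirac y" if y: "y \<in> W" for y
    proof -
      have ind: "a j = 0" if "(\<Sum>j\<in>B <+> C. a j *\<^sub>R t j y) = 0" "j \<in> B <+> C" for a j
        using that(2) indB[OF y _ that(1)[unfolded sum_t]] indC[OF y _ that(1)[unfolded sum_t]] by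
            (elim PlusE) auto
      have fam: "inj_on (\<lambda>j. t j y) (B <+> C)" "independent ((\<lambda>j. t j y) ` (B <+> C))"
        by (rule independent_family[OF finite_Plus[OF fin]], erule (1) ind)+
      have im: "(\<lambda>i. t (h i) y) ` {..<k} = (\<lambda>j. t j y) ` (B <+> C)"
        unfolding bij_betw_imp_surj_on[OF h, symmetric] image_image ..
      have "inj_on ((\<lambda>j. t j y) \<circ> h) {..<k}"
        using h fam(1) by (intro comp_inj_on) (auto simp: bij_betw_def)
      moreover have "span ((\<lambda>j. t j y) ` (B <+> C)) = dirac y"
      proof
        show "span ((\<lambda>j. t j y) ` (B <+> C)) \<subseteq> dirac y"
          using t by (intro span_minimal subspace_dirac) (auto simp: sections_def)
        show "dirac y \<subseteq> span ((\<lambda>j. t j y) ` (B <+> C))"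
        proof
          fix s assume s: "s \<in> dirac y"
          define a where "a j = (case j of Inl b \<Rightarrow> push (fst s) (\<eta> b) | Inr c \<Rightarrow> snd s (XV c y))" for j
          have "s = (\<Sum>j\<in>B <+> C. a j *\<^sub>R t j y)"
            unfolding sum_t a_def sum.case by (rule expand[OF y s])
          also have "\<dots> \<in> span ((\<lambda>j. t j y) ` (B <+> C))"
            by (intro span_sum span_scale span_base) auto
          finally show "s \<in> span ((\<lambda>j. t j y) ` (B <+> C))" .
        qed
      qed
      ultimately show ?thesis using fam(2) unfolding im by (simp add: o_def)
    qed
    show ?thesis
    proof (intro exI conjI ballI allI impI)
      show "open W" "e \<in> W" by (fact W)+
      show "smooth_section_on A\<^sub>E W (t (h i))" if "i < k" for i
        using t smooth_section_on_subset[OF _ W(1)] by (auto simp: sections_def)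
    qed (use frame in auto)
  qed
qed

section \<open>Reduction to generating sections\<close>

lemma sections_diracD:
  assumes "s \<in> sections A\<^sub>E dirac"
  shows "E.smooth_section s" "s y \<in> dirac y"
  using assms by (auto simp: sections_def)

lemma sections_dirac_add:
  "s \<in> sections A\<^sub>E dirac \<Longrightarrow> t \<in> sections A\<^sub>E dirac \<Longrightarrow> (\<lambda>y. s y + t y) \<in> sections A\<^sub>E dirac"
  unfolding sections_def using E.smooth_section_add[of s t] subspace_add[OF subspace_dirac] by blast

lemma sections_dirac_scaleR:
  "g \<in> E.CInf \<Longrightarrow> s \<in> sections A\<^sub>E dirac \<Longrightarrow> (\<lambda>y. g y *\<^sub>R s y) \<in> sections A\<^sub>E dirac"
  unfolding sections_def using E.smooth_section_scaleR[of g s] subspace_scale[OF subspace_dirac] by blast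

text \<open>All members are global sections, yet every local frame from
  \<open>ex_dirac_frame\<close> consists of them. So they span D at each point and can be
  substituted in the Courant tensor slot by slot.\<close>

definition generators :: "('e \<Rightarrow> 'e tvec \<times> 'e covec) set"
  where "generators = hor_section ` {u. smooth_vfield A\<^sub>P u} \<union> vert_section ` E.CInf"

lemma generators_sections: "g \<in> generators \<Longrightarrow> g \<in> sections A\<^sub>E dirac"
  using hor_section vert_section by (auto simp: generators_def)

text \<open>Only the first slot is reduced. The other two stay arbitrary sections of D: this
  provides the isotropy on which linearity over smooth functions rests, and rotation brings them
  into the first slot later.\<close>

lemma courant_tensor_generators:
  assumes t: "t \<in> sections A\<^sub>E dirac" and r: "r \<in> sections A\<^sub>E dirac"
    and gen: "\<And>g. g \<in> generators \<Longrightarrow> E.courant_tensor g t r x = 0" and s: "s \<in> sections A\<^sub>E dirac"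
  shows "E.courant_tensor s t r x = 0"
proof (rule ex_dirac_frame)
  fix B :: "'b set" and C :: "'f set" and XV \<zeta> Y \<eta> W
  assume fin: "finite B" "finite C" and W: "open W" "x \<in> W" and Y: "\<And>b. smooth_vfield A\<^sub>P (Y b)"
    and \<eta>: "\<And>b. \<eta> b \<in> P.CInf" and \<zeta>: "\<And>c. \<zeta> c \<in> E.CInf" and XV: "\<And>c. smooth_vfield A\<^sub>E (XV c)"
    and expand: "\<And>y s. y \<in> W \<Longrightarrow> s \<in> dirac y \<Longrightarrow> s = (\<Sum>b\<in>B. push (fst s) (\<eta> b) *\<^sub>R hor_section (Y b) y) +
      (\<Sum>c\<in>C. snd s (XV c y) *\<^sub>R vert_section (\<zeta> c) y)"
  note sD = sections_diracD[OF s]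
  define e where "e j = (case j of Inl b \<Rightarrow> hor_section (Y b) | Inr c \<Rightarrow> vert_section (\<zeta> c))" for j
  define f where "f j y = (case j of Inl b \<Rightarrow> push (fst (s y)) (\<eta> b) | Inr c \<Rightarrow> snd (s y) (XV c y))"
      for j y
  have e: "e j \<in> generators" for j
    using Y \<zeta> by (cases j) (auto simp: e_def generators_def)
  have f: "f j \<in> E.CInf" for j
  proof (cases j)
    case (Inl b)
    then have "f j = (\<lambda>y. fst (s y) (\<eta> b \<circ> p))" by (simp add: f_def push_apply[OF \<eta>] fun_eq_iff)
    then show ?thesis using E.smooth_vfieldD(2)[OF E.smooth_sectionD(1)[OF sD(1)]
        smooth_fun_projection[OF \<eta>]] by simp
  next
    case (Inr c)
    then have "f j = (\<lambda>y. snd (s y) (XV c y))" by (simp add: f_def fun_eq_iff)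
    then show ?thesis using E.smooth_form1D(2)[OF E.smooth_sectionD(2)[OF sD(1)] XV] by simp
  qed
  have "E.courant_tensor s t r x = (\<Sum>j\<in>B <+> C. f j x * E.courant_tensor (e j) t r x)"
  proof (rule E.module_functional_expand[where S = "sections A\<^sub>E dirac" and W = W])
    show "s y = (\<Sum>j\<in>B <+> C. f j y *\<^sub>R e j y)" if "y \<in> W" for y
      by (subst sum.Plus[OF fin]) (simp only: e_def f_def sum.case o_def expand[OF that sD(2),
          symmetric])
    show "E.courant_tensor (\<lambda>y. s y + s' y) t r x = E.courant_tensor s t r x + E.courant_tensor s' t r x"
      if "s \<in> sections A\<^sub>E dirac" "s' \<in> sections A\<^sub>E dirac" for s s'
      by (intro E.courant_tensor_add sections_diracD that t r)
    show "E.courant_tensor (\<lambda>y. g y *\<^sub>R s y) t r x = g x * E.courant_tensor s t r x"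
      if "g \<in> E.CInf" "s \<in> sections A\<^sub>E dirac" for g s
      by (intro E.courant_tensor_scaleR dirac_isotropic[of _ x] sections_diracD that t r)
  qed (use sections_dirac_add sections_dirac_scaleR W fin s f generators_sections[OF e] in auto)
  then show ?thesis using gen[OF e] by simp
qed

text \<open>For p-related fields X and u, differentiating a pulled-back function along X is pulling
  back its derivative along u; this is applied twice. The relation is required at all points, since
  the bracket differentiates.\<close>

lemma push_lie_bracket:
  assumes X: "smooth_vfield A\<^sub>E X" "\<And>y. push (X y) = u (p y)" and Y: "smooth_vfield A\<^sub>E Y" "\<And>y. push
      (Y y) = v (p y)"
    and u: "smooth_vfield A\<^sub>P u" and v: "smooth_vfield A\<^sub>P v"
  shows "push (lie_bracket X Y e) = lie_bracket u v (p e)"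
proof
  fix g
  show "push (lie_bracket X Y e) g = lie_bracket u v (p e) g"
  proof (cases "g \<in> P.CInf")
    case False
    then show ?thesis
      using P.tangent_spaceD(4)[OF P.lie_bracket_mem_tangent_space[OF u v]] by (simp add:
          pushforward_def)
  next
    case True
    note uv = P.smooth_vfieldD(2)[OF u True] P.smooth_vfieldD(2)[OF v True]
    have X': "X y (g \<circ> p) = u (p y) g" if "g \<in> P.CInf" for g y using push_apply[OF that, of "X y"]
        X(2)[of y] by simp
    have Y': "Y y (g \<circ> p) = v (p y) g" if "g \<in> P.CInf" for g y using push_apply[OF that, of "Y y"]
        Y(2)[of y] by simp
    have "X e (\<lambda>y. v (p y) g) = u (p e) (\<lambda>x. v x g)" "Y e (\<lambda>y. u (p y) g) = v (p e) (\<lambda>x. u x g)"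
      using X'[OF uv(2)] Y'[OF uv(1)] by (simp_all add: o_def)
    then show ?thesis by (simp add: push_apply[OF True] lie_bracket_def X'[OF True] Y'[OF True])
  qed
qed

text \<open>A vertical field is p-related to the zero field, and brackets with the zero field
  vanish.\<close>

lemma push_lie_bracket_vertical:
  assumes X: "smooth_vfield A\<^sub>E X" "\<And>y. push (X y) = u (p y)" and Y: "smooth_vfield A\<^sub>E Y" "\<And>y. push
      (Y y) = 0"
    and u: "smooth_vfield A\<^sub>P u"
  shows "push (lie_bracket X Y e) = 0" "push (lie_bracket Y X e) = 0"
proof -
  have "push (lie_bracket X Y e) = lie_bracket u (\<lambda>_. 0) (p e)"
    by (rule push_lie_bracket[OF X Y u P.smooth_vfield_zero])
  also have "\<dots> = 0"
    using P.tangent_const[OF P.smooth_vfieldD(1)[OF u], of _ 0] by (simp add: lie_bracket_def fun_eq_iff)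
  finally show 1: "push (lie_bracket X Y e) = 0" .
  have "lie_bracket Y X e = - 1 *\<^sub>R lie_bracket X Y e" using E.lie_bracket_minus[of Y X e] by simp
  then show "push (lie_bracket Y X e) = 0" using 1 push_scaleR[where c = "- 1"] by (metis
      scaleR_zero_right)
qed

section \<open>The Courant tensor on the four types of generating triples\<close>

lemma contraction_hor:
  assumes "smooth_vfield A\<^sub>P u" "smooth_vfield A\<^sub>P v"
  shows "con e (u (p e)) (hr v e) = F e (u (p e)) (v (p e))"
  using contraction_apply[OF E.smooth_vfieldD(1)[OF smooth_vfield_hor[OF assms(2)]]] push_hor[OF
      assms(2)] by simp

lemma contraction_ham: "smooth_vfield A\<^sub>P u \<Longrightarrow> con e (u (p e)) (ham f e) = 0"
  by (rule contraction_vertical[OF P.smooth_vfieldD(1) ham(1,2)])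

lemma vdiff_hor:
  assumes "smooth_vfield A\<^sub>P u"
  shows "vdiff f e (hr u e) = 0"
proof -
  note L = lift[OF P.smooth_vfieldD(1)[OF assms]]
  show ?thesis
    using L(2)[of e] by (simp add: hor_apply vdiff_apply[OF L(1)] zero_fun_apply)
qed

lemma vdiff_ham: "vdiff f e (ham g e) = ham g e f"
  by (rule vdiff_vertical[OF ham(1,2)])

lemmas section_simps = hor_section_def vert_section_def fst_conv snd_conv

text \<open>Contractions of \<open>F\<close> see only the projections of the brackets, which are the
  brackets on P. The six terms thus become those of the covariant derivative of \<open>F\<close> on
  u, v, w, up to the antisymmetry of \<open>F\<close> and of the bracket.\<close>

lemma courant_tensor_HHH:
  assumes u: "smooth_vfield A\<^sub>P u" and v: "smooth_vfield A\<^sub>P v" and w: "smooth_vfield A\<^sub>P w"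
  shows "E.courant_tensor (hor_section u) (hor_section v) (hor_section w) e = 0"
proof -
  note T = P.smooth_vfieldD(1)[OF u] P.smooth_vfieldD(1)[OF v] P.smooth_vfieldD(1)[OF w]
  note H = smooth_vfield_hor[OF u] smooth_vfield_hor[OF v] smooth_vfield_hor[OF w]
  have br: "con e (a (p e)) (lie_bracket (hr b) (hr c) e) = F e (a (p e)) (lie_bracket b c (p e))"
    if "smooth_vfield A\<^sub>P a" "smooth_vfield A\<^sub>P b" "smooth_vfield A\<^sub>P c" for a b c
    using contraction_apply[OF E.lie_bracket_mem_tangent_space[OF smooth_vfield_hor[OF that(2)]
        smooth_vfield_hor[OF that(3)]]]
      push_lie_bracket[OF smooth_vfield_hor[OF that(2)] push_hor[OF that(2)] smooth_vfield_hor[OF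
          that(3)] push_hor[OF that(3)] that(2,3)]
    by simp
  have "covariant_deriv A\<^sub>E A\<^sub>P p \<gamma> 2 (eval_form2 p F) [u, v, w] e = 0"
    using geometric u v w unfolding geometric_data_def by blast
  moreover have "eval_form2 p F [a, b] = (\<lambda>e. F e (a (p e)) (b (p e)))" for a b
    by (simp add: eval_form2_def fun_eq_iff)
  ultimately have closed: "hr u e (\<lambda>e. F e (v (p e)) (w (p e))) - hr v e (\<lambda>e. F e (u (p e)) (w (p e))) +
      hr w e (\<lambda>e. F e (u (p e)) (v (p e))) - F e (lie_bracket u v (p e)) (w (p e)) +
      F e (lie_bracket u w (p e)) (v (p e)) - F e (lie_bracket v w (p e)) (u (p e)) = 0"
    by (simp add: covariant_deriv_def numeral_2_eq_2 nths_Cons lessThan_Suc)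
  have 1: "hr v e (\<lambda>e. F e (w (p e)) (u (p e))) = - hr v e (\<lambda>e. F e (u (p e)) (w (p e)))"
    unfolding two_form(3)[OF T(3) T(1)]
    by (rule E.tangent_minus[OF E.smooth_vfieldD(1)[OF H(2)] two_form(4)[OF u w]])
  have 2: "F e (a (p e)) (lie_bracket b c (p e)) = - F e (lie_bracket b c (p e)) (a (p e))"
    if "smooth_vfield A\<^sub>P a" "smooth_vfield A\<^sub>P b" "smooth_vfield A\<^sub>P c" for a b c
    by (rule two_form(3)[OF P.smooth_vfieldD(1)[OF that(1)] P.lie_bracket_mem_tangent_space[OF
        that(2,3)]])
  have 3: "F e (lie_bracket w u (p e)) (v (p e)) = - F e (lie_bracket u w (p e)) (v (p e))"
    using linear_onD(2)[OF two_form(2)[OF T(2)] P.lie_bracket_mem_tangent_space[OF u w], where c = "- 1"]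
    by (simp add: P.lie_bracket_minus[of w u])
  show ?thesis
    unfolding E.courant_tensor_def section_simps contraction_hor[OF v w] contraction_hor[OF w u]
        contraction_hor[OF u v]
      br[OF u v w] br[OF v w u] br[OF w u v] 1 2[OF u v w] 2[OF v w u] 2[OF w u v] 3
    using closed by simp
qed

text \<open>Two terms survive: the derivative of F(u, v) along the Hamiltonian field of f, and the
  value of \<open>vdiff f\<close> on the bracket of the lifts, which sees only the curvature. The
  curvature is the Hamiltonian field of F(u, v), so the two cancel by antisymmetry of the
  bivector.\<close>

lemma courant_tensor_HHV:
  assumes u: "smooth_vfield A\<^sub>P u" and v: "smooth_vfield A\<^sub>P v" and f: "f \<in> E.CInf"
  shows "E.courant_tensor (hor_section u) (hor_section v) (vert_section f) e = 0"
proof -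
  note H = smooth_vfield_hor[OF u] smooth_vfield_hor[OF v] and V = ham(3)[OF f]
  let ?G = "\<lambda>e. F e (u (p e)) (v (p e))"
  have G: "?G \<in> E.CInf" by (rule two_form(4)[OF u v])
  have 1: "con e (u (p e)) (lie_bracket (hr v) (ham f) e) = 0"
    by (rule contraction_vertical[OF P.smooth_vfieldD(1)[OF u] E.lie_bracket_mem_tangent_space[OF H(2) V]
          push_lie_bracket_vertical(1)[OF H(2) push_hor[OF v] V ham(2) v]])
  have 2: "con e (v (p e)) (lie_bracket (ham f) (hr u) e) = 0"
    by (rule contraction_vertical[OF P.smooth_vfieldD(1)[OF v] E.lie_bracket_mem_tangent_space[OF V H(1)]
          push_lie_bracket_vertical(2)[OF H(1) push_hor[OF u] V ham(2) u]])
  have uv: "smooth_vfield A\<^sub>P (lie_bracket u v)" by (rule P.smooth_vfield_lie_bracket[OF u v])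
  note L = lift[OF P.smooth_vfieldD(1)[OF uv]]
  have "curvature A\<^sub>E A\<^sub>P p \<gamma> u v e = sh e (differential A\<^sub>E ?G e)"
    using geometric u v unfolding geometric_data_def by blast
  then have curv: "lie_bracket (hr u) (hr v) e - hr (lie_bracket u v) e = ham ?G e"
    by (simp add: curvature_def ham_def)
  have hl: "hr (lie_bracket u v) e \<in> T e" by (rule E.smooth_vfieldD(1)[OF smooth_vfield_hor[OF uv]])
  have "vdiff f e (lie_bracket (hr u) (hr v) e) - vdiff f e (hr (lie_bracket u v) e) = ham ?G e f"
    using E.cotangent_diff[OF vdiff_mem E.lie_bracket_mem_tangent_space[OF H] hl] vdiff_ham[of f e
        ?G] unfolding curv by simp
  then have 3: "vdiff f e (lie_bracket (hr u) (hr v) e) = - ham f e ?G"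
    unfolding vdiff_hor[OF uv] ham(5)[of ?G e f] by simp
  show ?thesis
    unfolding E.courant_tensor_def section_simps contraction_hor[OF u v] contraction_ham[OF v]
        vdiff_hor[OF u] 1 2 3
    by (simp add: E.tangent_const[OF E.smooth_vfieldD(1)[OF H(1)]] E.tangent_const[OF
        E.smooth_vfieldD(1)[OF H(2)]])
qed

text \<open>Writing {f, g} for \<open>ham f\<close> applied to g and D_u for the derivative along
  the horizontal lift, the surviving terms add up to D_u {f, g} - {D_u f, g} - {f, D_u g}, the Lie
  derivative of the bivector evaluated on df and dg.\<close>

lemma courant_tensor_HVV:
  assumes u: "smooth_vfield A\<^sub>P u" and f: "f \<in> E.CInf" and g: "g \<in> E.CInf"
  shows "E.courant_tensor (hor_section u) (vert_section f) (vert_section g) e = 0"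
proof -
  note H = smooth_vfield_hor[OF u] and Vf = ham(3)[OF f] and Vg = ham(3)[OF g]
  have 1: "con e (u (p e)) (lie_bracket (ham f) (ham g) e) = 0"
    by (rule contraction_vertical[OF P.smooth_vfieldD(1)[OF u] E.lie_bracket_mem_tangent_space[OF Vf Vg]
          push_lie_bracket_vertical(1)[OF Vf ham(2) Vg ham(2) P.smooth_vfield_zero]])
  have 2: "vdiff f e (lie_bracket (ham g) (hr u) e) = ham g e (\<lambda>y. hr u y f) - hr u e (\<lambda>y. ham g y f)"
    using vdiff_vertical[OF E.lie_bracket_mem_tangent_space[OF Vg H]
        push_lie_bracket_vertical(2)[OF H push_hor[OF u] Vg ham(2) u]] by (simp add: lie_bracket_def)
  have 3: "vdiff g e (lie_bracket (hr u) (ham f) e) = hr u e (\<lambda>y. ham f y g) - ham f e (\<lambda>y. hr u y g)"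
    using vdiff_vertical[OF E.lie_bracket_mem_tangent_space[OF H Vf]
        push_lie_bracket_vertical(1)[OF H push_hor[OF u] Vf ham(2) u]] by (simp add: lie_bracket_def)
  have mb: "multivector_of_bivector A\<^sub>E PiV [a, b] = (\<lambda>y. ham a y b)" for a b
    by (simp add: multivector_of_bivector_def ham(4) fun_eq_iff)
  have mv: "multivector_of_vfield (hr u) [a] = (\<lambda>y. hr u y a)" for a
    by (simp add: multivector_of_vfield_def fun_eq_iff)
  have "schouten 1 2 (multivector_of_vfield (hr u)) (multivector_of_bivector A\<^sub>E PiV) [f, g] e = 0"
    using geometric u f g unfolding geometric_data_def by blast
  then have "hr u e (\<lambda>y. ham f y g) - ham (\<lambda>y. hr u y f) e g + ham (\<lambda>y. hr u y g) e f = 0"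
    unfolding schouten_vfield_bivector mb mv .
  then have inv: "hr u e (\<lambda>y. ham f y g) + ham g e (\<lambda>y. hr u y f) - ham f e (\<lambda>y. hr u y g) = 0"
    using ham(5)[of "\<lambda>y. hr u y f" e g] ham(5)[of "\<lambda>y. hr u y g" e f] by simp
  show ?thesis
    unfolding E.courant_tensor_def section_simps contraction_ham[OF u] vdiff_hor[OF u] vdiff_ham 1 2 3
    using inv by (simp add: E.tangent_const[OF ham(1)])
qed

text \<open>The three differentiated pairings contribute minus the cyclic Jacobi sum of f, g, h, and
  the three brackets contribute twice that sum. Their total is the Jacobi sum itself, which
  vanishes.\<close>

lemma courant_tensor_VVV:
  assumes f: "f \<in> E.CInf" and g: "g \<in> E.CInf" and h: "h \<in> E.CInf"
  shows "E.courant_tensor (vert_section f) (vert_section g) (vert_section h) e = 0"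
proof -
  have 1: "vdiff a e (lie_bracket (ham b) (ham c) e) = ham b e (\<lambda>y. ham c y a) - ham c e (\<lambda>y. ham b y a)"
    if "b \<in> E.CInf" "c \<in> E.CInf" for a b c
    using vdiff_vertical[OF E.lie_bracket_mem_tangent_space[OF ham(3)[OF that(1)] ham(3)[OF that(2)]]
        push_lie_bracket_vertical(1)[OF ham(3)[OF that(1)] ham(2) ham(3)[OF that(2)] ham(2)
            P.smooth_vfield_zero]]
    by (simp add: lie_bracket_def)
  have mb: "multivector_of_bivector A\<^sub>E PiV [a, b] = (\<lambda>y. ham a y b)" for a b
    by (simp add: multivector_of_bivector_def ham(4) fun_eq_iff)
  have "schouten 2 2 (multivector_of_bivector A\<^sub>E PiV) (multivector_of_bivector A\<^sub>E PiV) [f, g, h] e = 0"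
    using geometric f g h unfolding geometric_data_def by blast
  then have "ham (\<lambda>y. ham f y g) e h - ham (\<lambda>y. ham f y h) e g + ham (\<lambda>y. ham g y h) e f = 0"
    unfolding schouten_bivector_bivector mb by simp
  then have "ham h e (\<lambda>y. ham f y g) - ham g e (\<lambda>y. ham f y h) + ham f e (\<lambda>y. ham g y h) = 0"
    using ham(5)[of "\<lambda>y. ham f y g" e h] ham(5)[of "\<lambda>y. ham f y h" e g] ham(5)[of "\<lambda>y. ham g y h" e
        f] by simp
  moreover have "ham g e (\<lambda>y. ham h y f) = - ham g e (\<lambda>y. ham f y h)"
    unfolding ham(5)[of h _ f] by (rule E.tangent_minus[OF ham(1) E.smooth_vfieldD(2)[OF ham(3)[OF
        f] h]])
  ultimately show ?thesis
    unfolding E.courant_tensor_def section_simps vdiff_ham 1[OF f g] 1[OF g h] 1[OF h f] by simp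
qed

lemma courant_tensor_zero_generators:
  assumes "s \<in> generators" "t \<in> generators" "r \<in> generators"
  shows "E.courant_tensor s t r e = 0"
proof -
  \<comment> \<open>Up to rotation the eight type patterns reduce to the four computed ones.\<close>
  note VHH = trans[OF E.courant_tensor_cyclic courant_tensor_HHV]
  note HVH = trans[OF E.courant_tensor_cyclic VHH]
  note VVH = trans[OF E.courant_tensor_cyclic courant_tensor_HVV]
  note VHV = trans[OF E.courant_tensor_cyclic VVH]
  have cases: "(\<exists>u. smooth_vfield A\<^sub>P u \<and> g = hor_section u) \<or> (\<exists>f. f \<in> E.CInf \<and> g = vert_section f)"
    if "g \<in> generators" for g
    using that by (auto simp: generators_def)
  show ?thesis
    using cases[OF assms(1)] cases[OF assms(2)] cases[OF assms(3)]
    by (elim disjE exE conjE;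
        simp only: courant_tensor_HHH courant_tensor_HHV courant_tensor_HVV courant_tensor_VVV VHH
            HVH VVH VHV)
qed

lemma courant_tensor_zero:
  assumes s: "s \<in> sections A\<^sub>E dirac" and t: "t \<in> sections A\<^sub>E dirac" and r: "r \<in> sections A\<^sub>E dirac"
  shows "E.courant_tensor s t r e = 0"
proof (rule courant_tensor_generators[OF t r _ s])
  fix g1 assume g1: "g1 \<in> generators"
  \<comment> \<open>With a generator fixed in one slot, rotation moves the next arbitrary section to
    the front; after three rounds only generators are left.\<close>
  have "E.courant_tensor t r g1 e = 0"
  proof (rule courant_tensor_generators[OF r generators_sections[OF g1] _ t])
    fix g2 assume g2: "g2 \<in> generators"
    have "E.courant_tensor r g1 g2 e = 0"
      by (rule courant_tensor_generators[OF generators_sections[OF g1] generators_sections[OF g2] _ r])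
         (rule courant_tensor_zero_generators[OF _ g1 g2])
    then show "E.courant_tensor g2 r g1 e = 0" by (simp only: E.courant_tensor_cyclic[of g2])
  qed
  then show "E.courant_tensor g1 t r e = 0" by (simp only: E.courant_tensor_cyclic[of g1])
qed

lemma courant_bracket_sections:
  assumes s: "s \<in> sections A\<^sub>E dirac" and t: "t \<in> sections A\<^sub>E dirac"
  shows "courant_bracket A\<^sub>E s t \<in> sections A\<^sub>E dirac"
proof -
  let ?c = "courant_bracket A\<^sub>E s t"
  have c: "E.smooth_section ?c"
    by (rule E.smooth_section_courant_bracket[OF sections_diracD(1)[OF s] sections_diracD(1)[OF t]])
  note cT = E.smooth_sectionD(3,4)[OF c]
  have "?c e \<in> dirac e" for e
  proof -
    have gen: "pairing (g e) (?c e) = 0" if "g \<in> generators" for g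
    proof -
      note g = generators_sections[OF that]
      have "2 * pairing (?c e) (g e) = E.courant_tensor s t g e"
        by (rule E.pairing_courant_bracket[OF sections_diracD(1)[OF s] sections_diracD(1)[OF t]
            sections_diracD(1)[OF g]])
           (rule dirac_isotropic[OF sections_diracD(2)[OF s] sections_diracD(2)[OF g]])
      then show ?thesis using courant_tensor_zero[OF s t g, of e] by (simp add: pairing_commute)
    qed
    have "(fst (?c e), snd (?c e)) \<in> dirac e"
    proof (rule dirac_perp[OF cT])
      fix r assume r: "r \<in> dirac e"
      \<comment> \<open>An element of D at e is only a vector, while the Courant tensor needs
        sections. Values of generators span D at e, and orthogonality to the bracket is a linear
        condition, so testing on generators is enough.\<close>
      have "dirac e \<subseteq> span ((\<lambda>g. g e) ` generators)"
      proof (rule ex_dirac_frame)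
        fix B :: "'b set" and C :: "'f set" and XV \<zeta> Y \<eta> W
        assume W: "e \<in> W" and Y: "\<And>b. smooth_vfield A\<^sub>P (Y b)" and \<zeta>: "\<And>c. \<zeta> c \<in> E.CInf"
          and expand: "\<And>y s. y \<in> W \<Longrightarrow> s \<in> dirac y \<Longrightarrow> s = (\<Sum>b\<in>B. push (fst s) (\<eta> b) *\<^sub>R hor_section (Y
              b) y) +
            (\<Sum>c\<in>C. snd s (XV c y) *\<^sub>R vert_section (\<zeta> c) y)"
        show ?thesis
        proof
          fix r assume "r \<in> dirac e"
          have "(\<Sum>b\<in>B. push (fst r) (\<eta> b) *\<^sub>R hor_section (Y b) e) +
            (\<Sum>c\<in>C. snd r (XV c e) *\<^sub>R vert_section (\<zeta> c) e) \<in> span ((\<lambda>g. g e) ` generators)"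
            by (intro span_add span_sum span_scale span_base) (use Y \<zeta> in \<open>auto simp: generators_def\<close>)
          then show "r \<in> span ((\<lambda>g. g e) ` generators)" using expand[OF W \<open>r \<in> dirac e\<close>] by metis
        qed
      qed
      moreover have "span ((\<lambda>g. g e) ` generators) \<subseteq> {r \<in> dirac e. pairing r (?c e) = 0}"
      proof (rule span_minimal)
        show "(\<lambda>g. g e) ` generators \<subseteq> {r \<in> dirac e. pairing r (?c e) = 0}"
          using gen sections_diracD(2)[OF generators_sections] by auto
        show "subspace {r \<in> dirac e. pairing r (?c e) = 0}"
        proof (rule subspaceI)
          show "0 \<in> {r \<in> dirac e. pairing r (?c e) = 0}"
            using subspace_0[OF subspace_dirac] E.cotangent_zero[OF cT(2)] by (simp add: pairing_def)
          fix r r' assume "r \<in> {r \<in> dirac e. pairing r (?c e) = 0}" "r' \<in> {r \<in> dirac e. pairing r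
              (?c e) = 0}"
          then show "r + r' \<in> {r \<in> dirac e. pairing r (?c e) = 0}"
            using pairing_linear(1)[OF dirac_subset dirac_subset cT] subspace_add[OF subspace_dirac]
                by simp
        next
          fix k r assume "r \<in> {r \<in> dirac e. pairing r (?c e) = 0}"
          then have r: "r \<in> dirac e" "pairing r (?c e) = 0" by auto
          then show "k *\<^sub>R r \<in> {r \<in> dirac e. pairing r (?c e) = 0}"
            using pairing_linear(2)[OF dirac_subset[OF r(1)] dirac_subset[OF r(1)] cT]
                subspace_scale[OF subspace_dirac] by simp
        qed
      qed
      ultimately have "pairing r (?c e) = 0" using r by blast
      then show "pairing (fst (?c e), snd (?c e)) r = 0" by (simp only: prod.collapse pairing_commute)
    qed
    then show ?thesis by (simp only: prod.collapse)
  qed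
  then show ?thesis using c by (simp add: sections_def)
qed

end

theorem theorem5p4:
  fixes A\<^sub>E :: "('e::{t2_space,second_countable_topology}, 'm::real_inner) chart set"
    and A\<^sub>P :: "('p::{t2_space,second_countable_topology}, 'b::real_inner) chart set"
    and p :: "'e \<Rightarrow> 'p"
    and vadd :: "'e \<Rightarrow> 'e \<Rightarrow> 'e" and vscale :: "real \<Rightarrow> 'e \<Rightarrow> 'e"
    and Triv :: "('p set \<times> ('e \<Rightarrow> 'f::real_inner)) set"
    and \<gamma> :: "'e \<Rightarrow> 'e tvec \<Rightarrow> 'e tvec"
    and PiV :: "'e \<Rightarrow> 'e covec \<Rightarrow> 'e covec \<Rightarrow> real"
    and F :: "'e \<Rightarrow> 'p tvec \<Rightarrow> 'p tvec \<Rightarrow> real"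
  assumes "smooth_vector_bundle A\<^sub>E A\<^sub>P p vadd vscale Triv"
    and "geometric_data A\<^sub>E A\<^sub>P p \<gamma> PiV F"
  shows "dirac_structure A\<^sub>E (induced_dirac A\<^sub>E A\<^sub>P p \<gamma> PiV F)"
proof -
  interpret geometric_bundle A\<^sub>E A\<^sub>P p vadd vscale Triv \<gamma> PiV F
    by unfold_locales (fact assms)+
  show ?thesis
    unfolding dirac_structure_def
    using smooth_subbundle_dirac maximal_isotropic_dirac courant_bracket_sections by blast
qed

end
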